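(* Let $X$ be a finite regular CW complex, let $f$ be a discrete Morse function on $X$ with induced Morse system $\Sigma$, and let $C=\mathrm{Flo}_\Sigma[X]$ be its discrete flow category. Then the spectral sequence $\{E^r_{*,*},\partial^r\}$ associated to the double nerve of $C$ collapses on page $2$, i.e. $\partial^r=0$ for all $r\ge 2$.
   Context: A regular CW complex is a CW complex in which every attaching map is a homeomorphism onto its image. For cells write $y<x$ (or $x>y$) if $y\neq x$ and $y$ is contained in the closure of $x$. Discrete Morse functions. A discrete Morse function on a regular CW complex $X$ assigns a real number $f(x)$ to each cell such that for each $k$-cell $x$ there is at most one $(k+1)$-cell $y>x$ with $f(x)\ge f(y)$ and at most one $(k-1)$-cell $y<x$ with $f(y)\ge f(x)$. A regular pair is a pair $\{x,y\}$ with $x$ a $k$-cell, $y$ a $(k+1)$-cell, $x<y$ and $f(x)\ge f(y)$. Regular pairs are pairwise disjoint. A cell is critical if it lies in no regular pair. A p-category is a category whose Hom sets are posets (order written $\Rightarrow$) such that composition is monotone. Entrance path category $\mathrm{Ent}[X]$: objects are the cells of $X$; morphisms $x\to y$ are strictly descending sequences of cells $(x=x_0>x_1>\dots>x_k=y)$, with $\mathrm{id}_x=(x)$; composition is concatenation of sequences (merging the common cell); $g\Rightarrow g'$ iff $g$ is a (not necessarily contiguous) subsequence of $g'$. Morse system: $\Sigma$ is the set of morphisms $(y>x)\colon y\to x$ with $\{x,y\}$ a regular pair ($x<y$); $\Sigma^+$ is $\Sigma$ together with all identities. Localization $\mathrm{Loc}_\Sigma[X]$: objects are the cells of $X$. Morphisms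 $w\to z$ are equivalence classes of zigzags $$w=x_0\xrightarrow{g_0}y_0\xleftarrow{f_0}x_1\xrightarrow{g_1}y_1\xleftarrow{f_1}\cdots\xleftarrow{f_{k-1}}x_k\xrightarrow{g_k}y_k=z$$ with $k\ge 0$, $g_i$ arbitrary morphisms of $\mathrm{Ent}[X]$ and $f_i\colon x_{i+1}\to y_i$ in $\Sigma^+$. The equivalence relation is generated by: (horizontal) inserting or deleting intermediate identity maps, i.e. exchanging $x_i\xrightarrow{g_i}y_i\xleftarrow{\mathrm{id}}y_i\xrightarrow{g_{i+1}}y_{i+1}$ with $x_i\xrightarrow{g_{i+1}\circ g_i}y_{i+1}$; (vertical) identifying zigzags $(x_i,y_i,g_i,f_i)$ and $(x_i',y_i',g_i',f_i')$ of the same length when there are $u_i\colon y_i\to y_i'$ and $v_i\colon x_i\to x_i'$ in $\Sigma^+$ with $v_0=\mathrm{id}_w$, $u_k=\mathrm{id}_z$, $u_i\circ g_i=g_i'\circ v_i$ and $u_i\circ f_i=f_i'\circ v_{i+1}$. The order: $[\gamma']\Rightarrow[\gamma]$ iff there are representatives $(x_i',y_i',g_i',f_i')$ of $[\gamma']$ and $(x_i,y_i,g_i,f_i)$ of $[\gamma]$ of the same length and $u_i\colon y_i\to y_i'$, $v_i\colon x_i\to x_i'$ in $\Sigma^+$ with $v_0=\mathrm{id}_w$, $u_k=\mathrm{id}_z$, $g_i'\circ v_i\Rightarrow u_i\circ g_i$ and $f_i'\circ v_{i+1}\Rightarrow u_i\circ f_i$. Composition is concatenation of zigzags (composing the two adjacent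 right-pointing arrows). The discrete flow category $\mathrm{Flo}_\Sigma[X]$ is the full sub-p-category of $\mathrm{Loc}_\Sigma[X]$ on the critical cells of $f$. Double nerve. For a p-category $C$ and $p\ge 0$, let $(\overline{N}C)([p])$ be the category with the same objects as $C$, whose morphisms $a\to b$ are chains $h_0\Rightarrow h_1\Rightarrow\dots\Rightarrow h_p$ in $\mathrm{Hom}_C(a,b)$ (the $p$-simplices of the nerve of this poset), composed termwise; with the face and degeneracy maps of these nerves, $\overline{N}C$ is a simplicial category. The double nerve $S$ of $C$ is the bisimplicial set with $S_{p,q}$ the set of $q$-simplices of the (ordinary) nerve of $(\overline{N}C)([p])$. Spectral sequence. To a bisimplicial set $S$ associate the first-quadrant double complex $FS$ with $(FS)_{p,q}=\mathbb{Z}S_{p,q}$ (free abelian group), horizontal differential $\partial_h=\sum_i(-1)^i(d_i,\mathrm{id})$ (lowering $p$) and vertical differential $\partial_v=\sum_i(-1)^i(\mathrm{id},d_i)$ (lowering $q$). The associated spectral sequence is the standard spectral sequence of the double complex obtained by taking vertical homology first: $E^0_{p,q}=(FS)_{p,q}$ with $\partial^0$ given by $\partial_v$, $E^1$ is the vertical homology, $E^2$ is the horizontal homology of the vertical homology, $\partial^r$ has bidegree $(-r,r-1)$, and it converges to the homology of the total complex. *)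

theory Defs
  imports
    "HOL-Analysis.Analysis"
    "HOL-Library.Sublist"
    "HOL-Algebra.Free_Abelian_Groups"
begin

section \<open>Regular CW complexes\<close>

text \<open>\<open>Euclidean_space n\<close> consists of the sequences vanishing from index \<open>n\<close> on. In particular
  the disc of dimension \<open>0\<close> is a point and its boundary sphere is empty.\<close>

definition sphere_set :: "nat \<Rightarrow> (nat \<Rightarrow> real) set" where
  "sphere_set n = {x. (\<Sum>i<n. (x i)\<^sup>2) = 1}"

definition disc :: "nat \<Rightarrow> (nat \<Rightarrow> real) topology" where
  "disc n = subtopology (Euclidean_space n) {x. (\<Sum>i<n. (x i)\<^sup>2) \<le> 1}"

definition disc_boundary :: "nat \<Rightarrow> (nat \<Rightarrow> real) topology" where
  "disc_boundary n = subtopology (disc n) (sphere_set n)"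

definition disc_interior :: "nat \<Rightarrow> (nat \<Rightarrow> real) topology" where
  "disc_interior n = subtopology (disc n) (- sphere_set n)"

text \<open>The cells in \<open>K\<close> are the open cells. \<open>\<Phi> e\<close> is the characteristic map of \<open>e\<close>, so the
  attaching map of \<open>e\<close> is its restriction to the boundary sphere.\<close>

locale CW_complex =
  fixes X :: "'a topology"
    and K :: "'a set set"
    and cdim :: "'a set \<Rightarrow> nat"
    and \<Phi> :: "'a set \<Rightarrow> (nat \<Rightarrow> real) \<Rightarrow> 'a"
  assumes Hausdorff: "Hausdorff_space X"
    and partition: "partition_on (topspace X) K"
    and characteristic_map: "e \<in> K \<Longrightarrow> continuous_map (disc (cdim e)) X (\<Phi> e)"
    and open_cell: "e \<in> K \<Longrightarrow> homeomorphic_map (disc_interior (cdim e)) (subtopology X e) (\<Phi> e)"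
    and closure_finite:
      "e \<in> K \<Longrightarrow> \<exists>F. finite F \<and> F \<subseteq> {c \<in> K. cdim c < cdim e} \<and>
                   \<Phi> e ` topspace (disc_boundary (cdim e)) \<subseteq> \<Union>F"
    and weak_topology:
      "\<lbrakk>A \<subseteq> topspace X; \<And>e. e \<in> K \<Longrightarrow> closedin X (A \<inter> X closure_of e)\<rbrakk> \<Longrightarrow> closedin X A"

locale regular_CW_complex = CW_complex +
  assumes regular: "e \<in> K \<Longrightarrow> embedding_map (disc_boundary (cdim e)) X (\<Phi> e)"

definition cell_less :: "'a topology \<Rightarrow> 'a set \<Rightarrow> 'a set \<Rightarrow> bool" where
  "cell_less X y x \<longleftrightarrow> y \<noteq> x \<and> y \<subseteq> X closure_of x"


section \<open>Discrete Morse functions\<close>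

definition discrete_Morse_function ::
  "'a topology \<Rightarrow> 'a set set \<Rightarrow> ('a set \<Rightarrow> nat) \<Rightarrow> ('a set \<Rightarrow> real) \<Rightarrow> bool" where
  "discrete_Morse_function X K cdim f \<longleftrightarrow>
     (\<forall>x\<in>K. (\<exists>\<^sub>\<le>\<^sub>1 y. y \<in> K \<and> cdim y = cdim x + 1 \<and> cell_less X x y \<and> f x \<ge> f y) \<and>
            (\<exists>\<^sub>\<le>\<^sub>1 y. y \<in> K \<and> cdim x = cdim y + 1 \<and> cell_less X y x \<and> f y \<ge> f x))"

definition regular_pair ::
  "'a topology \<Rightarrow> 'a set set \<Rightarrow> ('a set \<Rightarrow> nat) \<Rightarrow> ('a set \<Rightarrow> real) \<Rightarrow> 'a set \<Rightarrow> 'a set \<Rightarrow> bool" where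
  "regular_pair X K cdim f x y \<longleftrightarrow>
     x \<in> K \<and> y \<in> K \<and> cdim y = cdim x + 1 \<and> cell_less X x y \<and> f x \<ge> f y"

definition critical_cells ::
  "'a topology \<Rightarrow> 'a set set \<Rightarrow> ('a set \<Rightarrow> nat) \<Rightarrow> ('a set \<Rightarrow> real) \<Rightarrow> 'a set set" where
  "critical_cells X K cdim f =
     {x \<in> K. \<nexists>y. regular_pair X K cdim f x y \<or> regular_pair X K cdim f y x}"


section \<open>P-categories\<close>

text \<open>\<open>Comp C g f\<close> is the composite \<open>g \<circ> f\<close>. Only its values on composable pairs, and those
  of \<open>Le C\<close> on pairs from a common hom set, are meaningful.\<close>

record ('o, 'm) cat =
  Obj :: "'o set"
  Hom :: "'o \<Rightarrow> 'o \<Rightarrow> 'm set"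
  Ident :: "'o \<Rightarrow> 'm"
  Comp :: "'m \<Rightarrow> 'm \<Rightarrow> 'm"

record ('o, 'm) pcat = "('o, 'm) cat" +
  Le :: "'m \<Rightarrow> 'm \<Rightarrow> bool"

definition full_sub :: "('o, 'm) pcat \<Rightarrow> 'o set \<Rightarrow> ('o, 'm) pcat" where
  "full_sub C A = C\<lparr>Obj := Obj C \<inter> A\<rparr>"


section \<open>The entrance path category and its Morse system\<close>

definition Ent :: "'a topology \<Rightarrow> 'a set set \<Rightarrow> ('a set, 'a set list) pcat" where
  "Ent X K =
    \<lparr>Obj = K,
     Hom = (\<lambda>x y. {s. s \<noteq> [] \<and> set s \<subseteq> K \<and> hd s = x \<and> last s = y \<and>
                      successively (\<lambda>a b. cell_less X b a) s}),
     Ident = (\<lambda>x. [x]),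
     Comp = (\<lambda>t s. s @ tl t),
     Le = subseq\<rparr>"

definition Morse_system ::
  "'a topology \<Rightarrow> 'a set set \<Rightarrow> ('a set \<Rightarrow> nat) \<Rightarrow> ('a set \<Rightarrow> real) \<Rightarrow>
   'a set \<Rightarrow> 'a set \<Rightarrow> 'a set list set" where
  "Morse_system X K cdim f y x = (if regular_pair X K cdim f x y then {[y, x]} else {})"


section \<open>Localization\<close>

definition with_identities :: "('o, 'm) pcat \<Rightarrow> ('o \<Rightarrow> 'o \<Rightarrow> 'm set) \<Rightarrow> 'o \<Rightarrow> 'o \<Rightarrow> 'm set" where
  "with_identities C S a b = S a b \<union> (if a = b then {Ident C a} else {})"

text \<open>A zigzag records the lists \<open>x\<^sub>0, \<dots>, x\<^sub>k\<close> and \<open>y\<^sub>0, \<dots>, y\<^sub>k\<close>, the arrows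
  \<open>g\<^sub>i : x\<^sub>i \<rightarrow> y\<^sub>i\<close> for \<open>i \<le> k\<close>, and the arrows \<open>f\<^sub>i : x\<^sub>i\<^sub>+\<^sub>1 \<rightarrow> y\<^sub>i\<close> for \<open>i < k\<close>.\<close>

record ('o, 'm) zigzag =
  zx :: "'o list"
  zy :: "'o list"
  zg :: "'m list"
  zf :: "'m list"

text \<open>In this section \<open>S\<close> plays the role of \<open>\<Sigma>\<^sup>+\<close>: it already contains the identities.\<close>

definition zigzags ::
  "('o, 'm) pcat \<Rightarrow> ('o \<Rightarrow> 'o \<Rightarrow> 'm set) \<Rightarrow> 'o \<Rightarrow> 'o \<Rightarrow> ('o, 'm) zigzag set" where
  "zigzags C S w z =
    {\<gamma>. let k = length (zf \<gamma>) in
        length (zx \<gamma>) = k + 1 \<and> length (zy \<gamma>) = k + 1 \<and> length (zg \<gamma>) = k + 1 \<and>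
        set (zx \<gamma>) \<subseteq> Obj C \<and> set (zy \<gamma>) \<subseteq> Obj C \<and>
        zx \<gamma> ! 0 = w \<and> zy \<gamma> ! k = z \<and>
        (\<forall>i\<le>k. zg \<gamma> ! i \<in> Hom C (zx \<gamma> ! i) (zy \<gamma> ! i)) \<and>
        (\<forall>i<k. zf \<gamma> ! i \<in> S (zx \<gamma> ! (i + 1)) (zy \<gamma> ! i))}"

definition horizontal_step :: "('o, 'm) pcat \<Rightarrow> ('o, 'm) zigzag \<Rightarrow> ('o, 'm) zigzag \<Rightarrow> bool" where
  "horizontal_step C \<gamma> \<gamma>' \<longleftrightarrow>
    (\<exists>X1 X2 Y1 Y2 G1 G2 F1 F2 x y y' g g'.
       length X1 = length F1 \<and> length Y1 = length F1 \<and> length G1 = length F1 \<and>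
       \<gamma> = \<lparr>zx = X1 @ [x, y] @ X2, zy = Y1 @ [y, y'] @ Y2,
            zg = G1 @ [g, g'] @ G2, zf = F1 @ [Ident C y] @ F2\<rparr> \<and>
       \<gamma>' = \<lparr>zx = X1 @ [x] @ X2, zy = Y1 @ [y'] @ Y2,
             zg = G1 @ [Comp C g' g] @ G2, zf = F1 @ F2\<rparr>)"

text \<open>Equal-length zigzags \<open>\<gamma>\<close> and \<open>\<gamma>'\<close> with connecting maps \<open>u\<^sub>i : y\<^sub>i \<rightarrow> y\<^sub>i'\<close> and
  \<open>v\<^sub>i : x\<^sub>i \<rightarrow> x\<^sub>i'\<close> whose squares commute up to \<open>R\<close>: equality gives the vertical relation,
  and the order of \<open>C\<close> gives the order on the localization.\<close>

definition ladder ::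
  "('o, 'm) pcat \<Rightarrow> ('o \<Rightarrow> 'o \<Rightarrow> 'm set) \<Rightarrow> ('m \<Rightarrow> 'm \<Rightarrow> bool) \<Rightarrow>
   ('o, 'm) zigzag \<Rightarrow> ('o, 'm) zigzag \<Rightarrow> bool" where
  "ladder C S R \<gamma> \<gamma>' \<longleftrightarrow>
    (let k = length (zf \<gamma>) in
     length (zf \<gamma>') = k \<and>
     (\<exists>u v :: nat \<Rightarrow> 'm.
        (\<forall>i\<le>k. u i \<in> S (zy \<gamma> ! i) (zy \<gamma>' ! i) \<and> v i \<in> S (zx \<gamma> ! i) (zx \<gamma>' ! i)) \<and>
        v 0 = Ident C (zx \<gamma> ! 0) \<and> u k = Ident C (zy \<gamma> ! k) \<and>
        (\<forall>i\<le>k. R (Comp C (zg \<gamma>' ! i) (v i)) (Comp C (u i) (zg \<gamma> ! i))) \<and>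
        (\<forall>i<k. R (Comp C (zf \<gamma>' ! i) (v (i + 1))) (Comp C (u i) (zf \<gamma> ! i)))))"

definition zigzag_step ::
  "('o, 'm) pcat \<Rightarrow> ('o \<Rightarrow> 'o \<Rightarrow> 'm set) \<Rightarrow> (('o, 'm) zigzag \<times> ('o, 'm) zigzag) set" where
  "zigzag_step C S =
    {(\<gamma>, \<gamma>'). \<exists>w z. \<gamma> \<in> zigzags C S w z \<and> \<gamma>' \<in> zigzags C S w z \<and>
               (horizontal_step C \<gamma> \<gamma>' \<or> ladder C S (=) \<gamma> \<gamma>')}"

definition zigzag_equiv ::
  "('o, 'm) pcat \<Rightarrow> ('o \<Rightarrow> 'o \<Rightarrow> 'm set) \<Rightarrow> (('o, 'm) zigzag \<times> ('o, 'm) zigzag) set" where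
  "zigzag_equiv C S = (zigzag_step C S \<union> (zigzag_step C S)\<inverse>)\<^sup>*"

definition zigzag_concat ::
  "('o, 'm) pcat \<Rightarrow> ('o, 'm) zigzag \<Rightarrow> ('o, 'm) zigzag \<Rightarrow> ('o, 'm) zigzag" where
  "zigzag_concat C \<gamma> \<delta> =
    \<lparr>zx = zx \<gamma> @ tl (zx \<delta>),
     zy = butlast (zy \<gamma>) @ zy \<delta>,
     zg = butlast (zg \<gamma>) @ [Comp C (hd (zg \<delta>)) (last (zg \<gamma>))] @ tl (zg \<delta>),
     zf = zf \<gamma> @ zf \<delta>\<rparr>"

definition Loc ::
  "('o, 'm) pcat \<Rightarrow> ('o \<Rightarrow> 'o \<Rightarrow> 'm set) \<Rightarrow> ('o, ('o, 'm) zigzag set) pcat" where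
  "Loc C S =
    \<lparr>Obj = Obj C,
     Hom = (\<lambda>w z. zigzags C S w z // zigzag_equiv C S),
     Ident = (\<lambda>w. zigzag_equiv C S `` {\<lparr>zx = [w], zy = [w], zg = [Ident C w], zf = []\<rparr>}),
     Comp = (\<lambda>H G. \<Union>\<gamma>\<in>G. \<Union>\<delta>\<in>H. zigzag_equiv C S `` {zigzag_concat C \<gamma> \<delta>}),
     Le = (\<lambda>G' G. \<exists>\<gamma>'\<in>G'. \<exists>\<gamma>\<in>G. ladder C S (Le C) \<gamma> \<gamma>')\<rparr>"

definition Flo ::
  "'a topology \<Rightarrow> 'a set set \<Rightarrow> ('a set \<Rightarrow> nat) \<Rightarrow> ('a set \<Rightarrow> real) \<Rightarrow>
   ('a set, ('a set, 'a set list) zigzag set) pcat" where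
  "Flo X K cdim f =
     full_sub (Loc (Ent X K) (with_identities (Ent X K) (Morse_system X K cdim f)))
       (critical_cells X K cdim f)"


section \<open>Bisimplicial sets and the double nerve\<close>

text \<open>\<open>hface S p q i\<close> and \<open>vface S p q i\<close> are the faces \<open>(d\<^sub>i, id)\<close> and \<open>(id, d\<^sub>i)\<close> on
  \<open>Simp S p q\<close>, with values in bidegrees \<open>(p - 1, q)\<close> and \<open>(p, q - 1)\<close>; similarly for the
  degeneracies.\<close>

record 's bisimplicial_set =
  Simp :: "nat \<Rightarrow> nat \<Rightarrow> 's set"
  hface :: "nat \<Rightarrow> nat \<Rightarrow> nat \<Rightarrow> 's \<Rightarrow> 's"
  vface :: "nat \<Rightarrow> nat \<Rightarrow> nat \<Rightarrow> 's \<Rightarrow> 's"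
  hdegen :: "nat \<Rightarrow> nat \<Rightarrow> nat \<Rightarrow> 's \<Rightarrow> 's"
  vdegen :: "nat \<Rightarrow> nat \<Rightarrow> nat \<Rightarrow> 's \<Rightarrow> 's"

definition delete_nth :: "nat \<Rightarrow> 'b list \<Rightarrow> 'b list" where
  "delete_nth i xs = take i xs @ drop (i + 1) xs"

definition repeat_nth :: "nat \<Rightarrow> 'b list \<Rightarrow> 'b list" where
  "repeat_nth i xs = take (i + 1) xs @ drop i xs"

definition Nbar :: "('o, 'm) pcat \<Rightarrow> nat \<Rightarrow> ('o, 'm list) cat" where
  "Nbar C p =
    \<lparr>Obj = Obj C,
     Hom = (\<lambda>a b. {h. length h = p + 1 \<and> set h \<subseteq> Hom C a b \<and> successively (Le C) h}),
     Ident = (\<lambda>a. replicate (p + 1) (Ident C a)),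
     Comp = map2 (Comp C)\<rparr>"

text \<open>A \<open>q\<close>-simplex of the nerve is stored as its \<open>q + 1\<close> objects and \<open>q\<close> arrows.\<close>

definition nerve :: "('o, 'n) cat \<Rightarrow> nat \<Rightarrow> ('o list \<times> 'n list) set" where
  "nerve D q =
    {(as, ms). length as = q + 1 \<and> length ms = q \<and> set as \<subseteq> Obj D \<and>
               (\<forall>i<q. ms ! i \<in> Hom D (as ! i) (as ! (i + 1)))}"

definition nerve_face ::
  "('o, 'n) cat \<Rightarrow> nat \<Rightarrow> nat \<Rightarrow> 'o list \<times> 'n list \<Rightarrow> 'o list \<times> 'n list" where
  "nerve_face D q i = (\<lambda>(as, ms).
     (delete_nth i as,
      if i = 0 then tl ms
      else if i = q then butlast ms
      else take (i - 1) ms @ [Comp D (ms ! i) (ms ! (i - 1))] @ drop (i + 1) ms))"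

definition nerve_degen ::
  "('o, 'n) cat \<Rightarrow> nat \<Rightarrow> 'o list \<times> 'n list \<Rightarrow> 'o list \<times> 'n list" where
  "nerve_degen D i = (\<lambda>(as, ms).
     (repeat_nth i as, take i ms @ [Ident D (as ! i)] @ drop i ms))"

definition double_nerve :: "('o, 'm) pcat \<Rightarrow> ('o list \<times> 'm list list) bisimplicial_set" where
  "double_nerve C =
    \<lparr>Simp = (\<lambda>p q. nerve (Nbar C p) q),
     hface = (\<lambda>p q i (as, ms). (as, map (delete_nth i) ms)),
     vface = (\<lambda>p q i. nerve_face (Nbar C p) q i),
     hdegen = (\<lambda>p q i (as, ms). (as, map (repeat_nth i) ms)),
     vdegen = (\<lambda>p q i. nerve_degen (Nbar C p) i)\<rparr>"


section \<open>Double complexes and their spectral sequences\<close>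

text \<open>Bidegrees are integers, so that first-quadrant complexes are extended by trivial groups. The
  groups are abelian, written multiplicatively as in HOL-Algebra. The two differentials commute.\<close>

record 'g double_complex =
  dgrp :: "int \<Rightarrow> int \<Rightarrow> 'g monoid"
  dhor :: "int \<Rightarrow> int \<Rightarrow> 'g \<Rightarrow> 'g"
  dver :: "int \<Rightarrow> int \<Rightarrow> 'g \<Rightarrow> 'g"

definition FS :: "'s bisimplicial_set \<Rightarrow> ('s \<Rightarrow>\<^sub>0 int) double_complex" where
  "FS S =
    \<lparr>dgrp = (\<lambda>p q. free_Abelian_group (if p < 0 \<or> q < 0 then {} else Simp S (nat p) (nat q))),
     dhor = (\<lambda>p q. if p \<le> 0 then (\<lambda>_. 0) else
               frag_extend (\<lambda>s. \<Sum>i\<le>nat p. frag_cmul ((-1) ^ i) (frag_of (hface S (nat p) (nat q) i s)))),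
     dver = (\<lambda>p q. if q \<le> 0 then (\<lambda>_. 0) else
               frag_extend (\<lambda>s. \<Sum>i\<le>nat q. frag_cmul ((-1) ^ i) (frag_of (vface S (nat p) (nat q) i s))))\<rparr>"

text \<open>The total complex is the direct sum of the groups in bidegrees \<open>(p, n - p)\<close>, and an element
  is indexed by \<open>p\<close>. Its differential is \<open>\<partial>\<^sub>h + (-1)\<^sup>p \<partial>\<^sub>v\<close>.\<close>

definition Tot :: "'g double_complex \<Rightarrow> int \<Rightarrow> (int \<Rightarrow> 'g) monoid" where
  "Tot A n = sum_group UNIV (\<lambda>p. dgrp A p (n - p))"

definition Tot_diff :: "'g double_complex \<Rightarrow> int \<Rightarrow> (int \<Rightarrow> 'g) \<Rightarrow> (int \<Rightarrow> 'g)" where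
  "Tot_diff A n x = (\<lambda>p.
     let G = dgrp A p (n - 1 - p); v = dver A p (n - p) (x p)
     in dhor A (p + 1) (n - 1 - p) (x (p + 1)) \<otimes>\<^bsub>G\<^esub> (if even p then v else inv\<^bsub>G\<^esub> v))"

definition Filt :: "'g double_complex \<Rightarrow> int \<Rightarrow> int \<Rightarrow> (int \<Rightarrow> 'g) set" where
  "Filt A p n = {x \<in> carrier (Tot A n). \<forall>i>p. x i = \<one>\<^bsub>dgrp A i (n - i)\<^esub>}"

text \<open>The spectral sequence of the total complex filtered by columns, which is the one that takes
  vertical homology first:
  \<open>Z\<^sup>r\<^sub>p\<^sub>,\<^sub>q = {x \<in> F\<^sub>p. D x \<in> F\<^sub>p\<^sub>-\<^sub>r}\<close> and
  \<open>E\<^sup>r\<^sub>p\<^sub>,\<^sub>q = Z\<^sup>r\<^sub>p\<^sub>,\<^sub>q / (Z\<^sup>r\<^sup>-\<^sup>1\<^sub>p\<^sub>-\<^sub>1\<^sub>,\<^sub>q\<^sub>+\<^sub>1 + D Z\<^sup>r\<^sup>-\<^sup>1\<^sub>p\<^sub>+\<^sub>r\<^sub>-\<^sub>1\<^sub>,\<^sub>q\<^sub>-\<^sub>r\<^sub>+\<^sub>2)\<close>,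
  where the differential sends the class of \<open>x\<close> to the class of \<open>D x\<close>.
  The superscript \<open>r - 1\<close> is \<open>-1\<close> when \<open>r = 0\<close>.\<close>

definition Zcyc :: "'g double_complex \<Rightarrow> int \<Rightarrow> int \<Rightarrow> int \<Rightarrow> (int \<Rightarrow> 'g) set" where
  "Zcyc A r p q = {x \<in> Filt A p (p + q). Tot_diff A (p + q) x \<in> Filt A (p - r) (p + q - 1)}"

definition Edenom :: "'g double_complex \<Rightarrow> int \<Rightarrow> int \<Rightarrow> int \<Rightarrow> (int \<Rightarrow> 'g) set" where
  "Edenom A r p q =
     Zcyc A (r - 1) (p - 1) (q + 1) <#>\<^bsub>Tot A (p + q)\<^esub>
     Tot_diff A (p + q + 1) ` Zcyc A (r - 1) (p + r - 1) (q - r + 2)"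

definition Epage :: "'g double_complex \<Rightarrow> nat \<Rightarrow> int \<Rightarrow> int \<Rightarrow> (int \<Rightarrow> 'g) set monoid" where
  "Epage A r p q = (Tot A (p + q))\<lparr>carrier := Zcyc A (int r) p q\<rparr> Mod Edenom A (int r) p q"

definition Ediff ::
  "'g double_complex \<Rightarrow> nat \<Rightarrow> int \<Rightarrow> int \<Rightarrow> (int \<Rightarrow> 'g) set \<Rightarrow> (int \<Rightarrow> 'g) set" where
  "Ediff A r p q \<xi> =
     (\<Union>x\<in>\<xi>. Edenom A (int r) (p - int r) (q + int r - 1)
              #>\<^bsub>Tot A (p + q - 1)\<^esub> Tot_diff A (p + q) x)"

end

theory Submission
  imports Defs "HOL-Homology.Invariance_of_Domain"
begin

text \<open>The regular pairs are disjoint: if \<open>x < y < z\<close> were two consecutive pairs, the second facet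
  of \<open>z\<close> above \<open>x\<close>, which exists by invariance of domain, would violate the Morse condition.
  Hence a morphism of the localization is determined by its steps outside \<open>\<Sigma>\<close>, composition is
  concatenation of step lists, and \<open>\<Rightarrow>\<close> refines each step \<open>a > c\<close> to a descending path from \<open>a\<close>
  to \<open>c\<close>. The steps of a refinement can be attributed to the refined steps in only one way.
  Therefore every chain \<open>h\<^sub>0 \<Rightarrow> \<dots> \<Rightarrow> h\<^sub>p\<close> of the flow category splits uniquely at the interior
  critical cells of \<open>h\<^sub>0\<close>, so that each category \<open>(Nbar C)([p])\<close> is free and its nerve has no
  homology above degree \<open>1\<close>: the rows \<open>q \<ge> 2\<close> of \<open>E\<^sup>1\<close> vanish. The bottom row of \<open>E\<^sup>1\<close> is a constant
  simplicial group, so \<open>E\<^sup>2\<^sub>p\<^sub>,\<^sub>0 = 0\<close> for \<open>p > 0\<close>. This leaves no room for a differential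
  \<open>\<partial>\<^sup>r\<close> with \<open>r \<ge> 2\<close>.\<close>

section \<open>Spectral sequences of double complexes of free abelian groups\<close>

text \<open>A chain runs from its coarsest member \<open>h_0\<close> to finer ones. A factorization
  of \<open>h_0\<close> lifts to every later member, but a critical cell met by \<open>h_1\<close>
  need not be met by \<open>h_0\<close>. This is why freeness of \<open>(Nbar C)([p])\<close> is
  measured on first members, the generators being the chains whose \<open>h_0\<close> ends at the
  first critical cell it reaches. Deleting \<open>h_0\<close> may turn a generator into a composite,
  so freeness is used one column at a time. Lifting is unique because, for a step
  \<open>a > c\<close> outside \<Sigma>, no refinement is a proper initial part of another: after
  its last step outside \<Sigma> at most one step remains, and that step is forced by dimension.
  Over a free category, vertical acyclicity comes from splitting the first arrow at each of its
  generators, a telescoping argument as in Fox calculus. The vertices of the nerve, and which of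
  them are joined by an arrow, are the same for every \<open>p\<close>, so the horizontal
  differential on the bottom row alternates between zero and the identity.\<close>

locale frag_double_complex =
  fixes A :: "('s \<Rightarrow>\<^sub>0 int) double_complex" and B :: "int \<Rightarrow> int \<Rightarrow> 's set"
  assumes dgrp_eq: "dgrp A p q = free_Abelian_group (B p q)"
    and quadrant: "p < 0 \<or> q < 0 \<Longrightarrow> B p q = {}"
    and dhor_diff: "dhor A p q (x - y) = dhor A p q x - dhor A p q y"
    and dver_diff: "dver A p q (x - y) = dver A p q x - dver A p q y"
    and dhor_closed: "Poly_Mapping.keys x \<subseteq> B p q \<Longrightarrow> Poly_Mapping.keys (dhor A p q x) \<subseteq> B (p - 1) q"
    and dver_closed: "Poly_Mapping.keys x \<subseteq> B p q \<Longrightarrow> Poly_Mapping.keys (dver A p q x) \<subseteq> B p (q - 1)"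
    and dhor_dhor: "Poly_Mapping.keys x \<subseteq> B p q \<Longrightarrow> dhor A (p - 1) q (dhor A p q x) = 0"
    and dver_dver: "Poly_Mapping.keys x \<subseteq> B p q \<Longrightarrow> dver A p (q - 1) (dver A p q x) = 0"
    and dhor_dver: "Poly_Mapping.keys x \<subseteq> B p q \<Longrightarrow>
      dhor A p (q - 1) (dver A p q x) = dver A (p - 1) q (dhor A p q x)"
begin

lemma dhor_0 [simp]: "dhor A p q 0 = 0"
  using dhor_diff[of p q 0 0] by simp

lemma dver_0 [simp]: "dver A p q 0 = 0"
  using dver_diff[of p q 0 0] by simp

lemma dhor_uminus: "dhor A p q (- x) = - dhor A p q x"
  using dhor_diff[of p q 0 x] by simp

lemma dver_uminus: "dver A p q (- x) = - dver A p q x"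
  using dver_diff[of p q 0 x] by simp

lemma dhor_add: "dhor A p q (x + y) = dhor A p q x + dhor A p q y"
  using dhor_diff[of p q x "- y"] by (simp add: dhor_uminus)

lemma dver_add: "dver A p q (x + y) = dver A p q x + dver A p q y"
  using dver_diff[of p q x "- y"] by (simp add: dver_uminus)

lemma zero_outside: "Poly_Mapping.keys x \<subseteq> B p q \<Longrightarrow> p < 0 \<or> q < 0 \<Longrightarrow> x = 0"
  using quadrant[of p q] by auto

text \<open>In total degree \<open>n\<close> the first quadrant leaves only the columns
  \<open>0..n\<close>, so the finite support required in a direct sum is automatic.\<close>

lemma carrier_Tot: "carrier (Tot A n) = {x. \<forall>p. Poly_Mapping.keys (x p) \<subseteq> B p (n - p)}"
proof -
  have "finite {i. x i \<noteq> 0}" if "\<forall>p. Poly_Mapping.keys (x p) \<subseteq> B p (n - p)" for x :: "int \<Rightarrow> 's \<Rightarrow>\<^sub>0 int"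
  proof (rule finite_subset)
    show "{i. x i \<noteq> 0} \<subseteq> {0..n}"
      using that zero_outside by (smt (verit) atLeastAtMost_iff mem_Collect_eq subsetI)
  qed simp
  then show ?thesis
    by (auto simp: Tot_def carrier_sum_group dgrp_eq PiE_iff)
qed

lemma mult_Tot: "x \<otimes>\<^bsub>Tot A n\<^esub> y = (\<lambda>p. x p + y p)"
  by (simp add: Tot_def dgrp_eq restrict_UNIV)

lemma mem_Filt:
  "x \<in> Filt A p n \<longleftrightarrow> (\<forall>i. Poly_Mapping.keys (x i) \<subseteq> B i (n - i)) \<and> (\<forall>i>p. x i = 0)"
  by (auto simp: Filt_def carrier_Tot dgrp_eq)

lemma zero_in_Filt: "(\<lambda>_. 0) \<in> Filt A p n"
  by (simp add: mem_Filt)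

lemma Filt_mono: "x \<in> Filt A p n \<Longrightarrow> p \<le> p' \<Longrightarrow> x \<in> Filt A p' n"
  by (auto simp: mem_Filt)

lemma Filt_diff:
  assumes "x \<in> Filt A p n" "y \<in> Filt A p n"
  shows "(\<lambda>i. x i - y i) \<in> Filt A p n"
proof -
  have "Poly_Mapping.keys (x i - y i) \<subseteq> B i (n - i)" for i
    using assms keys_diff[of "x i" "y i"] unfolding mem_Filt by blast
  then show ?thesis using assms by (simp add: mem_Filt)
qed

lemma Filt_add:
  assumes "x \<in> Filt A p n" "y \<in> Filt A p n"
  shows "(\<lambda>i. x i + y i) \<in> Filt A p n"
proof -
  have "Poly_Mapping.keys (x i + y i) \<subseteq> B i (n - i)" for i
    using assms Poly_Mapping.keys_add[of "x i" "y i"] unfolding mem_Filt by blast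
  then show ?thesis using assms by (simp add: mem_Filt)
qed

lemma Filt_negative: "x \<in> Filt A p n \<Longrightarrow> p < 0 \<Longrightarrow> x = (\<lambda>_. 0)"
  unfolding mem_Filt by (metis linorder_not_less order_le_less_trans zero_outside)

text \<open>The total differential in additive notation, linear on all families. It agrees with
  \<open>Tot_diff\<close> where the group inverse is known to be negation, that is, on families
  supported in \<open>B\<close>.\<close>

definition D :: "int \<Rightarrow> (int \<Rightarrow> 's \<Rightarrow>\<^sub>0 int) \<Rightarrow> int \<Rightarrow> 's \<Rightarrow>\<^sub>0 int" where
  "D n x p = dhor A (p + 1) (n - 1 - p) (x (p + 1)) +
     (if even p then dver A p (n - p) (x p) else - dver A p (n - p) (x p))"

lemma Tot_diff_eq:
  assumes "\<And>p. Poly_Mapping.keys (x p) \<subseteq> B p (n - p)"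
  shows "Tot_diff A n x = D n x"
proof
  fix p
  have "Poly_Mapping.keys (dver A p (n - p) (x p)) \<subseteq> B p (n - 1 - p)"
    using dver_closed[OF assms, of p] by (simp add: algebra_simps)
  then show "Tot_diff A n x p = D n x p"
    by (simp add: Tot_diff_def D_def dgrp_eq Let_def)
qed

lemma Tot_diff_Filt: "x \<in> Filt A p n \<Longrightarrow> Tot_diff A n x = D n x"
  by (simp add: Tot_diff_eq mem_Filt)

lemma D_diff: "D n (\<lambda>i. x i - y i) = (\<lambda>i. D n x i - D n y i)"
  by (rule ext) (simp add: D_def dhor_diff dver_diff)

lemma D_add: "D n (\<lambda>i. x i + y i) = (\<lambda>i. D n x i + D n y i)"
  by (rule ext) (simp add: D_def dhor_add dver_add)

lemma D_zero: "D n (\<lambda>_. 0) = (\<lambda>_. 0)"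
  by (rule ext) (simp add: D_def)

lemma D_Filt:
  assumes "x \<in> Filt A p n"
  shows "D n x \<in> Filt A p (n - 1)"
proof -
  have k: "Poly_Mapping.keys (x i) \<subseteq> B i (n - i)" for i
    using assms by (simp add: mem_Filt)
  have "Poly_Mapping.keys (D n x i) \<subseteq> B i (n - 1 - i)" for i
  proof -
    have 1: "Poly_Mapping.keys (dhor A (i + 1) (n - 1 - i) (x (i + 1))) \<subseteq> B i (n - 1 - i)"
      using dhor_closed[of "x (i + 1)" "i + 1" "n - 1 - i"] k[of "i + 1"] by (simp add: algebra_simps)
    have 2: "Poly_Mapping.keys (dver A i (n - i) (x i)) \<subseteq> B i (n - 1 - i)"
      using dver_closed[OF k, of i] by (simp add: algebra_simps)
    have 3: "Poly_Mapping.keys (if even i then dver A i (n - i) (x i) else - dver A i (n - i) (x i)) \<subseteq> B i (n - 1 - i)"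
      using 2 by (simp add: keys_minus)
    show ?thesis unfolding D_def using 1 3
      by (meson Poly_Mapping.keys_add Un_least order_trans)
  qed
  then show ?thesis
    using assms by (simp add: mem_Filt D_def)
qed

text \<open>The alternating sign on the vertical part makes the two commuting differentials
  anticommute, so the mixed terms cancel.\<close>

lemma D_D:
  assumes "x \<in> Filt A p n"
  shows "D (n - 1) (D n x) = (\<lambda>_. 0)"
proof
  fix i
  have k: "Poly_Mapping.keys (x i) \<subseteq> B i (n - i)" for i
    using assms by (simp add: mem_Filt)
  have 1: "dhor A (i + 1) (n - 2 - i) (dhor A (i + 2) (n - 2 - i) (x (i + 2))) = 0"
    using dhor_dhor[of "x (i + 2)" "i + 2" "n - 2 - i"] k[of "i + 2"] by (simp add: algebra_simps)
  have 2: "dver A i (n - 1 - i) (dver A i (n - i) (x i)) = 0"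
    using dver_dver[of "x i" i "n - i"] k[of i] by (simp add: algebra_simps)
  have 3: "dhor A (i + 1) (n - 2 - i) (dver A (i + 1) (n - 1 - i) (x (i + 1)))
      = dver A i (n - 1 - i) (dhor A (i + 1) (n - 1 - i) (x (i + 1)))"
    using dhor_dver[of "x (i + 1)" "i + 1" "n - 1 - i"] k[of "i + 1"] by (simp add: algebra_simps)
  have a: "i + 1 + 1 = i + 2" "n - 1 - (i + 1) = n - 2 - i" "n - 1 - 1 - i = n - 2 - i" "n - (i + 1) = n - 1 - i"
    by auto
  show "D (n - 1) (D n x) i = 0"
    unfolding D_def a
    by (cases "even i") (auto simp: dhor_add dver_add dhor_diff dver_diff dhor_uminus dver_uminus 1 2 3)
qed

lemma column_Filt:
  assumes "Poly_Mapping.keys t \<subseteq> B p (n - p)" and "p \<le> p'"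
  shows "(\<lambda>i. if i = p then t else 0) \<in> Filt A p' n"
  using assms by (auto simp: mem_Filt)

lemma D_column:
  "D n (\<lambda>i. if i = p then t else 0) =
     (\<lambda>i. if i = p then (if even p then dver A p (n - p) t else - dver A p (n - p) t)
          else if i = p - 1 then dhor A p (n - p) t else 0)"
  by (rule ext) (auto simp: D_def)

lemma mem_Zcyc: "x \<in> Zcyc A r p q \<longleftrightarrow> x \<in> Filt A p (p + q) \<and> D (p + q) x \<in> Filt A (p - r) (p + q - 1)"
  by (auto simp: Zcyc_def Tot_diff_Filt)

lemma mem_Edenom:
  "x \<in> Edenom A r p q \<longleftrightarrow>
    (\<exists>y\<in>Zcyc A (r - 1) (p - 1) (q + 1). \<exists>w\<in>Zcyc A (r - 1) (p + r - 1) (q - r + 2).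
       x = (\<lambda>i. y i + D (p + q + 1) w i))"
proof -
  have "Tot_diff A (p + q + 1) w = D (p + q + 1) w" if "w \<in> Zcyc A (r - 1) (p + r - 1) (q - r + 2)" for w
    using that Tot_diff_Filt[of w "p + r - 1" "p + q + 1"]
    by (simp add: mem_Zcyc algebra_simps)
  then show ?thesis
    by (auto simp: Edenom_def set_mult_def mult_Tot)
qed

lemma zero_in_Zcyc: "(\<lambda>_. 0) \<in> Zcyc A r p q"
  by (simp add: mem_Zcyc zero_in_Filt D_zero)

lemma zero_in_Edenom: "(\<lambda>_. 0) \<in> Edenom A r p q"
  unfolding mem_Edenom by (intro bexI[OF _ zero_in_Zcyc]) (simp add: D_zero)

lemma Zcyc_add: "x \<in> Zcyc A r p q \<Longrightarrow> y \<in> Zcyc A r p q \<Longrightarrow> (\<lambda>i. x i + y i) \<in> Zcyc A r p q"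
  by (simp add: mem_Zcyc Filt_add D_add)

lemma Zcyc_uminus:
  assumes "x \<in> Zcyc A r p q"
  shows "(\<lambda>i. - x i) \<in> Zcyc A r p q"
proof -
  have "D n (\<lambda>i. - x i) = (\<lambda>i. - D n x i)" for n
    using D_diff[of n "\<lambda>_. 0" x] by (simp add: D_zero)
  with assms show ?thesis by (simp add: mem_Zcyc mem_Filt keys_minus)
qed

lemma Edenom_add:
  assumes "x \<in> Edenom A r p q" "y \<in> Edenom A r p q"
  shows "(\<lambda>i. x i + y i) \<in> Edenom A r p q"
proof -
  obtain x1 x2 where x: "x1 \<in> Zcyc A (r - 1) (p - 1) (q + 1)" "x2 \<in> Zcyc A (r - 1) (p + r - 1) (q - r + 2)"
    "x = (\<lambda>i. x1 i + D (p + q + 1) x2 i)" using assms(1) unfolding mem_Edenom by blast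
  obtain y1 y2 where y: "y1 \<in> Zcyc A (r - 1) (p - 1) (q + 1)" "y2 \<in> Zcyc A (r - 1) (p + r - 1) (q - r + 2)"
    "y = (\<lambda>i. y1 i + D (p + q + 1) y2 i)" using assms(2) unfolding mem_Edenom by blast
  show ?thesis
    unfolding mem_Edenom
    by (intro bexI[OF _ Zcyc_add[OF x(1) y(1)]] bexI[OF _ Zcyc_add[OF x(2) y(2)]])
      (simp add: x(3) y(3) D_add algebra_simps)
qed

lemma Edenom_uminus:
  assumes "x \<in> Edenom A r p q"
  shows "(\<lambda>i. - x i) \<in> Edenom A r p q"
proof -
  obtain x1 x2 where x: "x1 \<in> Zcyc A (r - 1) (p - 1) (q + 1)" "x2 \<in> Zcyc A (r - 1) (p + r - 1) (q - r + 2)"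
    "x = (\<lambda>i. x1 i + D (p + q + 1) x2 i)" using assms(1) unfolding mem_Edenom by blast
  have "D (p + q + 1) (\<lambda>i. - x2 i) = (\<lambda>i. - D (p + q + 1) x2 i)"
    using D_diff[of "p + q + 1" "\<lambda>_. 0" x2] by (simp add: D_zero)
  then show ?thesis
    unfolding mem_Edenom
    by (intro bexI[OF _ Zcyc_uminus[OF x(1)]] bexI[OF _ Zcyc_uminus[OF x(2)]]) (simp add: x(3))
qed

lemma Edenom_coset:
  assumes "x \<in> Edenom A r p q"
  shows "Edenom A r p q #>\<^bsub>Tot A n\<^esub> x = Edenom A r p q"
proof
  show "Edenom A r p q #>\<^bsub>Tot A n\<^esub> x \<subseteq> Edenom A r p q"
    using Edenom_add[OF _ assms] by (auto simp: r_coset_def mult_Tot)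
  show "Edenom A r p q \<subseteq> Edenom A r p q #>\<^bsub>Tot A n\<^esub> x"
  proof
    fix y assume "y \<in> Edenom A r p q"
    then have "(\<lambda>i. y i + (- x i)) \<in> Edenom A r p q"
      using Edenom_add[OF _ Edenom_uminus[OF assms]] by blast
    then show "y \<in> Edenom A r p q #>\<^bsub>Tot A n\<^esub> x"
      unfolding r_coset_def mult_Tot by (force intro!: bexI[of _ "\<lambda>i. y i + (- x i)"])
  qed
qed

text \<open>Write \<open>D x = D (x - y) + D y\<close>. By \<open>push\<close> the first summand is
  a cycle one filtration step below the target, and the second is the boundary of an element of
  \<open>Zcyc A (r - 1) (p - 1) (q + 1)\<close>. These are exactly the two parts of the denominator
  of the target page.\<close>

lemma Ediff_trivial:
  assumes push: "\<And>x. x \<in> Zcyc A (int r) p q \<Longrightarrow>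
      \<exists>y\<in>Zcyc A (int r - 1) (p - 1) (q + 1). D (p + q) (\<lambda>i. x i - y i) \<in> Filt A (p - int r - 1) (p + q - 1)"
    and \<xi>: "\<xi> \<in> carrier (Epage A r p q)"
  shows "Ediff A r p q \<xi> = \<one>\<^bsub>Epage A r (p - int r) (q + int r - 1)\<^esub>"
proof -
  let ?E = "Edenom A (int r) (p - int r) (q + int r - 1)"
  obtain x where x: "x \<in> Zcyc A (int r) p q"
    and \<xi>_eq: "\<xi> = {(\<lambda>i. h i + x i) |h. h \<in> Edenom A (int r) p q}"
    using \<xi> by (auto simp: Epage_def FactGroup_def RCOSETS_def r_coset_def mult_Tot)
  have nd: "D (p + q) y \<in> ?E" if y: "y \<in> Zcyc A (int r - 1) (p - 1) (q + 1)" for y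
    unfolding mem_Edenom
    by (intro bexI[OF _ zero_in_Zcyc] bexI[of _ y]) (use y in \<open>simp_all add: algebra_simps\<close>)
  have Dx: "D (p + q) x' \<in> ?E" if x': "x' \<in> Zcyc A (int r) p q" for x'
  proof -
    obtain y where y: "y \<in> Zcyc A (int r - 1) (p - 1) (q + 1)"
      and low: "D (p + q) (\<lambda>i. x' i - y i) \<in> Filt A (p - int r - 1) (p + q - 1)"
      using push[OF x'] by blast
    have F: "(\<lambda>i. x' i - y i) \<in> Filt A p (p + q)"
      using x' y Filt_diff Filt_mono[of y "p - 1" "p + q" p] by (simp add: mem_Zcyc)
    have "D (p + q) (\<lambda>i. x' i - y i) \<in> Zcyc A (int r - 1) (p - int r - 1) (q + int r)"
      using low D_D[OF F] zero_in_Filt by (simp add: mem_Zcyc algebra_simps)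
    then have "D (p + q) (\<lambda>i. x' i - y i) \<in> ?E"
      unfolding mem_Edenom
      by (intro bexI[of _ "D (p + q) (\<lambda>i. x' i - y i)"] bexI[OF _ zero_in_Zcyc])
        (simp_all add: D_zero algebra_simps)
    from Edenom_add[OF this nd[OF y]] show ?thesis
      by (simp add: D_diff)
  qed
  \<comment> \<open>\<open>Ediff\<close> is a union over all representatives of the class, so each
    of them has to be sent into \<open>?E\<close>, and the class must be nonempty for the union to
    equal \<open>?E\<close>.\<close>
  have "Tot_diff A (p + q) x' \<in> ?E" if "x' \<in> \<xi>" for x'
  proof -
    from that obtain h where h: "h \<in> Edenom A (int r) p q" and x'_eq: "x' = (\<lambda>i. h i + x i)"
      unfolding \<xi>_eq by blast
    obtain y w where y: "y \<in> Zcyc A (int r - 1) (p - 1) (q + 1)"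
      and w: "w \<in> Zcyc A (int r - 1) (p + int r - 1) (q - int r + 2)"
      and h_eq: "h = (\<lambda>i. y i + D (p + q + 1) w i)"
      using h unfolding mem_Edenom by blast
    have wF: "w \<in> Filt A (p + int r - 1) (p + q + 1)" and Dw: "D (p + q + 1) w \<in> Filt A p (p + q)"
      using w by (simp_all add: mem_Zcyc algebra_simps)
    have yF: "y \<in> Filt A p (p + q)"
      using y Filt_mono[of y "p - 1" "p + q" p] by (simp add: mem_Zcyc)
    have xF: "x \<in> Filt A p (p + q)" using x by (simp add: mem_Zcyc)
    have "x' \<in> Filt A p (p + q)"
      unfolding x'_eq h_eq by (intro Filt_add yF Dw xF)
    then have "Tot_diff A (p + q) x' = D (p + q) x'"
      by (rule Tot_diff_Filt)
    also have "\<dots> = (\<lambda>i. D (p + q) y i + D (p + q) x i)"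
      using D_D[OF wF] by (simp add: x'_eq h_eq D_add)
    finally show ?thesis
      using Edenom_add[OF nd[OF y] Dx[OF x]] by simp
  qed
  moreover have "\<xi> \<noteq> {}"
    using \<xi>_eq zero_in_Edenom by blast
  ultimately have "Ediff A r p q \<xi> = ?E"
    unfolding Ediff_def using Edenom_coset by auto
  then show ?thesis
    by (simp add: Epage_def FactGroup_def)
qed

text \<open>At chain level, \<open>exact\<close> is the vanishing of the rows \<open>q >= 2\<close>
  of \<open>E^1\<close>, and \<open>bottom_row\<close> that of \<open>E^2_{p,0}\<close> for
  \<open>p >= 2\<close>. If \<open>p >= r >= 2\<close> and \<open>q >= 0\<close>, the differential
  either starts in the bottom row, where \<open>x\<close> is a total boundary modulo lower
  filtration, or ends in a row \<open>q + r - 1 >= 2\<close>, where the leading term of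
  \<open>D x\<close> is a vertical boundary.\<close>

theorem collapse:
  assumes exact: "\<And>p q x. 2 \<le> q \<Longrightarrow> Poly_Mapping.keys x \<subseteq> B p q \<Longrightarrow> dver A p q x = 0 \<Longrightarrow>
      \<exists>t. Poly_Mapping.keys t \<subseteq> B p (q + 1) \<and> dver A p (q + 1) t = x"
    and bottom_row: "\<And>p x u. 2 \<le> p \<Longrightarrow> Poly_Mapping.keys x \<subseteq> B p 0 \<Longrightarrow> Poly_Mapping.keys u \<subseteq> B (p - 1) 1 \<Longrightarrow>
      dhor A p 0 x + dver A (p - 1) 1 u = 0 \<Longrightarrow>
      \<exists>w t. Poly_Mapping.keys w \<subseteq> B (p + 1) 0 \<and> Poly_Mapping.keys t \<subseteq> B p 1 \<and>
            x = dhor A (p + 1) 0 w + dver A p 1 t"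
    and "2 \<le> r" and \<xi>: "\<xi> \<in> carrier (Epage A r p q)"
  shows "Ediff A r p q \<xi> = \<one>\<^bsub>Epage A r (p - int r) (q + int r - 1)\<^esub>"
proof (rule Ediff_trivial[OF _ \<xi>])
  fix x assume x: "x \<in> Zcyc A (int r) p q"
  have xF: "x \<in> Filt A p (p + q)" and Dx: "D (p + q) x \<in> Filt A (p - int r) (p + q - 1)"
    using x by (simp_all add: mem_Zcyc)
  have kx: "Poly_Mapping.keys (x i) \<subseteq> B i (p + q - i)" for i
    using xF by (simp add: mem_Filt)
  have r2: "int r \<ge> 2" using \<open>2 \<le> r\<close> by simp
  let ?goal = "\<exists>y\<in>Zcyc A (int r - 1) (p - 1) (q + 1).
      D (p + q) (\<lambda>i. x i - y i) \<in> Filt A (p - int r - 1) (p + q - 1)"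
  consider "p - int r < 0" | "q < 0" | "p - int r \<ge> 0" "q = 0" | "p - int r \<ge> 0" "q > 0" by linarith
  then show ?goal
  proof cases
    case 1
    then have "D (p + q) x = (\<lambda>_. 0)" using Filt_negative[OF Dx] by blast
    then show ?thesis by (intro bexI[OF _ zero_in_Zcyc]) (simp add: zero_in_Filt)
  next
    case 2
    then have "x p = 0" using zero_outside[OF kx[of p]] by simp
    then have "x \<in> Filt A (p - 1) (p + q)"
      using xF by (simp add: mem_Filt) (metis linorder_less_linear zle_diff1_eq not_le)
    then have "x \<in> Zcyc A (int r - 1) (p - 1) (q + 1)"
      using Dx by (simp add: mem_Zcyc)
    then show ?thesis by (intro bexI[of _ x]) (simp_all add: D_zero zero_in_Filt)
  next
    case 3
    \<comment> \<open>The sign of the vertical part in column \<open>p - 1\<close> is absorbed in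
      \<open>u\<close>. Component \<open>p - 1\<close> of \<open>D x\<close> vanishes because
      \<open>r >= 2\<close>, and this is the premise of \<open>bottom_row\<close>.\<close>
    define u where "u = (if even (p - 1) then x (p - 1) else - x (p - 1))"
    have ku: "Poly_Mapping.keys u \<subseteq> B (p - 1) 1"
      using kx[of "p - 1"] 3 by (simp add: u_def keys_minus)
    have "D (p + q) x (p - 1) = 0"
      using Dx r2 by (simp add: mem_Filt)
    then have "dhor A p 0 (x p) + dver A (p - 1) 1 u = 0"
      using 3 by (simp add: D_def u_def dver_uminus split: if_splits)
    then obtain w t where w: "Poly_Mapping.keys w \<subseteq> B (p + 1) 0" and t: "Poly_Mapping.keys t \<subseteq> B p 1"
      and xp: "x p = dhor A (p + 1) 0 w + dver A p 1 t"
      using bottom_row[of p "x p" u] kx[of p] ku 3 r2 by auto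
    \<comment> \<open>\<open>W\<close> and \<open>T\<close> are chosen so that the total boundary of
      their sum has component \<open>x p\<close> in column \<open>p\<close>; the sign in
      \<open>T\<close> cancels the one in \<open>D\<close>.\<close>
    define W where "W = (\<lambda>i. if i = p + 1 then w else 0)"
    define T where "T = (\<lambda>i. if i = p then (if even p then t else - t) else 0)"
    define V where "V = (\<lambda>i. W i + T i)"
    have V: "V \<in> Filt A (p + 1) (p + q + 1)"
      unfolding V_def W_def T_def
      by (intro Filt_add column_Filt) (use w t 3 in \<open>auto simp: keys_minus\<close>)
    have DV: "D (p + q + 1) V \<in> Filt A (p + 1) (p + q)"
      using D_Filt[OF V] by simp
    have DVp: "D (p + q + 1) V p = x p"
      unfolding V_def D_add W_def T_def D_column using 3 by (simp add: xp dver_uminus)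
    have DVp1: "D (p + q + 1) V (p + 1) = 0"
    proof -
      have "Poly_Mapping.keys (D (p + q + 1) V (p + 1)) \<subseteq> B (p + 1) (p + q - (p + 1))"
        using DV unfolding mem_Filt by blast
      also have "p + q - (p + 1) = - 1" using 3 by simp
      finally have "Poly_Mapping.keys (D (p + q + 1) V (p + 1)) \<subseteq> B (p + 1) (- 1)" .
      then show ?thesis by (rule zero_outside) simp
    qed
    have "(\<lambda>i. x i - D (p + q + 1) V i) \<in> Filt A (p - 1) (p + q)"
    proof -
      have "(\<lambda>i. x i - D (p + q + 1) V i) \<in> Filt A (p + 1) (p + q)"
        using Filt_diff[OF Filt_mono[OF xF] DV] by simp
      moreover have "x i - D (p + q + 1) V i = 0" if "i > p - 1" for i
        using that DVp DVp1 xF DV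
        by (cases "i = p"; cases "i = p + 1") (auto simp: mem_Filt)
      ultimately show ?thesis by (simp add: mem_Filt)
    qed
    moreover have DD: "D (p + q) (\<lambda>i. x i - D (p + q + 1) V i) = D (p + q) x"
      using D_D[OF V] by (simp add: D_diff)
    ultimately have "(\<lambda>i. x i - D (p + q + 1) V i) \<in> Zcyc A (int r - 1) (p - 1) (q + 1)"
      using Dx by (simp add: mem_Zcyc)
    moreover have "D (p + q) (\<lambda>i. x i - (x i - D (p + q + 1) V i)) \<in> Filt A (p - int r - 1) (p + q - 1)"
      using D_D[OF V] by (simp add: zero_in_Filt)
    ultimately show ?thesis
      by (intro bexI[of _ "\<lambda>i. x i - D (p + q + 1) V i"])
  next
    case 4
    define z where "z = D (p + q) x (p - int r)"
    have idx: "p + q - 1 - (p - int r) = q + int r - 1" by simp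
    have "Poly_Mapping.keys z \<subseteq> B (p - int r) (p + q - 1 - (p - int r))"
      using Dx unfolding mem_Filt z_def by blast
    then have kz: "Poly_Mapping.keys z \<subseteq> B (p - int r) (q + int r - 1)"
      unfolding idx .
    \<comment> \<open>With nothing to the right of column \<open>p - r\<close>, the component of
      \<open>D (D x) = 0\<close> in that column is plus or minus the vertical differential of
      \<open>z\<close>.\<close>
    have "D (p + q) x (p - int r + 1) = 0"
      using Dx by (simp add: mem_Filt)
    then have "D (p + q - 1) (D (p + q) x) (p - int r) =
        (if even (p - int r) then dver A (p - int r) (q + int r - 1) z else - dver A (p - int r) (q + int r - 1) z)"
      unfolding D_def[of "p + q - 1"] idx z_def by (simp only: dhor_0 add_0_left)
    then have "dver A (p - int r) (q + int r - 1) z = 0"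
      unfolding D_D[OF xF] by (metis neg_equal_0_iff_equal)
    then obtain t where t: "Poly_Mapping.keys t \<subseteq> B (p - int r) (q + int r)"
      and dt: "dver A (p - int r) (q + int r) t = z"
      using exact[of "q + int r - 1" z "p - int r"] kz 4 r2 by auto
    define y where "y = (\<lambda>i. if i = p - int r then (if even (p - int r) then t else - t) else 0)"
    have y: "y \<in> Filt A (p - int r) (p + q)"
      unfolding y_def by (rule column_Filt) (use t in \<open>auto simp: keys_minus algebra_simps\<close>)
    then have "y \<in> Zcyc A (int r - 1) (p - 1) (q + 1)"
      using D_Filt[OF y] Filt_mono[OF y, of "p - 1"] r2 by (simp add: mem_Zcyc)
    moreover have "D (p + q) (\<lambda>i. x i - y i) \<in> Filt A (p - int r - 1) (p + q - 1)"
    proof -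
      have "(\<lambda>i. D (p + q) x i - D (p + q) y i) \<in> Filt A (p - int r) (p + q - 1)"
        by (rule Filt_diff[OF Dx D_Filt[OF y]])
      moreover have "D (p + q) y (p - int r) = z"
        unfolding y_def D_column using dt by (simp add: dver_uminus algebra_simps)
      ultimately show ?thesis
        unfolding D_diff mem_Filt z_def
        by (metis (no_types, lifting) diff_self linorder_less_linear not_less zle_diff1_eq)
    qed
    ultimately show ?thesis by blast
  qed
qed

end

section \<open>Nerves of free categories\<close>

text \<open>The simplicial identity pairs the index \<open>(i, j)\<close>, \<open>i < j\<close>,
  with \<open>(j - 1, i)\<close>. The two terms agree up to sign, and the signs are
  opposite.\<close>

lemma alternating_double_sum_eq_0:
  fixes F :: "nat \<Rightarrow> nat \<Rightarrow> 'b \<Rightarrow>\<^sub>0 int"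
  assumes "\<And>i j. i < j \<Longrightarrow> j \<le> Suc q \<Longrightarrow> F i j = F (j - 1) i"
  shows "(\<Sum>j\<le>Suc q. \<Sum>i\<le>q. frag_cmul ((-1) ^ (i + j)) (F i j)) = 0"
proof -
  let ?t = "\<lambda>(i, j). frag_cmul ((-1) ^ (i + j)) (F i j)"
  let ?A = "{(i, j). i < j \<and> j \<le> Suc q}" and ?B = "{(i, j). j \<le> i \<and> i \<le> q}"
  have fin: "finite ?A" "finite ?B"
    by (rule finite_subset[of _ "{..Suc q} \<times> {..Suc q}"]; auto)+
  have "(\<Sum>j\<le>Suc q. \<Sum>i\<le>q. frag_cmul ((-1) ^ (i + j)) (F i j)) =
      (\<Sum>i\<le>q. \<Sum>j\<le>Suc q. frag_cmul ((-1) ^ (i + j)) (F i j))"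
    by (rule sum.swap)
  also have "\<dots> = sum ?t ({..q} \<times> {..Suc q})"
    by (rule sum.cartesian_product)
  also have "\<dots> = sum ?t (?A \<union> ?B)"
    by (rule arg_cong[where f = "sum ?t"]) auto
  also have "\<dots> = sum ?t ?A + sum ?t ?B"
    by (rule sum.union_disjoint[OF fin]) auto
  finally have split: "(\<Sum>j\<le>Suc q. \<Sum>i\<le>q. frag_cmul ((-1) ^ (i + j)) (F i j)) = sum ?t ?A + sum ?t ?B" .
  have A: "sum ?t ?A = (\<Sum>x\<in>?B. - ?t x)"
  proof (rule sum.reindex_bij_witness[of _ "\<lambda>(i, j). (j, Suc i)" "\<lambda>(i, j). (j - 1, i)"])
    fix x assume "x \<in> ?A"
    moreover obtain i k where ik: "x = (i, k)" by (cases x)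
    ultimately obtain j where k: "k = Suc j" "i \<le> j" "j \<le> q"
      by (cases k) auto
    note x = ik[unfolded k(1)] k(2,3)
    have eq: "F i (Suc j) = F j i"
      using assms[of i "Suc j"] x by simp
    have "- frag_cmul ((-1) ^ (j + i)) (F j i) = frag_cmul ((-1) ^ (i + Suc j)) (F i (Suc j))"
      unfolding eq by (simp add: add.commute[of j i])
    then show "- ?t (case x of (i, j) \<Rightarrow> (j - 1, i)) = ?t x"
      unfolding x(1) by simp
    show "(case case x of (i, j) \<Rightarrow> (j - 1, i) of (i, j) \<Rightarrow> (j, Suc i)) = x"
      "(case x of (i, j) \<Rightarrow> (j - 1, i)) \<in> ?B"
      using x by simp_all
  next
    fix x assume "x \<in> ?B"
    then show "(case case x of (i, j) \<Rightarrow> (j, Suc i) of (i, j) \<Rightarrow> (j - 1, i)) = x"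
      "(case x of (i, j) \<Rightarrow> (j, Suc i)) \<in> ?A"
      by (cases x, simp)+
  qed
  show ?thesis
    unfolding split A by (simp only: sum_negf left_minus)
qed

section \<open>Faces of nerves, recursively along the first arrow\<close>

definition pcons :: "'o \<Rightarrow> 'n \<Rightarrow> 'o list \<times> 'n list \<Rightarrow> 'o list \<times> 'n list" where
  "pcons a m = (\<lambda>(as, ms). (a # as, m # ms))"

lemma pcons_simp [simp]: "pcons a m (as, ms) = (a # as, m # ms)"
  by (simp add: pcons_def)

text \<open>The faces of \<open>nerve_face\<close> in a form that recurses behind the first arrow.
  The second clause for \<open>Suc 0\<close> is the last face of a 1-simplex, which keeps only its
  source; the final clause only makes the function total.\<close>

fun rface :: "('n \<Rightarrow> 'n \<Rightarrow> 'n) \<Rightarrow> nat \<Rightarrow> 'o list \<times> 'n list \<Rightarrow> 'o list \<times> 'n list" where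
  "rface c 0 (as, ms) = (tl as, tl ms)"
| "rface c (Suc 0) (a # b # as, m # n # ms) = (a # as, c n m # ms)"
| "rface c (Suc 0) (as, ms) = (take 1 as, [])"
| "rface c (Suc (Suc i)) (a # as, m # ms) = pcons a m (rface c (Suc i) (as, ms))"
| "rface c (Suc (Suc i)) (as, ms) = (as, ms)"

lemma rface_Suc_Suc_pcons [simp]: "rface c (Suc (Suc i)) (pcons a m \<sigma>) = pcons a m (rface c (Suc i) \<sigma>)"
  by (cases \<sigma>) simp

lemma rface_0_pcons [simp]: "rface c 0 (pcons a m \<sigma>) = \<sigma>"
  by (cases \<sigma>) simp

lemma rface_1_pcons [simp]: "rface c (Suc 0) (pcons a m (pcons b n \<sigma>)) = pcons a (c n m) \<sigma>"
  by (cases \<sigma>) simp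

lemma nerve_0: "\<sigma> \<in> nerve D 0 \<longleftrightarrow> (\<exists>a\<in>Obj D. \<sigma> = ([a], []))"
  by (auto simp: nerve_def length_Suc_conv)

lemma nerve_Suc_iff:
  "(a # b # as, m # ms) \<in> nerve D (Suc q) \<longleftrightarrow>
     a \<in> Obj D \<and> m \<in> Hom D a b \<and> (b # as, ms) \<in> nerve D q"
  by (auto simp: nerve_def less_Suc_eq_0_disj)

lemma nerve_SucE:
  assumes "\<sigma> \<in> nerve D (Suc q)"
  obtains a b as m ms where "\<sigma> = (a # b # as, m # ms)" "a \<in> Obj D" "b \<in> Obj D" "m \<in> Hom D a b"
    "(b # as, ms) \<in> nerve D q"
proof -
  obtain as ms where \<sigma>: "\<sigma> = (as, ms)" by fastforce
  with assms have "length as = Suc (Suc q)" "length ms = Suc q" by (auto simp: nerve_def)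
  then obtain a b as' m ms' where s: "\<sigma> = (a # b # as', m # ms')"
    using \<sigma> by (auto simp: length_Suc_conv)
  with assms show ?thesis
    by (intro that[OF s]) (auto simp: nerve_Suc_iff, auto simp: nerve_def)
qed

lemma nerve_Suc_pcons:
  assumes "\<sigma> \<in> nerve D (Suc q)"
  shows "\<exists>a b as m ms. \<sigma> = pcons a m (b # as, ms) \<and> a \<in> Obj D \<and> b \<in> Obj D \<and> m \<in> Hom D a b \<and>
    (b # as, ms) \<in> nerve D q"
  by (rule nerve_SucE[OF assms]) fastforce

lemma nerve_face_eq_rface:
  assumes "length as = Suc q" "length ms = q" "i \<le> q" "0 < q"
  shows "nerve_face D q i (as, ms) = rface (Comp D) i (as, ms)"
  using assms
proof (induction i arbitrary: as ms q)
  case 0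
  then show ?case by (auto simp: nerve_face_def delete_nth_def drop_Suc)
next
  case (Suc i)
  then obtain q' where q: "q = Suc q'" by (cases q) auto
  with Suc.prems obtain a as' m ms' where s: "as = a # as'" "ms = m # ms'" "length as' = Suc q'" "length ms' = q'"
    by (cases as; cases ms) auto
  show ?case
  proof (cases i)
    case 0
    then show ?thesis
      using s q by (cases as'; cases ms') (auto simp: nerve_face_def delete_nth_def)
  next
    case (Suc j)
    have "nerve_face D q' i (as', ms') = rface (Comp D) i (as', ms')"
      using Suc.IH[of as' q' ms'] Suc.prems s q Suc by auto
    moreover have "nerve_face D q (Suc i) (as, ms) = pcons a m (nerve_face D q' i (as', ms'))"
      using s q Suc by (auto simp: nerve_face_def delete_nth_def)
    ultimately show ?thesis using Suc s by simp
  qed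
qed

text \<open>Only \<open>d_0\<close> moves the initial object. This keeps a face composable with an
  arrow put in front of it.\<close>

lemma hd_rface:
  assumes "length as = length ms" "i < length ms"
  shows "fst (rface c (Suc i) (b # as, ms)) \<noteq> []" "hd (fst (rface c (Suc i) (b # as, ms))) = b"
proof -
  have *: "\<exists>bs ns. rface c (Suc i) (b # as, ms) = (b # bs, ns)"
  proof (cases i)
    case 0
    with assms show ?thesis
      by (cases as; cases ms; cases "tl ms") auto
  next
    case (Suc j)
    with assms show ?thesis
      by (cases ms; cases "rface c (Suc j) (as, tl ms)") auto
  qed
  then show "fst (rface c (Suc i) (b # as, ms)) \<noteq> []" "hd (fst (rface c (Suc i) (b # as, ms))) = b"
    by auto
qed

text \<open>Omitting the face \<open>d\<^sub>0\<close> from the boundary gives an operator with a recursion along \<open>pcons\<close>.\<close>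

definition bdp :: "('n \<Rightarrow> 'n \<Rightarrow> 'n) \<Rightarrow> nat \<Rightarrow> 'o list \<times> 'n list \<Rightarrow> ('o list \<times> 'n list) \<Rightarrow>\<^sub>0 int" where
  "bdp c q \<sigma> = (\<Sum>i<q. frag_cmul ((-1) ^ Suc i) (frag_of (rface c (Suc i) \<sigma>)))"

definition bd :: "('n \<Rightarrow> 'n \<Rightarrow> 'n) \<Rightarrow> nat \<Rightarrow> 'o list \<times> 'n list \<Rightarrow> ('o list \<times> 'n list) \<Rightarrow>\<^sub>0 int" where
  "bd c q \<sigma> = (\<Sum>i\<le>q. frag_cmul ((-1) ^ i) (frag_of (rface c i \<sigma>)))"

abbreviation econs :: "'o \<Rightarrow> 'n \<Rightarrow> (('o list \<times> 'n list) \<Rightarrow>\<^sub>0 int) \<Rightarrow> ('o list \<times> 'n list) \<Rightarrow>\<^sub>0 int" where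
  "econs a m \<equiv> frag_extend (frag_of \<circ> pcons a m)"

lemma bd_pcons: "bd c q (pcons a m \<sigma>) = frag_of \<sigma> + bdp c q (pcons a m \<sigma>)"
proof -
  have "bd c q (pcons a m \<sigma>) = (\<Sum>i<Suc q. frag_cmul ((-1) ^ i) (frag_of (rface c i (pcons a m \<sigma>))))"
    by (simp only: bd_def lessThan_Suc_atMost)
  also have "\<dots> = frag_of \<sigma> + bdp c q (pcons a m \<sigma>)"
    by (simp only: sum.lessThan_Suc_shift bdp_def rface_0_pcons power_0 frag_cmul_one)
  finally show ?thesis .
qed

text \<open>The face \<open>d_1\<close> composes the first two arrows. Every later face acts behind
  \<open>m\<close>, with its index, and hence its sign, shifted by one.\<close>

lemma bdp_pcons_pcons:
  "bdp c (Suc (Suc q)) (pcons a m (pcons b n \<sigma>)) =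
     - frag_of (pcons a (c n m) \<sigma>) - econs a m (bdp c (Suc q) (pcons b n \<sigma>))"
proof -
  have "bdp c (Suc (Suc q)) (pcons a m (pcons b n \<sigma>)) = - frag_of (pcons a (c n m) \<sigma>) +
     (\<Sum>i<Suc q. frag_cmul ((-1) ^ Suc (Suc i)) (frag_of (pcons a m (rface c (Suc i) (pcons b n \<sigma>)))))"
    unfolding bdp_def sum.lessThan_Suc_shift[of _ "Suc q"] by simp
  also have "(\<Sum>i<Suc q. frag_cmul ((-1) ^ Suc (Suc i)) (frag_of (pcons a m (rface c (Suc i) (pcons b n \<sigma>)))))
      = - econs a m (bdp c (Suc q) (pcons b n \<sigma>))"
    unfolding bdp_def
    by (simp add: frag_extend_sum frag_extend_cmul comp_def del: sum.lessThan_Suc flip: sum_negf)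
  finally show ?thesis by simp
qed

lemma keys_signed_sum:
  assumes "\<And>i. i \<in> I \<Longrightarrow> g i \<in> S"
  shows "Poly_Mapping.keys (\<Sum>i\<in>I. frag_cmul (c i) (frag_of (g i))) \<subseteq> S"
proof -
  have "(\<Sum>i\<in>I. frag_cmul (c i) (frag_of (g i))) \<in> carrier (free_Abelian_group S)"
    by (rule sum_closed_free_Abelian_group) (use assms keys_cmul in auto)
  then show ?thesis by simp
qed

lemma hd_bdp:
  assumes "length as = q" "length ms = q"
  shows "Poly_Mapping.keys (bdp c q (b # as, ms)) \<subseteq> {\<sigma>. fst \<sigma> \<noteq> [] \<and> hd (fst \<sigma>) = b}"
  unfolding bdp_def by (rule keys_signed_sum) (use hd_rface[of as ms _ c b] assms in simp)

section \<open>Simplicial identities for nerves of categories\<close>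

locale cat_laws =
  fixes D :: "('o, 'n) cat"
  assumes ident_closed: "a \<in> Obj D \<Longrightarrow> Ident D a \<in> Hom D a a"
    and comp_closed: "\<lbrakk>a \<in> Obj D; b \<in> Obj D; c \<in> Obj D; f \<in> Hom D a b; g \<in> Hom D b c\<rbrakk> \<Longrightarrow> Comp D g f \<in> Hom D a c"
    and comp_assoc: "\<lbrakk>a \<in> Obj D; b \<in> Obj D; c \<in> Obj D; d \<in> Obj D; f \<in> Hom D a b; g \<in> Hom D b c; h \<in> Hom D c d\<rbrakk>
      \<Longrightarrow> Comp D h (Comp D g f) = Comp D (Comp D h g) f"
    and comp_ident_left: "\<lbrakk>a \<in> Obj D; b \<in> Obj D; f \<in> Hom D a b\<rbrakk> \<Longrightarrow> Comp D (Ident D b) f = f"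
    and comp_ident_right: "\<lbrakk>a \<in> Obj D; b \<in> Obj D; f \<in> Hom D a b\<rbrakk> \<Longrightarrow> Comp D f (Ident D a) = f"
begin

lemma nerve_rface:
  assumes "\<sigma> \<in> nerve D (Suc q)" "i \<le> Suc q"
  shows "rface (Comp D) i \<sigma> \<in> nerve D q"
  using assms
proof (induction i arbitrary: \<sigma> q)
  case 0
  then show ?case by (auto elim!: nerve_SucE)
next
  case (Suc i)
  obtain a b as m ms where s: "\<sigma> = (a # b # as, m # ms)" "a \<in> Obj D" "b \<in> Obj D" "m \<in> Hom D a b"
    "(b # as, ms) \<in> nerve D q"
    using Suc.prems by (elim nerve_SucE)
  show ?case
  proof (cases i)
    case 0
    show ?thesis
    proof (cases q)
      case 0
      with s \<open>i = 0\<close> show ?thesis by (auto simp: nerve_0)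
    next
      case (Suc q')
      then have "(b # as, ms) \<in> nerve D (Suc q')" using s by simp
      then obtain e as' n ms' where t: "as = e # as'" "ms = n # ms'" "e \<in> Obj D" "n \<in> Hom D b e"
        "(e # as', ms') \<in> nerve D q'"
        by (elim nerve_SucE) auto
      then show ?thesis using s \<open>i = 0\<close> Suc comp_closed by (auto simp: nerve_Suc_iff)
    qed
  next
    case (Suc j)
    with Suc.prems obtain q' where q: "q = Suc q'" by (cases q) auto
    have r: "rface (Comp D) i (b # as, ms) \<in> nerve D q'"
      using Suc.IH[of "(b # as, ms)" q'] s q Suc.prems by simp
    have l: "length as = length ms" "j < length ms"
      using s(5) q Suc Suc.prems by (auto simp: nerve_def)
    obtain bs ns where e: "rface (Comp D) i (b # as, ms) = (b # bs, ns)"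
      using hd_rface[OF l, of "Comp D" b] Suc
      by (metis hd_Cons_tl prod.collapse)
    then show ?thesis using r s Suc q by (simp add: nerve_Suc_iff)
  qed
qed

text \<open>Mostly the two faces act at separate places. The case \<open>i = 1\<close>,
  \<open>j = 2\<close> is the one where both compose with the same middle arrow, and there the
  identity is associativity.\<close>

lemma rface_rface:
  assumes "\<sigma> \<in> nerve D (Suc q)" "0 < q" "i < j" "j \<le> Suc q"
  shows "rface (Comp D) i (rface (Comp D) j \<sigma>) = rface (Comp D) (j - 1) (rface (Comp D) i \<sigma>)"
  using assms
proof (induction i arbitrary: \<sigma> q j)
  case 0
  obtain q' where q: "q = Suc q'" using 0 by (cases q) auto
  obtain a b as m ms where s: "\<sigma> = pcons a m (b # as, ms)" "(b # as, ms) \<in> nerve D (Suc q')"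
    using nerve_Suc_pcons 0(1) unfolding q by blast
  then obtain e as' n ms' where "(b # as, ms) = pcons b n (e # as', ms')"
    using nerve_Suc_pcons[OF s(2)] by auto
  with s have \<sigma>: "\<sigma> = pcons a m (pcons b n (e # as', ms'))" by simp
  from 0(3) consider "j = Suc 0" | j' where "j = Suc (Suc j')"
    by (cases j; cases "j - 1") auto
  then show ?case
  proof cases
    case 1
    then show ?thesis by (simp only: \<sigma> diff_Suc_1 rface_1_pcons rface_0_pcons)
  next
    case 2
    then show ?thesis by (simp only: \<sigma> diff_Suc_1 rface_Suc_Suc_pcons rface_0_pcons)
  qed
next
  case (Suc i)
  obtain q' where q: "q = Suc q'" using Suc.prems by (cases q) auto
  obtain a b as m ms where s: "\<sigma> = pcons a m (b # as, ms)" "(b # as, ms) \<in> nerve D (Suc q')"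
     "a \<in> Obj D" "b \<in> Obj D" "m \<in> Hom D a b"
    using nerve_Suc_pcons Suc.prems(1) unfolding q by blast
  then obtain e as' n ms' where "(b # as, ms) = pcons b n (e # as', ms')" "e \<in> Obj D" "n \<in> Hom D b e"
      "(e # as', ms') \<in> nerve D q'"
    using nerve_Suc_pcons[OF s(2)] by auto
  with s have t: "\<sigma> = pcons a m (pcons b n (e # as', ms'))" "e \<in> Obj D" "n \<in> Hom D b e"
      "(e # as', ms') \<in> nerve D q'"
    by simp_all
  obtain j' where j: "j = Suc (Suc j')" using Suc.prems by (cases j; cases "j - 1") auto
  show ?case
  proof (cases i)
    case i: 0
    show ?thesis
    proof (cases j')
      case 0
      show ?thesis
      proof (cases q')
        case 0
        with t have "as' = []" "ms' = []" by (auto simp: nerve_def)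
        then show ?thesis using t i j \<open>j' = 0\<close> by simp
      next
        case (Suc q'')
        then obtain d as'' k ms'' where u: "as' = d # as''" "ms' = k # ms''" "d \<in> Obj D" "k \<in> Hom D e d"
          using nerve_Suc_pcons[OF t(4)[unfolded Suc]] by auto
        have "Comp D k (Comp D n m) = Comp D (Comp D k n) m"
          by (rule comp_assoc[of a b e d]) (use s t u in auto)
        then show ?thesis using t u i j \<open>j' = 0\<close> by simp
      qed
    next
      case (Suc j'')
      then show ?thesis using t(1) i j by (simp del: pcons_simp)
    qed
  next
    case (Suc i')
    then have "rface (Comp D) i (rface (Comp D) (Suc j') (b # as, ms)) =
       rface (Comp D) (Suc j' - 1) (rface (Comp D) i (b # as, ms))"
      by (intro Suc.IH[of _ q']) (use s Suc.prems q j in auto)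
    moreover obtain j'' where "j' = Suc j''" using Suc Suc.prems j by (cases j') auto
    ultimately show ?thesis using s(1) j Suc by (simp del: pcons_simp)
  qed
qed

lemma bd_closed: "\<sigma> \<in> nerve D (Suc q) \<Longrightarrow> Poly_Mapping.keys (bd (Comp D) (Suc q) \<sigma>) \<subseteq> nerve D q"
  unfolding bd_def by (rule keys_signed_sum) (simp add: nerve_rface del: rface.simps)

lemma bd_bd:
  assumes "\<sigma> \<in> nerve D (Suc q)" "0 < q"
  shows "frag_extend (bd (Comp D) q) (bd (Comp D) (Suc q) \<sigma>) = 0"
proof -
  have "frag_extend (bd (Comp D) q) (bd (Comp D) (Suc q) \<sigma>) =
     (\<Sum>j\<le>Suc q. \<Sum>i\<le>q. frag_cmul ((-1) ^ (i + j)) (frag_of (rface (Comp D) i (rface (Comp D) j \<sigma>))))"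
    unfolding bd_def[of _ "Suc q"]
    by (simp add: frag_extend_sum frag_extend_cmul comp_def bd_def frag_cmul_sum power_add mult.commute
        del: sum.atMost_Suc)
  also have "\<dots> = 0"
    by (rule alternating_double_sum_eq_0) (simp add: rface_rface[OF assms])
  finally show ?thesis .
qed

end


lemmas frag_carrier_induct = free_Abelian_group_induct [consumes 1, case_names zero diff gen]

lemma frag_extend_closed:
  assumes "Poly_Mapping.keys x \<subseteq> S" "\<And>s. s \<in> S \<Longrightarrow> Poly_Mapping.keys (f s) \<subseteq> T"
  shows "Poly_Mapping.keys (frag_extend f x) \<subseteq> T"
  using keys_frag_extend[of f x] assms by blast

text \<open>Freeness in the form of a length function together with the unique removal of a first
  generator. Iterating the removal writes each morphism uniquely as a composite of morphisms of
  length 1.\<close>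

locale free_cat = cat_laws +
  fixes len :: "'b \<Rightarrow> nat"
  assumes len_comp: "\<lbrakk>a \<in> Obj D; b \<in> Obj D; c \<in> Obj D; f \<in> Hom D a b; g \<in> Hom D b c\<rbrakk> \<Longrightarrow>
      len (Comp D g f) = len f + len g"
    and len_eq_0: "\<lbrakk>a \<in> Obj D; b \<in> Obj D; f \<in> Hom D a b; len f = 0\<rbrakk> \<Longrightarrow> a = b \<and> f = Ident D a"
    and factor: "\<lbrakk>a \<in> Obj D; b \<in> Obj D; f \<in> Hom D a b; len f > 0\<rbrakk> \<Longrightarrow>
      \<exists>!(c, g, r). c \<in> Obj D \<and> g \<in> Hom D a c \<and> r \<in> Hom D c b \<and> len g = 1 \<and> f = Comp D r g"
begin

lemma len_ident: "a \<in> Obj D \<Longrightarrow> len (Ident D a) = 0"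
  using len_comp[of a a a "Ident D a" "Ident D a"] ident_closed[of a] comp_ident_left[of a a "Ident D a"]
  by simp

definition first_factor :: "'a \<Rightarrow> 'a \<Rightarrow> 'b \<Rightarrow> 'a \<times> 'b \<times> 'b" where
  "first_factor a b f =
    (THE (c, g, r). c \<in> Obj D \<and> g \<in> Hom D a c \<and> r \<in> Hom D c b \<and> len g = 1 \<and> f = Comp D r g)"

lemma first_factor_eq:
  assumes "a \<in> Obj D" "b \<in> Obj D" "c \<in> Obj D" "g \<in> Hom D a c" "r \<in> Hom D c b" "len g = 1"
  shows "first_factor a b (Comp D r g) = (c, g, r)"
proof -
  have "\<exists>!(c', g', r'). c' \<in> Obj D \<and> g' \<in> Hom D a c' \<and> r' \<in> Hom D c' b \<and> len g' = 1 \<and> Comp D r g = Comp D r' g'"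
    by (rule factor) (use assms comp_closed[of a c b g r] len_comp[of a c b g r] in auto)
  from the1_equality[OF this, of "(c, g, r)"] show ?thesis
    unfolding first_factor_def using assms by simp
qed

lemma first_factorE:
  assumes "a \<in> Obj D" "b \<in> Obj D" "f \<in> Hom D a b" "len f > 0"
  obtains c g r where "c \<in> Obj D" "g \<in> Hom D a c" "r \<in> Hom D c b" "len g = 1" "f = Comp D r g"
    "first_factor a b f = (c, g, r)" "len f = Suc (len r)"
proof -
  obtain c g r where "c \<in> Obj D" "g \<in> Hom D a c" "r \<in> Hom D c b" "len g = 1" "f = Comp D r g"
    using factor[OF assms] by auto
  with that show ?thesis using first_factor_eq[of a b c g r] assms len_comp[of a c b g r] by simp
qed

text \<open>The entry \<open>(a\<^sub>j, c\<^sub>j, g\<^sub>j, r\<^sub>j)\<close> consists of the \<open>j\<close>-th generator \<open>g\<^sub>j : a\<^sub>j \<rightarrow> c\<^sub>j\<close> of a morphism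
  into \<open>b\<close> and of the composite \<open>r\<^sub>j\<close> of all later generators.\<close>

primrec factors_upto :: "nat \<Rightarrow> 'a \<Rightarrow> 'a \<Rightarrow> 'b \<Rightarrow> ('a \<times> 'a \<times> 'b \<times> 'b) list" where
  "factors_upto 0 a b f = []"
| "factors_upto (Suc n) a b f =
    (case first_factor a b f of (c, g, r) \<Rightarrow> (a, c, g, r) # factors_upto n c b r)"

definition factors :: "'a \<Rightarrow> 'a \<Rightarrow> 'b \<Rightarrow> ('a \<times> 'a \<times> 'b \<times> 'b) list" where
  "factors a b f = factors_upto (len f) a b f"

lemma factors_0: "len f = 0 \<Longrightarrow> factors a b f = []"
  by (simp add: factors_def)

lemma factors_comp_generator:
  assumes "a \<in> Obj D" "b \<in> Obj D" "c \<in> Obj D" "g \<in> Hom D a c" "r \<in> Hom D c b" "len g = 1"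
  shows "factors a b (Comp D r g) = (a, c, g, r) # factors c b r"
  using first_factor_eq[OF assms] len_comp[of a c b g r] assms by (simp add: factors_def)

lemma hom_induct [consumes 3, case_names ident comp]:
  assumes "a \<in> Obj D" "b \<in> Obj D" "f \<in> Hom D a b"
    and "P b (Ident D b)"
    and "\<And>a c g r. \<lbrakk>a \<in> Obj D; c \<in> Obj D; g \<in> Hom D a c; r \<in> Hom D c b; len g = 1; P c r\<rbrakk> \<Longrightarrow>
      P a (Comp D r g)"
  shows "P a f"
  using assms(1,3)
proof (induction "len f" arbitrary: a f)
  case 0
  then show ?case using len_eq_0[of a b f] assms by auto
next
  case (Suc n)
  obtain c g r where "c \<in> Obj D" "g \<in> Hom D a c" "r \<in> Hom D c b" "len g = 1" "f = Comp D r g" "len f = Suc (len r)"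
    using first_factorE[OF Suc.prems(1) assms(2) Suc.prems(2)] Suc.hyps(2) by (metis zero_less_Suc)
  then show ?case using Suc.hyps Suc.prems assms(5) by simp
qed

lemma factors_closed:
  assumes "a \<in> Obj D" "b \<in> Obj D" "f \<in> Hom D a b" "(a', c', g, r) \<in> set (factors a b f)"
  shows "a' \<in> Obj D" "c' \<in> Obj D" "g \<in> Hom D a' c'" "r \<in> Hom D c' b"
proof -
  have "\<forall>(a', c', g, r) \<in> set (factors a b f). a' \<in> Obj D \<and> c' \<in> Obj D \<and> g \<in> Hom D a' c' \<and> r \<in> Hom D c' b"
    using assms(1-3)
  proof (induction rule: hom_induct)
    case ident
    then show ?case using len_ident[OF assms(2)] by (simp add: factors_0)
  next
    case (comp a c g r)
    then show ?case using assms(2) by (auto simp: factors_comp_generator)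
  qed
  with assms(4) show "a' \<in> Obj D" "c' \<in> Obj D" "g \<in> Hom D a' c'" "r \<in> Hom D c' b" by auto
qed

text \<open>A Leibniz rule as in Fox calculus: the generators of \<open>f\<close> come first, with
  \<open>h\<close> appended to their remainders, followed by those of \<open>h\<close>.\<close>

lemma factors_comp:
  assumes "a \<in> Obj D" "b \<in> Obj D" "f \<in> Hom D a b" and "e \<in> Obj D" "h \<in> Hom D b e"
  shows "factors a e (Comp D h f) =
     map (\<lambda>(a', c', g, r). (a', c', g, Comp D h r)) (factors a b f) @ factors b e h"
  using assms(1-3)
proof (induction rule: hom_induct)
  case ident
  then show ?case using len_ident[OF assms(2)] comp_ident_right assms by (simp add: factors_0)
next
  case (comp a c g r)
  have "Comp D h (Comp D r g) = Comp D (Comp D h r) g"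
    using comp assms comp_assoc[of a c b e g r h] by simp
  moreover have "Comp D h r \<in> Hom D c e"
    using comp assms comp_closed[of c b e r h] by simp
  ultimately show ?case
    using comp assms by (simp add: factors_comp_generator)
qed

text \<open>\<open>Comp D r g\<close> is the remainder before the generator \<open>g\<close> is
  removed, that is, the remainder stored in the preceding entry, so neighbouring summands
  cancel.\<close>

lemma factors_telescope:
  fixes F :: "'a \<Rightarrow> 'b \<Rightarrow> 'c :: ab_group_add"
  assumes "a \<in> Obj D" "b \<in> Obj D" "f \<in> Hom D a b"
  shows "(\<Sum>(a', c', g, r)\<leftarrow>factors a b f. F c' r - F a' (Comp D r g)) = F b (Ident D b) - F a f"
  using assms
proof (induction rule: hom_induct)
  case ident
  then show ?case using len_ident[OF assms(2)] by (simp add: factors_0)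
next
  case (comp a c g r)
  then show ?case using assms(2) by (simp add: factors_comp_generator)
qed

text \<open>The splitting homotopy known from free monoids: the summand for the \<open>j\<close>-th
  generator forgets the earlier generators and breaks what is left into that generator and its
  remainder.\<close>

fun T :: "'a list \<times> 'b list \<Rightarrow> ('a list \<times> 'b list) \<Rightarrow>\<^sub>0 int" where
  "T (a # b # as, m # ms) =
     (\<Sum>(a', c', g, r)\<leftarrow>factors a b m. frag_of (pcons a' g (pcons c' r (b # as, ms))))"
| "T _ = 0"

fun S :: "'a list \<times> 'b list \<Rightarrow> 'a list \<times> 'b list" where
  "S (a # as, ms) = pcons a (Ident D a) (a # as, ms)"
| "S \<sigma> = \<sigma>"

abbreviation "dd q \<equiv> frag_extend (bd (Comp D) q)"
abbreviation "eT \<equiv> frag_extend T"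
abbreviation "eS \<equiv> frag_extend (frag_of \<circ> S)"

lemma T_closed:
  assumes "\<sigma> \<in> nerve D (Suc q)"
  shows "Poly_Mapping.keys (T \<sigma>) \<subseteq> nerve D (Suc (Suc q))"
proof -
  obtain a b as m ms where s: "\<sigma> = (a # b # as, m # ms)" "a \<in> Obj D" "b \<in> Obj D" "m \<in> Hom D a b"
    "(b # as, ms) \<in> nerve D q"
    using assms by (elim nerve_SucE)
  have *: "Poly_Mapping.keys (\<Sum>(a', c', g, r)\<leftarrow>xs. frag_of (pcons a' g (pcons c' r (b # as, ms)))) \<subseteq> nerve D (Suc (Suc q))"
    if "set xs \<subseteq> set (factors a b m)" for xs
    using that
  proof (induction xs)
    case (Cons x xs)
    obtain a' c' g r where x: "x = (a', c', g, r)" by (cases x)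
    have "(a' # c' # b # as, g # r # ms) \<in> nerve D (Suc (Suc q))"
      using factors_closed[OF s(2-4), of a' c' g r] Cons.prems s by (simp add: nerve_Suc_iff x)
    then show ?case
      using Cons Poly_Mapping.keys_add by (force simp: x)
  qed simp
  show ?thesis using *[of "factors a b m"] s(1) by simp
qed

lemma S_closed: "\<sigma> \<in> nerve D q \<Longrightarrow> S \<sigma> \<in> nerve D (Suc q)"
proof (cases q)
  case 0
  assume "\<sigma> \<in> nerve D q"
  with 0 show ?thesis using ident_closed by (auto simp: nerve_0 nerve_Suc_iff[where as = "[]" and ms = "[]"])
next
  case (Suc q')
  assume "\<sigma> \<in> nerve D q"
  with Suc show ?thesis using ident_closed by (auto elim!: nerve_SucE simp: nerve_Suc_iff)
qed

lemma frag_extend_sum_list: "frag_extend f (\<Sum>x\<leftarrow>xs. g x) = (\<Sum>x\<leftarrow>xs. frag_extend f (g x))"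
  by (induction xs) (simp_all add: frag_extend_add)

text \<open>\<open>T\<close> inspects only the first arrow and its target, and leaves the tail
  alone. The assumption on the heads ensures that \<open>b\<close> is the target it finds.\<close>

lemma eT_econs:
  assumes "Poly_Mapping.keys x \<subseteq> {\<sigma>. fst \<sigma> \<noteq> [] \<and> hd (fst \<sigma>) = b}"
  shows "eT (econs a m x) = (\<Sum>(a', c', g, r)\<leftarrow>factors a b m. econs a' g (econs c' r x))"
  using assms
proof (induction x rule: frag_carrier_induct)
  case zero
  show ?case by (induction "factors a b m") auto
next
  case (diff x y)
  then show ?case
    by (simp add: frag_extend_diff case_prod_unfold sum_list_subtractf)
next
  case (gen \<sigma>)
  then obtain as ms where "\<sigma> = (b # as, ms)" by (cases \<sigma>; cases "fst \<sigma>") auto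
  then show ?case by simp
qed

text \<open>\<open>T\<close> is a chain homotopy from the identity to \<open>s\<^sub>0 d\<^sub>0\<close> in degrees \<open>q \<ge> 2\<close>: the faces of the
  summands \<open>(g\<^sub>j, r\<^sub>j, m\<^sub>2, \<dots>)\<close> of \<open>T (m\<^sub>1, m\<^sub>2, \<dots>)\<close> that drop or compose the first two entries telescope.\<close>

lemma bd_T:
  assumes "\<sigma> \<in> nerve D (Suc (Suc q))"
  shows "dd (Suc (Suc (Suc q))) (T \<sigma>) + eT (bd (Comp D) (Suc (Suc q)) \<sigma>) =
     frag_of (S (rface (Comp D) 0 \<sigma>)) - frag_of \<sigma>"
proof -
  obtain a b as0 m ms0 where s: "\<sigma> = pcons a m (b # as0, ms0)" "a \<in> Obj D" "b \<in> Obj D" "m \<in> Hom D a b"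
    "(b # as0, ms0) \<in> nerve D (Suc q)"
    using nerve_Suc_pcons[OF assms] by blast
  obtain e as n ms where t: "(b # as0, ms0) = pcons b n (e # as, ms)" "e \<in> Obj D" "n \<in> Hom D b e"
    "(e # as, ms) \<in> nerve D q"
    using nerve_Suc_pcons[OF s(5)] by auto
  have \<sigma>: "\<sigma> = pcons a m (pcons b n (e # as, ms))"
    using s t by simp
  define \<beta> where "\<beta> = bdp (Comp D) (Suc q) (pcons b n (e # as, ms))"
  have k\<beta>: "Poly_Mapping.keys \<beta> \<subseteq> {\<sigma>. fst \<sigma> \<noteq> [] \<and> hd (fst \<sigma>) = b}"
  proof -
    have "length as = q" "length ms = q" using t(4) by (auto simp: nerve_def)
    then show ?thesis
      unfolding \<beta>_def using hd_bdp[of "e # as" "Suc q" "n # ms" "Comp D" b] by simp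
  qed
  let ?G = "\<lambda>a' m. frag_of (pcons a' m (pcons b n (e # as, ms)))"
  let ?Q = "\<lambda>(a', c', g, r). frag_of (pcons a' g (pcons c' (Comp D n r) (e # as, ms)))"
  let ?R = "\<lambda>(a', c', g, r). econs a' g (econs c' r \<beta>)"
  let ?tau = "T (pcons b n (e # as, ms))"
  \<comment> \<open>The faces \<open>d_0\<close> and \<open>d_1\<close> give the bracketed
    difference, \<open>d_2\<close> gives \<open>?Q\<close>, and the later faces, acting behind both
    factors, give \<open>?R\<close>.\<close>
  have dT: "bd (Comp D) (Suc (Suc (Suc q))) (pcons a' g (pcons c' r (pcons b n (e # as, ms)))) =
      (?G c' r - ?G a' (Comp D r g)) + ?Q (a', c', g, r) + ?R (a', c', g, r)" for a' c' g r
    unfolding bd_pcons bdp_pcons_pcons[of _ "Suc q"] bdp_pcons_pcons[of _ q] \<beta>_def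
    by (simp add: frag_extend_diff frag_extend_minus frag_extend_cmul del: pcons_simp)
  have "dd (Suc (Suc (Suc q))) (T \<sigma>) =
      (\<Sum>x\<leftarrow>factors a b m. (case x of (a', c', g, r) \<Rightarrow> ?G c' r - ?G a' (Comp D r g)) + ?Q x + ?R x)"
  proof -
    have "T \<sigma> = (\<Sum>(a', c', g, r)\<leftarrow>factors a b m. frag_of (pcons a' g (pcons c' r (pcons b n (e # as, ms)))))"
      unfolding \<sigma> by simp
    then show ?thesis
      by (auto simp: frag_extend_sum_list dT[unfolded prod.case] case_prod_unfold simp del: pcons_simp
          intro!: arg_cong[where f = sum_list] map_cong)
  qed
  also have "\<dots> = (\<Sum>(a', c', g, r)\<leftarrow>factors a b m. ?G c' r - ?G a' (Comp D r g)) +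
      (\<Sum>x\<leftarrow>factors a b m. ?Q x) + (\<Sum>x\<leftarrow>factors a b m. ?R x)"
    by (simp only: sum_list_addf)
  also have "(\<Sum>(a', c', g, r)\<leftarrow>factors a b m. ?G c' r - ?G a' (Comp D r g)) = ?G b (Ident D b) - ?G a m"
    by (rule factors_telescope) (use s in auto)
  finally have 1: "dd (Suc (Suc (Suc q))) (T \<sigma>) = ?G b (Ident D b) - ?G a m +
      (\<Sum>x\<leftarrow>factors a b m. ?Q x) + (\<Sum>x\<leftarrow>factors a b m. ?R x)" .
  have "eT (bd (Comp D) (Suc (Suc q)) \<sigma>) =
      ?tau - T (pcons a (Comp D n m) (e # as, ms)) - eT (econs a m \<beta>)"
    unfolding \<sigma> bd_pcons bdp_pcons_pcons \<beta>_def
    by (simp add: frag_extend_add frag_extend_diff frag_extend_minus frag_extend_cmul del: pcons_simp)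
  also have "eT (econs a m \<beta>) = (\<Sum>x\<leftarrow>factors a b m. ?R x)"
    by (rule eT_econs[OF k\<beta>])
  \<comment> \<open>The face \<open>d_1\<close> of the simplex composes \<open>n\<close> with
    \<open>m\<close>. By the Leibniz rule its \<open>T\<close> reproduces the \<open>?Q\<close>
    terms, plus a copy of \<open>?tau\<close> that cancels the contribution of
    \<open>d_0\<close>.\<close>
  also have "T (pcons a (Comp D n m) (e # as, ms)) = (\<Sum>x\<leftarrow>factors a b m. ?Q x) + ?tau"
  proof -
    have "factors a e (Comp D n m) = map (\<lambda>(a', c', g, r). (a', c', g, Comp D n r)) (factors a b m) @ factors b e n"
      by (rule factors_comp) (use s t in auto)
    then show ?thesis
      by (simp add: comp_def case_prod_unfold)
  qed
  finally have 2: "eT (bd (Comp D) (Suc (Suc q)) \<sigma>) =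
      ?tau - ((\<Sum>x\<leftarrow>factors a b m. ?Q x) + ?tau) - (\<Sum>x\<leftarrow>factors a b m. ?R x)" .
  have 3: "frag_of (S (rface (Comp D) 0 \<sigma>)) = ?G b (Ident D b)"
    unfolding \<sigma> rface_0_pcons by simp
  show ?thesis unfolding 1 2 3 unfolding \<sigma> by (simp add: algebra_simps del: pcons_simp)
qed

text \<open>The simplices \<open>s_0 \<sigma>\<close> carry no homology: a second identity in front
  is a contraction. The faces \<open>d_0\<close>, \<open>d_1\<close>, \<open>d_2\<close> of
  \<open>S (S \<sigma>)\<close> all equal \<open>S \<sigma>\<close>, so one copy survives.\<close>

lemma bd_S_S:
  assumes "\<sigma> \<in> nerve D (Suc q)"
  shows "bd (Comp D) (Suc (Suc (Suc q))) (S (S \<sigma>)) = frag_of (S \<sigma>) - eS (bd (Comp D) (Suc (Suc q)) (S \<sigma>))"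
proof -
  obtain b e as n ms where s: "\<sigma> = pcons b n (e # as, ms)" "b \<in> Obj D" "e \<in> Obj D" "n \<in> Hom D b e"
    "(e # as, ms) \<in> nerve D q"
    using nerve_Suc_pcons[OF assms] by blast
  let ?i = "Ident D b"
  have S1: "S \<sigma> = pcons b ?i \<sigma>" and S2: "S (S \<sigma>) = pcons b ?i (pcons b ?i \<sigma>)"
    using s by simp_all
  have id: "Comp D n ?i = n" "Comp D ?i ?i = ?i"
    using comp_ident_right[of b e n] comp_ident_right[of b b ?i] ident_closed s by auto
  have "length as = q" "length ms = q" using s(5) by (auto simp: nerve_def)
  then have k: "Poly_Mapping.keys (bdp (Comp D) (Suc q) \<sigma>) \<subseteq> {\<sigma>. fst \<sigma> \<noteq> [] \<and> hd (fst \<sigma>) = b}"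
    using hd_bdp[of "e # as" "Suc q" "n # ms" "Comp D" b] s(1) by simp
  have eS: "eS (econs b ?i x) = econs b ?i (econs b ?i x)"
    if "Poly_Mapping.keys x \<subseteq> {\<sigma>. fst \<sigma> \<noteq> [] \<and> hd (fst \<sigma>) = b}" for x
    using that
  proof (induction x rule: frag_carrier_induct)
    case (gen \<tau>)
    then obtain as ms where "\<tau> = (b # as, ms)" by (cases \<tau>; cases "fst \<tau>") auto
    then show ?case by simp
  qed (simp_all add: frag_extend_diff)
  have b1: "bd (Comp D) (Suc (Suc q)) (S \<sigma>) = - econs b ?i (bdp (Comp D) (Suc q) \<sigma>)"
    unfolding S1 bd_pcons unfolding s(1) bdp_pcons_pcons id by simp
  have b2: "bd (Comp D) (Suc (Suc (Suc q))) (S (S \<sigma>)) =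
      frag_of (S \<sigma>) + econs b ?i (econs b ?i (bdp (Comp D) (Suc q) \<sigma>))"
    unfolding S2 unfolding S1 bd_pcons bdp_pcons_pcons[of _ "Suc q" b ?i b ?i \<sigma>] id
    unfolding s(1) bdp_pcons_pcons id
    by (simp add: frag_extend_diff frag_extend_minus frag_extend_cmul del: pcons_simp)
  show ?thesis
    unfolding b1 b2 frag_extend_minus eS[OF k] by simp
qed

text \<open>For a cycle \<open>x\<close> the homotopy \<open>T\<close> gives
  \<open>x = s_0 y - d (T x)\<close> with \<open>y = d_0 x\<close>. Then \<open>s_0 y\<close> is a
  cycle too, hence the boundary of \<open>s_0 (s_0 y)\<close>. Degree at least 2 supplies the second
  arrow that \<open>bd_T\<close> composes with.\<close>

theorem nerve_exact:
  assumes x: "Poly_Mapping.keys x \<subseteq> nerve D q" and q: "2 \<le> q" and cyc: "dd q x = 0"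
  shows "\<exists>t. Poly_Mapping.keys t \<subseteq> nerve D (Suc q) \<and> dd (Suc q) t = x"
proof -
  obtain k where k: "q = Suc (Suc k)" using q by (metis add_2_eq_Suc le_Suc_ex)
  define y where "y = frag_extend (frag_of \<circ> rface (Comp D) 0) x"
  have y: "Poly_Mapping.keys y \<subseteq> nerve D (Suc k)"
    unfolding y_def by (rule frag_extend_closed[OF x]) (use nerve_rface[of _ "Suc k" 0] k in auto)
  have Tx: "Poly_Mapping.keys (eT x) \<subseteq> nerve D (Suc q)"
    by (rule frag_extend_closed[OF x]) (use T_closed k in auto)
  have Sy: "Poly_Mapping.keys (eS y) \<subseteq> nerve D q"
    unfolding k by (rule frag_extend_closed[OF y]) (simp add: S_closed)
  have SSy: "Poly_Mapping.keys (eS (eS y)) \<subseteq> nerve D (Suc q)"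
    by (rule frag_extend_closed[OF Sy]) (simp add: S_closed)
  have 1: "dd (Suc q) (eT x) + eT (dd q x) = eS y - x"
    using x unfolding y_def
  proof (induction x rule: frag_carrier_induct)
    case (gen \<sigma>)
    then show ?case using bd_T[of \<sigma> k] k by (simp del: rface.simps)
  next
    case (diff a b)
    let ?S = "\<lambda>x. eS (frag_extend (frag_of \<circ> rface (Comp D) 0) x)"
    have "dd (Suc q) (eT (a - b)) + eT (dd q (a - b)) =
        (dd (Suc q) (eT a) + eT (dd q a)) - (dd (Suc q) (eT b) + eT (dd q b))"
      by (simp add: frag_extend_diff)
    also have "\<dots> = (?S a - a) - (?S b - b)"
      by (simp only: diff.IH)
    also have "\<dots> = ?S (a - b) - (a - b)"
      by (simp add: frag_extend_diff)
    finally show ?case .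
  qed simp
  have 2: "dd (Suc q) (eS (eS y)) = eS y - eS (dd q (eS y))"
    using y
  proof (induction y rule: frag_carrier_induct)
    case (gen \<sigma>)
    then show ?case using bd_S_S[of \<sigma> k] k by (simp add: comp_def)
  qed (simp_all add: frag_extend_diff algebra_simps)
  have 3: "dd q (dd (Suc q) z) = 0" if "Poly_Mapping.keys z \<subseteq> nerve D (Suc q)"
    for z :: "('a list \<times> 'b list) \<Rightarrow>\<^sub>0 int"
    using that
  proof (induction z rule: frag_carrier_induct)
    case (gen \<sigma>)
    then show ?case using bd_bd[of \<sigma> q] k by simp
  qed (simp_all add: frag_extend_diff)
  have dT: "dd (Suc q) (eT x) = eS y - x"
    using 1 unfolding cyc frag_extend_0 add_0_right .
  then have "dd q (eS y - x) = 0"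
    using 3[OF Tx] by (simp only:)
  then have dS: "dd q (eS y) = 0"
    unfolding frag_extend_diff cyc diff_zero .
  have "dd (Suc q) (eS (eS y) - eT x) = eS y - (eS y - x)"
    unfolding frag_extend_diff 2 dT dS frag_extend_0 diff_zero ..
  also have "\<dots> = x" by simp
  finally have "dd (Suc q) (eS (eS y) - eT x) = x" .
  moreover have "Poly_Mapping.keys (eS (eS y) - eT x) \<subseteq> nerve D (Suc q)"
    using keys_diff[of "eS (eS y)" "eT x"] SSy Tx by (meson Un_least order_trans)
  ultimately show ?thesis by blast
qed

end

section \<open>Double nerves of free p-categories\<close>

lemma ex1_unique: "\<exists>!x. P x \<Longrightarrow> P a \<Longrightarrow> P b \<Longrightarrow> a = b"
  by blast

lemma delete_nth_0 [simp]: "delete_nth 0 xs = tl xs"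
  by (simp add: delete_nth_def drop_Suc)

lemma delete_nth_Suc_Cons [simp]: "delete_nth (Suc i) (x # xs) = x # delete_nth i xs"
  by (simp add: delete_nth_def)

lemma delete_nth_Nil [simp]: "delete_nth i [] = []"
  by (simp add: delete_nth_def)

lemma delete_nth_delete_nth: "i < j \<Longrightarrow> delete_nth i (delete_nth j xs) = delete_nth (j - 1) (delete_nth i xs)"
proof (induction xs arbitrary: i j)
  case (Cons x xs)
  then obtain k where "j = Suc k" by (cases j) auto
  with Cons show ?case by (cases i; cases k) auto
qed simp

lemma delete_nth_map2:
  "length xs = length ys \<Longrightarrow> delete_nth i (map2 f xs ys) = map2 f (delete_nth i xs) (delete_nth i ys)"
proof (induction xs ys arbitrary: i rule: list_induct2)
  case (Cons x xs y ys)
  then show ?case by (cases i) auto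
qed simp

lemma length_delete_nth: "i < length xs \<Longrightarrow> length (delete_nth i xs) = length xs - 1"
  by (simp add: delete_nth_def)

lemma set_delete_nth: "set (delete_nth i xs) \<subseteq> set xs"
  unfolding delete_nth_def using set_take_subset set_drop_subset by fastforce

lemma successively_delete_nth:
  assumes "successively P xs" "set xs \<subseteq> A"
    and trans: "\<And>x y z. x \<in> A \<Longrightarrow> y \<in> A \<Longrightarrow> z \<in> A \<Longrightarrow> P x y \<Longrightarrow> P y z \<Longrightarrow> P x z"
  shows "successively P (delete_nth i xs)"
  using assms(1,2)
proof (induction xs arbitrary: i)
  case (Cons x xs)
  show ?case
  proof (cases i)
    case 0
    with Cons show ?thesis by (auto simp: successively_Cons)
  next
    case i: (Suc j)
    show ?thesis
    proof (cases xs)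
      case Nil
      then show ?thesis using i by simp
    next
      case xs: (Cons y ys)
      show ?thesis
      proof (cases j)
        case 0
        show ?thesis
        proof (cases ys)
          case (Cons z zs)
          then show ?thesis using Cons.prems i xs 0 trans[of x y z] by simp
        qed (simp add: i xs 0)
      next
        case (Suc k)
        then show ?thesis using Cons.IH[of j] Cons.prems i xs by simp
      qed
    qed
  qed
qed simp

lemma successively_map2:
  assumes "length gs = length fs" "successively P gs" "successively Q fs" "set gs \<subseteq> A" "set fs \<subseteq> B"
    and "\<And>g g' f f'. g \<in> A \<Longrightarrow> g' \<in> A \<Longrightarrow> f \<in> B \<Longrightarrow> f' \<in> B \<Longrightarrow> P g g' \<Longrightarrow> Q f f' \<Longrightarrow> R (c g f) (c g' f')"
  shows "successively R (map2 c gs fs)"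
  using assms(1-5)
proof (induction gs fs rule: list_induct2)
  case (Cons g gs f fs)
  then show ?case using assms(6) by (cases gs; cases fs) auto
qed simp

text \<open>Besides freeness of the underlying category, \<open>le_factor\<close> lifts a
  factorization to any larger morphism, and \<open>le_ident\<close> keeps identities from being
  refined. These two let a chain inherit its factorization from its first member.\<close>

locale free_pcat =
  fixes C :: "('o, 'm) pcat" and len :: "'m \<Rightarrow> nat"
  assumes ident_closed: "a \<in> Obj C \<Longrightarrow> Ident C a \<in> Hom C a a"
    and comp_closed: "\<lbrakk>a \<in> Obj C; b \<in> Obj C; c \<in> Obj C; f \<in> Hom C a b; g \<in> Hom C b c\<rbrakk> \<Longrightarrow> Comp C g f \<in> Hom C a c"
    and comp_assoc: "\<lbrakk>a \<in> Obj C; b \<in> Obj C; c \<in> Obj C; d \<in> Obj C; f \<in> Hom C a b; g \<in> Hom C b c; h \<in> Hom C c d\<rbrakk>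
      \<Longrightarrow> Comp C h (Comp C g f) = Comp C (Comp C h g) f"
    and comp_ident_left: "\<lbrakk>a \<in> Obj C; b \<in> Obj C; f \<in> Hom C a b\<rbrakk> \<Longrightarrow> Comp C (Ident C b) f = f"
    and comp_ident_right: "\<lbrakk>a \<in> Obj C; b \<in> Obj C; f \<in> Hom C a b\<rbrakk> \<Longrightarrow> Comp C f (Ident C a) = f"
    and le_refl: "\<lbrakk>a \<in> Obj C; b \<in> Obj C; f \<in> Hom C a b\<rbrakk> \<Longrightarrow> Le C f f"
    and le_trans: "\<lbrakk>a \<in> Obj C; b \<in> Obj C; f \<in> Hom C a b; g \<in> Hom C a b; h \<in> Hom C a b; Le C f g; Le C g h\<rbrakk> \<Longrightarrow> Le C f h"
    and le_comp: "\<lbrakk>a \<in> Obj C; b \<in> Obj C; c \<in> Obj C; f \<in> Hom C a b; f' \<in> Hom C a b; g \<in> Hom C b c; g' \<in> Hom C b c;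
      Le C f f'; Le C g g'\<rbrakk> \<Longrightarrow> Le C (Comp C g f) (Comp C g' f')"
    and len_comp: "\<lbrakk>a \<in> Obj C; b \<in> Obj C; c \<in> Obj C; f \<in> Hom C a b; g \<in> Hom C b c\<rbrakk> \<Longrightarrow>
      len (Comp C g f) = len f + len g"
    and len_eq_0: "\<lbrakk>a \<in> Obj C; b \<in> Obj C; f \<in> Hom C a b; len f = 0\<rbrakk> \<Longrightarrow> a = b \<and> f = Ident C a"
    and factor: "\<lbrakk>a \<in> Obj C; b \<in> Obj C; f \<in> Hom C a b; len f > 0\<rbrakk> \<Longrightarrow>
      \<exists>!(c, g, r). c \<in> Obj C \<and> g \<in> Hom C a c \<and> r \<in> Hom C c b \<and> len g = 1 \<and> f = Comp C r g"
    and le_factor: "\<lbrakk>a \<in> Obj C; b \<in> Obj C; c \<in> Obj C; g \<in> Hom C a c; r \<in> Hom C c b; f \<in> Hom C a b; Le C (Comp C r g) f\<rbrakk> \<Longrightarrow>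
      \<exists>!(g', r'). g' \<in> Hom C a c \<and> r' \<in> Hom C c b \<and> f = Comp C r' g' \<and> Le C g g' \<and> Le C r r'"
    and le_ident: "\<lbrakk>a \<in> Obj C; f \<in> Hom C a a; Le C (Ident C a) f\<rbrakk> \<Longrightarrow> f = Ident C a"
begin

lemma mem_Hom_Nbar:
  "h \<in> Hom (Nbar C p) a b \<longleftrightarrow> length h = Suc p \<and> set h \<subseteq> Hom C a b \<and> successively (Le C) h"
  by (simp add: Nbar_def)

lemma Nbar_simps [simp]:
  "Obj (Nbar C p) = Obj C"
  "Comp (Nbar C p) = map2 (Comp C)"
  "Ident (Nbar C p) a = replicate (Suc p) (Ident C a)"
  by (simp_all add: Nbar_def)

text \<open>Only the first member is assumed to factor; \<open>le_factor\<close> passes the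
  factorization from each member to the next, and delivers factors that again form chains.\<close>

lemma chain_factor_exists:
  assumes obj: "a \<in> Obj C" "b \<in> Obj C" "c \<in> Obj C"
    and "h \<noteq> []" "set h \<subseteq> Hom C a b" "successively (Le C) h" "g0 \<in> Hom C a c" "r0 \<in> Hom C c b"
      "hd h = Comp C r0 g0"
  shows "\<exists>gs rs. length gs = length h \<and> length rs = length h \<and> set gs \<subseteq> Hom C a c \<and> set rs \<subseteq> Hom C c b \<and>
     successively (Le C) gs \<and> successively (Le C) rs \<and> hd gs = g0 \<and> hd rs = r0 \<and> h = map2 (Comp C) rs gs"
  using assms(4-9)
proof (induction h arbitrary: g0 r0 rule: list_nonempty_induct)
  case (single x)
  then show ?case by (intro exI[of _ "[g0]"] exI[of _ "[r0]"]) simp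
next
  case (cons x xs)
  have x: "x = Comp C r0 g0" using cons.prems(5) by simp
  have le: "Le C x (hd xs)" using cons.prems(2) cons.hyps(1) by (simp add: successively_Cons)
  have hom: "hd xs \<in> Hom C a b" using cons.prems(1) hd_in_set[OF cons.hyps(1)] by auto
  from ex1_implies_ex[OF le_factor[OF obj cons.prems(3,4) hom le[unfolded x]]]
  obtain g1 r1 where 1: "g1 \<in> Hom C a c" "r1 \<in> Hom C c b" "hd xs = Comp C r1 g1" "Le C g0 g1" "Le C r0 r1"
    unfolding split_paired_Ex prod.case by blast
  have xs: "set xs \<subseteq> Hom C a b" using cons.prems(1) by simp
  have sxs: "successively (Le C) xs"
    using cons.prems(2) cons.hyps(1) by (simp add: successively_Cons)
  from cons.IH[OF xs sxs 1(1,2,3)] obtain gs rs where gs: "length gs = length xs" "length rs = length xs" "set gs \<subseteq> Hom C a c" "set rs \<subseteq> Hom C c b"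
     "successively (Le C) gs" "successively (Le C) rs" "hd gs = g1" "hd rs = r1" "xs = map2 (Comp C) rs gs"
    by (elim exE conjE) (rule that)
  have "x # xs = map2 (Comp C) (r0 # rs) (g0 # gs)"
    unfolding x gs(9) by simp
  moreover have "successively (Le C) (g0 # gs)" "successively (Le C) (r0 # rs)"
    unfolding successively_Cons using 1(4,5) gs(5-8) by simp_all
  moreover have "length (g0 # gs) = length (x # xs)" "length (r0 # rs) = length (x # xs)"
    "set (g0 # gs) \<subseteq> Hom C a c" "set (r0 # rs) \<subseteq> Hom C c b" "hd (g0 # gs) = g0" "hd (r0 # rs) = r0"
    using gs(1-4) cons.prems(3,4) by simp_all
  ultimately show ?case
    by - (rule exI[of _ "g0 # gs"], rule exI[of _ "r0 # rs"], intro conjI, assumption+)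
qed

lemma chain_factor_unique:
  assumes obj: "a \<in> Obj C" "b \<in> Obj C" "c \<in> Obj C"
    and "length rs = length gs" "length gs' = length gs" "length rs' = length gs"
    and "set gs \<subseteq> Hom C a c" "set gs' \<subseteq> Hom C a c" "set rs \<subseteq> Hom C c b" "set rs' \<subseteq> Hom C c b"
    and "successively (Le C) gs" "successively (Le C) gs'" "successively (Le C) rs" "successively (Le C) rs'"
    and "gs \<noteq> []" "hd gs = hd gs'" "hd rs = hd rs'" "map2 (Comp C) rs gs = map2 (Comp C) rs' gs'"
  shows "gs = gs' \<and> rs = rs'"
proof -
  have hom: "gs ! i \<in> Hom C a c" "gs' ! i \<in> Hom C a c" "rs ! i \<in> Hom C c b" "rs' ! i \<in> Hom C c b"
    if "i < length gs" for i
    using that assms(4-10) by (metis nth_mem subsetD)+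
  have le: "Le C (gs ! i) (gs ! Suc i)" "Le C (gs' ! i) (gs' ! Suc i)" "Le C (rs ! i) (rs ! Suc i)" "Le C (rs' ! i) (rs' ! Suc i)"
    if "Suc i < length gs" for i
    using that assms(4-6) assms(11-14)[unfolded successively_conv_nth] by metis+
  have "gs ! i = gs' ! i \<and> rs ! i = rs' ! i" if "i < length gs" for i
    using that
  proof (induction i)
    case 0
    then show ?case using assms(4-6,15-17) by (metis hd_conv_nth length_0_conv)
  next
    case (Suc i)
    then have i: "i < length gs" and IH: "gs' ! i = gs ! i" "rs' ! i = rs ! i" by auto
    note h = hom[OF i] hom[OF Suc.prems] and l = le[OF Suc.prems]
    have e: "Comp C (rs ! Suc i) (gs ! Suc i) = Comp C (rs' ! Suc i) (gs' ! Suc i)"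
      using arg_cong[OF assms(18), of "\<lambda>x. x ! Suc i"] Suc.prems assms(4-6) by simp
    have "\<exists>!(g', r'). g' \<in> Hom C a c \<and> r' \<in> Hom C c b \<and> Comp C (rs ! Suc i) (gs ! Suc i) = Comp C r' g' \<and>
        Le C (gs ! i) g' \<and> Le C (rs ! i) r'"
      by (rule le_factor[OF obj h(1,3) comp_closed[OF obj(1,3,2) h(5,7)]
            le_comp[OF obj(1,3,2) h(1,5,3,7) l(1,3)]])
    then have "(gs ! Suc i, rs ! Suc i) = (gs' ! Suc i, rs' ! Suc i)"
      by (rule ex1_unique) (use h(5-8) l[unfolded IH] e in simp_all)
    then show ?case by simp
  qed
  with assms(4-6) show ?thesis by (auto intro: nth_equalityI)
qed

text \<open>The length of a chain is that of its first member, since factorizations lift along the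
  order but need not descend. A first generator of the head thus extends uniquely to a first
  generator of the chain.\<close>

lemma free_cat_Nbar: "free_cat (Nbar C p) (\<lambda>h. len (hd h))"
proof
  fix a assume "a \<in> Obj (Nbar C p)"
  then have a: "a \<in> Obj C" by simp
  have "successively (Le C) (replicate n (Ident C a))" for n
    using le_refl[OF a a ident_closed[OF a]] by (simp add: successively_conv_nth)
  then show "Ident (Nbar C p) a \<in> Hom (Nbar C p) a a"
    unfolding mem_Hom_Nbar using ident_closed[OF a] by (auto simp del: replicate_Suc)
next
  fix a b c f g
  assume obj: "a \<in> Obj (Nbar C p)" "b \<in> Obj (Nbar C p)" "c \<in> Obj (Nbar C p)"
    and f: "f \<in> Hom (Nbar C p) a b" and g: "g \<in> Hom (Nbar C p) b c"
  have "successively (Le C) (map2 (Comp C) g f)"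
    by (rule successively_map2[where P = "Le C" and Q = "Le C" and A = "Hom C b c" and B = "Hom C a b"])
      (use f g obj le_comp[of a b c] in \<open>simp_all add: mem_Hom_Nbar\<close>)
  moreover have "Comp C y x \<in> Hom C a c" if "(y, x) \<in> set (zip g f)" for y x
    using that f g obj comp_closed[of a b c x y] unfolding mem_Hom_Nbar
    by (auto dest: set_zip_leftD set_zip_rightD)
  ultimately show "Comp (Nbar C p) g f \<in> Hom (Nbar C p) a c"
    using f g by (auto simp: mem_Hom_Nbar)
  show "len (hd (Comp (Nbar C p) g f)) = len (hd f) + len (hd g)"
    using f g obj len_comp[of a b c "hd f" "hd g"] by (cases f; cases g) (auto simp: mem_Hom_Nbar)
next
  fix a b c d f g h
  assume "a \<in> Obj (Nbar C p)" "b \<in> Obj (Nbar C p)" "c \<in> Obj (Nbar C p)" "d \<in> Obj (Nbar C p)"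
    and "f \<in> Hom (Nbar C p) a b" "g \<in> Hom (Nbar C p) b c" "h \<in> Hom (Nbar C p) c d"
  then show "Comp (Nbar C p) h (Comp (Nbar C p) g f) = Comp (Nbar C p) (Comp (Nbar C p) h g) f"
    by (auto simp: mem_Hom_Nbar subset_iff intro!: nth_equalityI comp_assoc[of a b c d])
next
  fix a b f
  assume "a \<in> Obj (Nbar C p)" "b \<in> Obj (Nbar C p)" "f \<in> Hom (Nbar C p) a b"
  then show "Comp (Nbar C p) (Ident (Nbar C p) b) f = f" "Comp (Nbar C p) f (Ident (Nbar C p) a) = f"
    by (auto simp: mem_Hom_Nbar subset_iff simp del: replicate_Suc
        intro!: nth_equalityI comp_ident_left[of a b] comp_ident_right[of a b])
next
  fix a b f
  assume "a \<in> Obj (Nbar C p)" "b \<in> Obj (Nbar C p)" and f: "f \<in> Hom (Nbar C p) a b" and "len (hd f) = 0"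
  then have a: "a \<in> Obj C" "b \<in> Obj C" and f': "set f \<subseteq> Hom C a b" "successively (Le C) f" "f \<noteq> []"
    by (auto simp: mem_Hom_Nbar)
  then have "hd f \<in> Hom C a b" using hd_in_set[of f] by blast
  then have ab: "a = b" and hd: "hd f = Ident C a"
    using len_eq_0[of a b "hd f"] \<open>len (hd f) = 0\<close> a by simp_all
  \<comment> \<open>Length zero makes the head an identity, and by \<open>le_ident\<close> nothing
    but the identity can follow it.\<close>
  have "f = replicate (length f) (Ident C a)"
    using f'(3) f'(1,2) hd
  proof (induction f rule: list_nonempty_induct)
    case (cons x xs)
    then have "hd xs \<in> Hom C a a" "Le C (Ident C a) (hd xs)"
      using ab by (cases xs; auto)+
    then have "hd xs = Ident C a" using le_ident a by blast
    then show ?case using cons by (auto simp: successively_Cons)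
  qed simp
  with f ab show "a = b \<and> f = Ident (Nbar C p) a"
    by (simp add: mem_Hom_Nbar)
next
  fix a b f
  assume "a \<in> Obj (Nbar C p)" "b \<in> Obj (Nbar C p)" and f: "f \<in> Hom (Nbar C p) a b" and l: "0 < len (hd f)"
  then have a: "a \<in> Obj C" "b \<in> Obj C"
    and f': "length f = Suc p" "set f \<subseteq> Hom C a b" "successively (Le C) f" "f \<noteq> []"
    using f by (auto simp: mem_Hom_Nbar)
  have hface_at: "hd f \<in> Hom C a b" using f'(2,4) hd_in_set[of f] by blast
  obtain c g r where cgr: "c \<in> Obj C" "g \<in> Hom C a c" "r \<in> Hom C c b" "len g = 1" "hd f = Comp C r g"
    using ex1_implies_ex[OF factor[OF a hface_at l]] unfolding split_paired_Ex prod.case by blast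
  from chain_factor_exists[OF a cgr(1) f'(4,2,3) cgr(2,3,5)]
  obtain gs rs where gs: "length gs = length f" "length rs = length f" "set gs \<subseteq> Hom C a c" "set rs \<subseteq> Hom C c b"
     "successively (Le C) gs" "successively (Le C) rs" "hd gs = g" "hd rs = r" "f = map2 (Comp C) rs gs"
    by (elim exE conjE) (rule that)
  show "\<exists>!(c, g, r). c \<in> Obj (Nbar C p) \<and> g \<in> Hom (Nbar C p) a c \<and> r \<in> Hom (Nbar C p) c b \<and>
      len (hd g) = 1 \<and> f = Comp (Nbar C p) r g"
  proof (rule ex1I[of _ "(c, gs, rs)"])
    have "gs \<in> Hom (Nbar C p) a c" "rs \<in> Hom (Nbar C p) c b"
      using gs(1-6) f'(1) by (simp_all add: mem_Hom_Nbar)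
    then show "case (c, gs, rs) of (c, g, r) \<Rightarrow> c \<in> Obj (Nbar C p) \<and> g \<in> Hom (Nbar C p) a c \<and> r \<in> Hom (Nbar C p) c b \<and>
      len (hd g) = 1 \<and> f = Comp (Nbar C p) r g"
      using gs(7,9) cgr(1,4) by simp
  next
    fix x
    assume x: "case x of (c, g, r) \<Rightarrow> c \<in> Obj (Nbar C p) \<and> g \<in> Hom (Nbar C p) a c \<and> r \<in> Hom (Nbar C p) c b \<and>
      len (hd g) = 1 \<and> f = Comp (Nbar C p) r g"
    obtain c' gs' rs' where x_eq: "x = (c', gs', rs')" by (cases x)
    have x': "c' \<in> Obj C" "length gs' = Suc p" "length rs' = Suc p" "set gs' \<subseteq> Hom C a c'" "set rs' \<subseteq> Hom C c' b"
      "successively (Le C) gs'" "successively (Le C) rs'" "len (hd gs') = 1" "f = map2 (Comp C) rs' gs'"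
      using x unfolding x_eq by (auto simp: mem_Hom_Nbar)
    then have ne: "gs' \<noteq> []" "rs' \<noteq> []" by auto
    then have h': "hd gs' \<in> Hom C a c'" "hd rs' \<in> Hom C c' b" "hd f = Comp C (hd rs') (hd gs')"
      using x' hd_in_set[OF ne(1)] hd_in_set[OF ne(2)] by (auto simp: hd_map hd_zip)
    have "(c, g, r) = (c', hd gs', hd rs')"
      using factor[OF a hface_at l] by (rule ex1_unique) (use cgr x' h' in auto)
    then have e: "c' = c" "hd gs = hd gs'" "hd rs = hd rs'" using gs(7,8) by auto
    have "gs = gs' \<and> rs = rs'"
      by (rule chain_factor_unique[OF a cgr(1)]) (use gs(1-8) gs(9)[symmetric] x'(2-7) x'(9)[symmetric] e ne f'(1) in auto)
    then show "x = (c, gs, rs)" using x_eq e by simp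
  qed
qed

sublocale Nbar: free_cat "Nbar C p" "\<lambda>h. len (hd h)" for p
  by (rule free_cat_Nbar)


section \<open>Horizontal faces and their compatibility with the vertical ones\<close>

definition hface_at :: "nat \<Rightarrow> 'o list \<times> 'm list list \<Rightarrow> 'o list \<times> 'm list list" where
  "hface_at i = (\<lambda>(as, ms). (as, map (delete_nth i) ms))"

definition hboundary :: "nat \<Rightarrow> 'o list \<times> 'm list list \<Rightarrow> ('o list \<times> 'm list list) \<Rightarrow>\<^sub>0 int" where
  "hboundary p \<sigma> = (\<Sum>i\<le>p. frag_cmul ((-1) ^ i) (frag_of (hface_at i \<sigma>)))"

lemma hface_at_pcons: "hface_at i (pcons a m \<sigma>) = pcons a (delete_nth i m) (hface_at i \<sigma>)"
  by (simp add: hface_at_def pcons_def case_prod_unfold)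

lemma delete_nth_Hom:
  assumes "a \<in> Obj C" "b \<in> Obj C" "m \<in> Hom (Nbar C (Suc p)) a b" "i \<le> Suc p"
  shows "delete_nth i m \<in> Hom (Nbar C p) a b"
  unfolding mem_Hom_Nbar
proof (intro conjI)
  have m: "length m = Suc (Suc p)" "set m \<subseteq> Hom C a b" "successively (Le C) m"
    using assms(3) by (auto simp: mem_Hom_Nbar)
  show "length (delete_nth i m) = Suc p" using m(1) assms(4) by (simp add: length_delete_nth)
  show "set (delete_nth i m) \<subseteq> Hom C a b" using m(2) set_delete_nth by fast
  show "successively (Le C) (delete_nth i m)"
    by (rule successively_delete_nth[OF m(3,2)]) (rule le_trans[OF assms(1,2)])
qed

lemma hface_at_nerve:
  assumes "\<sigma> \<in> nerve (Nbar C (Suc p)) q" "i \<le> Suc p"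
  shows "hface_at i \<sigma> \<in> nerve (Nbar C p) q"
proof -
  obtain as ms where s: "\<sigma> = (as, ms)" by fastforce
  have n: "length as = q + 1" "length ms = q" "set as \<subseteq> Obj C"
    "\<And>k. k < q \<Longrightarrow> ms ! k \<in> Hom (Nbar C (Suc p)) (as ! k) (as ! (k + 1))"
    using assms(1) by (auto simp: nerve_def s)
  have "map (delete_nth i) ms ! k \<in> Hom (Nbar C p) (as ! k) (as ! (k + 1))" if k: "k < q" for k
  proof -
    have "as ! k \<in> Obj C" "as ! (k + 1) \<in> Obj C"
      using n(1,3) k by (auto simp: subset_iff)
    then show ?thesis using delete_nth_Hom[OF _ _ n(4)[OF k] assms(2)] n(2) k by simp
  qed
  then show ?thesis using n by (simp add: nerve_def hface_at_def s)
qed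

lemma hface_at_hface_at: "i < j \<Longrightarrow> hface_at i (hface_at j \<sigma>) = hface_at (j - 1) (hface_at i \<sigma>)"
  by (simp add: hface_at_def case_prod_unfold delete_nth_delete_nth)

text \<open>Chains are composed termwise, so deleting the \<open>j\<close>-th term before or after a
  composition makes no difference.\<close>

lemma hface_at_rface:
  assumes "\<sigma> \<in> nerve (Nbar C p) (Suc q)" "i \<le> Suc q"
  shows "rface (map2 (Comp C)) i (hface_at j \<sigma>) = hface_at j (rface (map2 (Comp C)) i \<sigma>)"
  using assms
proof (induction i arbitrary: \<sigma> q)
  case 0
  then obtain a as m ms where "\<sigma> = pcons a m (as, ms)"
    using nerve_Suc_pcons by blast
  then show ?case by (simp add: hface_at_pcons del: rface.simps pcons_simp)
next
  case (Suc i)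
  obtain a b as m ms where s: "\<sigma> = pcons a m (b # as, ms)" "(b # as, ms) \<in> nerve (Nbar C p) q"
    "m \<in> Hom (Nbar C p) a b"
    using nerve_Suc_pcons Suc.prems(1) by blast
  show ?case
  proof (cases i)
    case i: 0
    show ?thesis
    proof (cases q)
      case 0
      with s have "\<sigma> = ([a, b], [m])" by (auto simp: nerve_0)
      then show ?thesis using i by (simp add: hface_at_def)
    next
      case (Suc q')
      obtain e as' n ms' where t: "(b # as, ms) = pcons b n (e # as', ms')" "n \<in> Hom (Nbar C p) b e"
        using nerve_Suc_pcons[OF s(2)[unfolded Suc]] by auto
      have "length n = length m" using t(2) s(3) by (simp add: mem_Hom_Nbar)
      then show ?thesis
        unfolding i s(1) t(1) hface_at_pcons rface_1_pcons by (simp only: delete_nth_map2)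
    qed
  next
    case (Suc k)
    with Suc.prems obtain q' where q: "q = Suc q'" by (cases q) auto
    have "rface (map2 (Comp C)) i (hface_at j (b # as, ms)) = hface_at j (rface (map2 (Comp C)) i (b # as, ms))"
      by (rule Suc.IH[OF s(2)[unfolded q]]) (use Suc.prems q in simp)
    then show ?thesis
      unfolding s(1) Suc hface_at_pcons rface_Suc_Suc_pcons by simp
  qed
qed

lemma hboundary_closed:
  "\<sigma> \<in> nerve (Nbar C (Suc p)) q \<Longrightarrow> Poly_Mapping.keys (hboundary (Suc p) \<sigma>) \<subseteq> nerve (Nbar C p) q"
  unfolding hboundary_def by (rule keys_signed_sum) (simp add: hface_at_nerve)

lemma hboundary_hboundary: "frag_extend (hboundary p) (hboundary (Suc p) \<sigma>) = 0"
proof -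
  have "frag_extend (hboundary p) (hboundary (Suc p) \<sigma>) =
     (\<Sum>j\<le>Suc p. \<Sum>i\<le>p. frag_cmul ((-1) ^ (i + j)) (frag_of (hface_at i (hface_at j \<sigma>))))"
    unfolding hboundary_def[of "Suc p"]
    by (simp add: frag_extend_sum frag_extend_cmul comp_def hboundary_def frag_cmul_sum power_add mult.commute
        del: sum.atMost_Suc)
  also have "\<dots> = 0"
    by (rule alternating_double_sum_eq_0) (simp add: hface_at_hface_at)
  finally show ?thesis .
qed

lemma hboundary_bd:
  assumes "\<sigma> \<in> nerve (Nbar C p) (Suc q)"
  shows "frag_extend (hboundary k) (bd (map2 (Comp C)) (Suc q) \<sigma>) =
    frag_extend (bd (map2 (Comp C)) (Suc q)) (hboundary k \<sigma>)"
proof -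
  let ?c = "map2 (Comp C)"
  have "frag_extend (hboundary k) (bd ?c (Suc q) \<sigma>) =
     (\<Sum>i\<le>Suc q. \<Sum>j\<le>k. frag_cmul ((-1) ^ (i + j)) (frag_of (hface_at j (rface ?c i \<sigma>))))"
    unfolding bd_def
    by (simp add: frag_extend_sum frag_extend_cmul comp_def hboundary_def frag_cmul_sum power_add
        del: sum.atMost_Suc)
  also have "\<dots> = (\<Sum>i\<le>Suc q. \<Sum>j\<le>k. frag_cmul ((-1) ^ (i + j)) (frag_of (rface ?c i (hface_at j \<sigma>))))"
    by (intro sum.cong refl) (simp add: hface_at_rface[OF assms])
  also have "\<dots> = (\<Sum>j\<le>k. \<Sum>i\<le>Suc q. frag_cmul ((-1) ^ (i + j)) (frag_of (rface ?c i (hface_at j \<sigma>))))"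
    by (rule sum.swap)
  also have "\<dots> = frag_extend (bd ?c (Suc q)) (hboundary k \<sigma>)"
    unfolding hboundary_def
    by (simp add: frag_extend_sum frag_extend_cmul comp_def bd_def frag_cmul_sum power_add mult.commute
        del: sum.atMost_Suc)
  finally show ?thesis .
qed

section \<open>The double complex of the double nerve\<close>

abbreviation "DC \<equiv> FS (double_nerve C)"

definition simplices :: "int \<Rightarrow> int \<Rightarrow> ('o list \<times> 'm list list) set" where
  "simplices p q = (if p < 0 \<or> q < 0 then {} else nerve (Nbar C (nat p)) (nat q))"

lemma simplices_nat [simp]: "simplices (int p) (int q) = nerve (Nbar C p) q"
  by (simp add: simplices_def)

lemma dgrp_DC: "dgrp DC p q = free_Abelian_group (simplices p q)"
  by (simp add: FS_def double_nerve_def simplices_def if_distrib)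

lemma dhor_DC: "dhor DC p q = (if p \<le> 0 then (\<lambda>_. 0) else frag_extend (hboundary (nat p)))"
  by (simp add: FS_def double_nerve_def hboundary_def[abs_def] hface_at_def)

lemma dhor_DC_int: "dhor DC (int p) q x = (if p = 0 then 0 else frag_extend (hboundary p) x)"
  by (simp add: dhor_DC)

lemma dver_DC_nonpos: "q \<le> 0 \<Longrightarrow> dver DC p q x = 0"
  by (simp add: FS_def)

text \<open>The support condition matters because \<open>rface\<close> is known to agree with
  \<open>nerve_face\<close> on lists of matching lengths.\<close>

lemma dver_DC:
  assumes "Poly_Mapping.keys x \<subseteq> nerve (Nbar C p) (Suc q)"
  shows "dver DC (int p) (int (Suc q)) x = frag_extend (bd (map2 (Comp C)) (Suc q)) x"
proof -
  have "(\<Sum>i\<le>Suc q. frag_cmul ((-1) ^ i) (frag_of (nerve_face (Nbar C p) (Suc q) i \<sigma>))) = bd (map2 (Comp C)) (Suc q) \<sigma>"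
    if "\<sigma> \<in> Poly_Mapping.keys x" for \<sigma>
  proof -
    obtain as ms where s: "\<sigma> = (as, ms)" by fastforce
    have "length as = Suc (Suc q)" "length ms = Suc q" using that assms s by (auto simp: nerve_def)
    then show ?thesis
      unfolding bd_def s by (intro sum.cong refl) (simp add: nerve_face_eq_rface)
  qed
  then have "frag_extend (\<lambda>\<sigma>. \<Sum>i\<le>Suc q. frag_cmul ((-1) ^ i) (frag_of (nerve_face (Nbar C p) (Suc q) i \<sigma>))) x =
      frag_extend (bd (map2 (Comp C)) (Suc q)) x"
    by (rule frag_extend_eq)
  then show ?thesis
    by (simp add: FS_def double_nerve_def nat_add_distrib del: of_nat_Suc sum.atMost_Suc)
qed

lemma simplices_cases:
  assumes "Poly_Mapping.keys x \<subseteq> simplices p q"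
  obtains "x = 0" | p' q' where "p = int p'" "q = int q'" "Poly_Mapping.keys x \<subseteq> nerve (Nbar C p') q'"
proof (cases "p < 0 \<or> q < 0")
  case True
  then show ?thesis using assms that(1) by (simp add: simplices_def)
next
  case False
  then show ?thesis using assms that(2)[of "nat p" "nat q"] by (simp add: simplices_def)
qed

lemma frag_double_complex_DC: "frag_double_complex DC simplices"
proof
  fix p q :: int and x y :: "('o list \<times> 'm list list) \<Rightarrow>\<^sub>0 int"
  let ?c = "map2 (Comp C)"
  show "dgrp DC p q = free_Abelian_group (simplices p q)" by (rule dgrp_DC)
  show "p < 0 \<or> q < 0 \<Longrightarrow> simplices p q = {}" by (simp add: simplices_def)
  show "dhor DC p q (x - y) = dhor DC p q x - dhor DC p q y"
    by (simp add: dhor_DC frag_extend_diff)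
  show "dver DC p q (x - y) = dver DC p q x - dver DC p q y"
    by (simp add: FS_def frag_extend_diff)
  have h0: "dhor DC i j 0 = 0" and v0: "dver DC i j 0 = 0" for i j
    by (simp_all add: dhor_DC) (simp add: FS_def)
  have vc: "Poly_Mapping.keys (frag_extend (bd ?c (Suc q)) z) \<subseteq> nerve (Nbar C p) q"
    if "Poly_Mapping.keys z \<subseteq> nerve (Nbar C p) (Suc q)" for z p q
    by (rule frag_extend_closed[OF that]) (use Nbar.bd_closed[of _ p q] in simp)
  have hc: "Poly_Mapping.keys (frag_extend (hboundary (Suc p)) z) \<subseteq> nerve (Nbar C p) q"
    if "Poly_Mapping.keys z \<subseteq> nerve (Nbar C (Suc p)) q" for z p q
    by (rule frag_extend_closed[OF that]) (rule hboundary_closed)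
  assume x: "Poly_Mapping.keys x \<subseteq> simplices p q"
  show "Poly_Mapping.keys (dhor DC p q x) \<subseteq> simplices (p - 1) q"
    using x
  proof (cases rule: simplices_cases)
    case (2 p' q')
    show ?thesis
    proof (cases p')
      case 0
      with 2 show ?thesis by (simp add: dhor_DC)
    next
      case (Suc k)
      have e: "p - 1 = int k" using 2 Suc by simp
      show ?thesis
        unfolding e unfolding 2 Suc dhor_DC_int simplices_nat using hc[of x k q'] 2 Suc by simp
    qed
  qed (simp add: h0)
  show "Poly_Mapping.keys (dver DC p q x) \<subseteq> simplices p (q - 1)"
    using x
  proof (cases rule: simplices_cases)
    case (2 p' q')
    show ?thesis
    proof (cases q')
      case 0
      with 2 show ?thesis by (simp add: dver_DC_nonpos)
    next
      case (Suc k)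
      then show ?thesis using 2 dver_DC[of x p' k] vc[of x p' k] by simp
    qed
  qed (simp add: v0)
  show "dhor DC (p - 1) q (dhor DC p q x) = 0"
    using x
  proof (cases rule: simplices_cases)
    case (2 p' q')
    show ?thesis
    proof (cases "p' \<le> 1")
      case True
      with 2 show ?thesis by (simp add: dhor_DC)
    next
      case False
      then obtain k where k: "p' = Suc (Suc k)" by (metis One_nat_def bot_nat_0.extremum le_Suc_eq nat_le_linear not0_implies_Suc)
      have "frag_extend (hboundary (Suc k)) (frag_extend (hboundary (Suc (Suc k))) x) = 0"
        using 2(3)
      proof (induction x rule: frag_carrier_induct)
        case (gen \<sigma>)
        then show ?case by (simp add: hboundary_hboundary)
      qed (simp_all add: frag_extend_diff)
      moreover have e: "p - 1 = int (Suc k)" using 2 k by simp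
      ultimately show ?thesis unfolding e unfolding 2 k dhor_DC_int by simp
    qed
  qed (simp add: h0)
  show "dver DC p (q - 1) (dver DC p q x) = 0"
    using x
  proof (cases rule: simplices_cases)
    case (2 p' q')
    show ?thesis
    proof (cases "q' \<le> 1")
      case True
      with 2 show ?thesis by (simp add: dver_DC_nonpos)
    next
      case False
      then obtain k where k: "q' = Suc (Suc k)" by (metis One_nat_def bot_nat_0.extremum le_Suc_eq nat_le_linear not0_implies_Suc)
      have kx: "Poly_Mapping.keys x \<subseteq> nerve (Nbar C p') (Suc (Suc k))" using 2 k by simp
      then have "frag_extend (bd ?c (Suc k)) (frag_extend (bd ?c (Suc (Suc k))) x) = 0"
      proof (induction x rule: frag_carrier_induct)
        case (gen \<sigma>)
        then show ?case using Nbar.bd_bd[of \<sigma> p' "Suc k"] by simp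
      qed (simp_all add: frag_extend_diff)
      then have "dver DC p' (int (Suc k)) (dver DC p' (int (Suc (Suc k))) x) = 0"
        using dver_DC[OF kx] dver_DC[OF vc[OF kx]] by simp
      then show ?thesis using 2 k by simp
    qed
  qed (simp add: v0)
  show "dhor DC p (q - 1) (dver DC p q x) = dver DC (p - 1) q (dhor DC p q x)"
    using x
  proof (cases rule: simplices_cases)
    case (2 p' q')
    show ?thesis
    proof (cases "p' = 0 \<or> q' = 0")
      case True
      with 2 show ?thesis by (auto simp: dhor_DC dver_DC_nonpos v0 h0)
    next
      case False
      then obtain k l where k: "p' = Suc k" "q' = Suc l" by (metis not0_implies_Suc)
      have kx: "Poly_Mapping.keys x \<subseteq> nerve (Nbar C (Suc k)) (Suc l)" using 2 k by simp
      then have "frag_extend (hboundary (Suc k)) (frag_extend (bd ?c (Suc l)) x) =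
          frag_extend (bd ?c (Suc l)) (frag_extend (hboundary (Suc k)) x)"
      proof (induction x rule: frag_carrier_induct)
        case (gen \<sigma>)
        then show ?case using hboundary_bd[of \<sigma> "Suc k" l "Suc k"] by simp
      qed (simp_all add: frag_extend_diff)
      then have "dhor DC (int (Suc k)) (int l) (dver DC (int (Suc k)) (int (Suc l)) x) =
          dver DC (int k) (int (Suc l)) (dhor DC (int (Suc k)) (int (Suc l)) x)"
        unfolding dver_DC[OF kx] dhor_DC_int using dver_DC[OF hc[OF kx]] by simp
      then show ?thesis using 2 k by simp
    qed
  qed (simp add: v0 h0)
qed

text \<open>A vertex carries no arrows, so its \<open>p + 1\<close> horizontal faces coincide and
  their alternating sum is one copy or nothing, according to parity.\<close>

lemma hboundary_vertex: "hboundary p (as, []) = (if even p then frag_of (as, []) else 0)"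
proof -
  have "hboundary p (as, []) = (\<Sum>i\<le>p. frag_cmul ((-1) ^ i) (frag_of (as, [])))"
    by (simp add: hboundary_def hface_at_def)
  also have "\<dots> = (if even p then frag_of (as, []) else 0)"
    by (induction p) (auto simp: frag_cmul_distrib)
  finally show ?thesis .
qed

lemma dhor_bottom:
  assumes "Poly_Mapping.keys x \<subseteq> nerve (Nbar C k) 0" "0 < p"
  shows "dhor DC (int p) q x = (if even p then x else 0)"
proof -
  have "frag_extend (hboundary p) x = (if even p then x else 0)"
    using assms(1)
  proof (induction x rule: frag_carrier_induct)
    case (gen \<sigma>)
    then show ?case by (auto simp: nerve_0 hboundary_vertex)
  qed (auto simp: frag_extend_diff)
  with assms(2) show ?thesis by (simp add: dhor_DC)
qed

text \<open>The horizontal degeneracy \<open>s_0\<close>. It moves a 1-simplex one column to the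
  right without changing its endpoints, hence without changing its vertical boundary.\<close>

definition hdegen_0 :: "'o list \<times> 'm list list \<Rightarrow> 'o list \<times> 'm list list" where
  "hdegen_0 = (\<lambda>(as, ms). (as, map (\<lambda>m. hd m # m) ms))"

lemma hdegen_0_closed:
  assumes "\<sigma> \<in> nerve (Nbar C p) 1"
  shows "hdegen_0 \<sigma> \<in> nerve (Nbar C (Suc p)) 1"
proof -
  obtain a b m where s: "\<sigma> = ([a, b], [m])" "a \<in> Obj C" "b \<in> Obj C" "m \<in> Hom (Nbar C p) a b"
    using assms by (auto simp: One_nat_def nerve_0 elim!: nerve_SucE)
  then have "m \<noteq> []" "set m \<subseteq> Hom C a b" by (auto simp: mem_Hom_Nbar)
  then have "hd m \<in> Hom C a b" using hd_in_set[of m] by blast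
  then have "hd m # m \<in> Hom (Nbar C (Suc p)) a b"
    using s le_refl[of a b "hd m"] by (simp add: mem_Hom_Nbar successively_Cons)
  then show ?thesis
    using s by (simp add: hdegen_0_def nerve_Suc_iff nerve_0)
qed

lemma bd_hdegen_0:
  assumes "\<sigma> \<in> nerve (Nbar C p) 1"
  shows "bd c 1 (hdegen_0 \<sigma>) = bd c 1 \<sigma>"
proof -
  obtain a b m where s: "\<sigma> = ([a, b], [m])"
    using assms by (auto simp: One_nat_def nerve_0 elim!: nerve_SucE)
  then show ?thesis by (simp add: bd_def hdegen_0_def)
qed

theorem spectral_sequence_collapses:
  assumes "2 \<le> r" "\<xi> \<in> carrier (Epage DC r p q)"
  shows "Ediff DC r p q \<xi> = \<one>\<^bsub>Epage DC r (p - int r) (q + int r - 1)\<^esub>"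
proof (rule frag_double_complex.collapse[OF frag_double_complex_DC _ _ assms])
  fix p q :: int and x
  assume "2 \<le> q" and x: "Poly_Mapping.keys x \<subseteq> simplices p q" and v: "dver DC p q x = 0"
  from x show "\<exists>t. Poly_Mapping.keys t \<subseteq> simplices p (q + 1) \<and> dver DC p (q + 1) t = x"
  proof (cases rule: simplices_cases)
    case 1
    then show ?thesis by (intro exI[of _ 0]) (simp add: FS_def)
  next
    case (2 p' q')
    then obtain k where k: "q' = Suc k" using \<open>2 \<le> q\<close> by (cases q') auto
    have "frag_extend (bd (map2 (Comp C)) (Suc k)) x = 0"
      using v dver_DC[of x p' k] 2 k by simp
    then obtain t where t: "Poly_Mapping.keys t \<subseteq> nerve (Nbar C p') (Suc q')"
        "frag_extend (bd (map2 (Comp C)) (Suc q')) t = x"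
      using Nbar.nerve_exact[of x p' q'] 2 k \<open>2 \<le> q\<close> by auto
    have e: "q + 1 = int (Suc q')" using 2 by simp
    show ?thesis
      unfolding e 2(1) using t dver_DC[OF t(1)] by (intro exI[of _ t]) (simp only: simplices_nat)
  qed
next
  fix p :: int and x u
  assume p: "2 \<le> p" and x: "Poly_Mapping.keys x \<subseteq> simplices p 0" and u: "Poly_Mapping.keys u \<subseteq> simplices (p - 1) 1"
    and eq: "dhor DC p 0 x + dver DC (p - 1) 1 u = 0"
  define k where "k = nat (p - 1)"
  have k: "p = int (Suc k)" using p by (simp add: k_def)
  have x': "Poly_Mapping.keys x \<subseteq> nerve (Nbar C (Suc k)) 0"
    using x k simplices_nat[of "Suc k" 0] by (simp del: of_nat_Suc)
  have u': "Poly_Mapping.keys u \<subseteq> nerve (Nbar C k) 1"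
    using u k simplices_nat[of k 1] by simp
  show "\<exists>w t. Poly_Mapping.keys w \<subseteq> simplices (p + 1) 0 \<and> Poly_Mapping.keys t \<subseteq> simplices p 1 \<and>
          x = dhor DC (p + 1) 0 w + dver DC p 1 t"
  \<comment> \<open>Here \<open>p = Suc k\<close>. For odd \<open>p\<close> the horizontal
    differential from column \<open>p + 1\<close> is the identity on vertices, so \<open>x\<close>
    is its own preimage. For even \<open>p\<close> it fixes \<open>x\<close>, so \<open>eq\<close>
    shows \<open>x\<close> to be a vertical boundary taken in column \<open>p - 1\<close>, and
    \<open>hdegen_0\<close> carries this over to column \<open>p\<close>.\<close>
  proof (cases "even (Suc k)")
    case False
    have p1: "p + 1 = int (Suc (Suc k))" using k by simp
    have "nerve (Nbar C (Suc (Suc k))) 0 = nerve (Nbar C (Suc k)) 0"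
      by (auto simp: nerve_0)
    then have "Poly_Mapping.keys x \<subseteq> simplices (p + 1) 0"
      using x' p1 simplices_nat[of "Suc (Suc k)" 0] by (simp del: of_nat_Suc)
    moreover have "dhor DC (p + 1) 0 x = x"
      using dhor_bottom[OF x', of "Suc (Suc k)" 0] False p1 by (simp del: of_nat_Suc)
    ultimately show ?thesis
      by (intro exI[of _ x] exI[of _ 0]) (simp add: FS_def)
  next
    case True
    define t where "t = - frag_extend (frag_of \<circ> hdegen_0) u"
    have t0: "Poly_Mapping.keys (frag_extend (frag_of \<circ> hdegen_0) u) \<subseteq> nerve (Nbar C (Suc k)) (Suc 0)"
      by (rule frag_extend_closed[OF u']) (use hdegen_0_closed in auto)
    then have t: "Poly_Mapping.keys t \<subseteq> nerve (Nbar C (Suc k)) (Suc 0)"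
      by (simp add: t_def keys_minus)
    have "frag_extend (bd (map2 (Comp C)) 1) (frag_extend (frag_of \<circ> hdegen_0) u) = frag_extend (bd (map2 (Comp C)) 1) u"
      using u'
    proof (induction u rule: frag_carrier_induct)
      case (gen \<sigma>)
      then show ?case using bd_hdegen_0[of \<sigma>] by simp
    qed (simp_all add: frag_extend_diff)
    moreover have "dhor DC p 0 x = x"
      using dhor_bottom[OF x', of "Suc k" 0] True k by (simp del: of_nat_Suc even_Suc)
    moreover have "dver DC (p - 1) 1 u = frag_extend (bd (map2 (Comp C)) 1) u"
      using dver_DC[of u k 0] u' k by simp
    ultimately have "x = frag_extend (bd (map2 (Comp C)) 1) t"
      using eq unfolding t_def frag_extend_minus eq_neg_iff_add_eq_0 by simp
    then have "x = dver DC p 1 t"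
      using dver_DC[OF t] k by simp
    moreover have "Poly_Mapping.keys t \<subseteq> simplices p 1"
      using t by (simp add: simplices_def k nat_add_distrib)
    ultimately show ?thesis
      by (intro exI[of _ 0] exI[of _ t]) (simp add: dhor_DC)
  qed
qed

end

section \<open>Zigzags\<close>

abbreviation zz1 :: "'o \<Rightarrow> 'o \<Rightarrow> 'm \<Rightarrow> ('o, 'm) zigzag" where
  "zz1 w z g \<equiv> \<lparr>zx = [w], zy = [z], zg = [g], zf = []\<rparr>"

definition zcons :: "'o \<Rightarrow> 'o \<Rightarrow> 'm \<Rightarrow> 'm \<Rightarrow> ('o, 'm) zigzag \<Rightarrow> ('o, 'm) zigzag" where
  "zcons w y g f \<gamma> = \<lparr>zx = w # zx \<gamma>, zy = y # zy \<gamma>, zg = g # zg \<gamma>, zf = f # zf \<gamma>\<rparr>"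

lemma zz1_in_zigzags [simp]:
  "zz1 w z g \<in> zigzags C S w' z' \<longleftrightarrow> w' = w \<and> z' = z \<and> w \<in> Obj C \<and> z \<in> Obj C \<and> g \<in> Hom C w z"
  by (auto simp: zigzags_def)

lemma zcons_in_zigzags:
  "zcons w y g f \<gamma> \<in> zigzags C S w' z \<longleftrightarrow>
     w' = w \<and> w \<in> Obj C \<and> y \<in> Obj C \<and> g \<in> Hom C w y \<and>
     (\<exists>x. f \<in> S x y \<and> \<gamma> \<in> zigzags C S x z)"
  unfolding zigzags_def zcons_def Let_def
  by (auto simp: All_less_Suc2 nth_Cons' less_Suc_eq_le[symmetric] simp del: less_Suc_eq_le)

lemma zigzags_lengths:
  assumes "\<gamma> \<in> zigzags C S w z"
  shows "length (zx \<gamma>) = Suc (length (zf \<gamma>))" "length (zy \<gamma>) = Suc (length (zf \<gamma>))"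
    "length (zg \<gamma>) = Suc (length (zf \<gamma>))"
  using assms by (simp_all add: zigzags_def Let_def)

lemma zigzags_endpoints:
  assumes "\<gamma> \<in> zigzags C S w z"
  shows "w \<in> Obj C" "z \<in> Obj C" "zx \<gamma> ! 0 = w" "zy \<gamma> ! length (zf \<gamma>) = z"
proof -
  have "zx \<gamma> ! 0 \<in> set (zx \<gamma>)" "zy \<gamma> ! length (zf \<gamma>) \<in> set (zy \<gamma>)"
    using zigzags_lengths[OF assms] by simp_all
  then show "w \<in> Obj C" "z \<in> Obj C" "zx \<gamma> ! 0 = w" "zy \<gamma> ! length (zf \<gamma>) = z"
    using assms by (auto simp: zigzags_def Let_def)
qed

lemma zigzag_eta: "\<gamma> = \<lparr>zx = zx \<gamma>, zy = zy \<gamma>, zg = zg \<gamma>, zf = zf \<gamma>\<rparr>"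
  by simp

lemma zigzag_cases:
  assumes "\<gamma> \<in> zigzags C S w z"
  obtains (single) g where "\<gamma> = zz1 w z g" "w \<in> Obj C" "z \<in> Obj C" "g \<in> Hom C w z"
  | (cons) y g f x \<delta> where "\<gamma> = zcons w y g f \<delta>" "w \<in> Obj C" "y \<in> Obj C" "g \<in> Hom C w y" "f \<in> S x y"
      "\<delta> \<in> zigzags C S x z"
proof (cases "zf \<gamma>")
  case Nil
  then obtain a b g where "zx \<gamma> = [a]" "zy \<gamma> = [b]" "zg \<gamma> = [g]"
    using zigzags_lengths[OF assms] by (auto simp: length_Suc_conv)
  then have \<gamma>: "\<gamma> = zz1 a b g" using Nil zigzag_eta[of \<gamma>] by simp
  show ?thesis using assms single unfolding \<gamma> by auto
next
  case (Cons f fs)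
  then obtain a as b bs g gs where "zx \<gamma> = a # as" "zy \<gamma> = b # bs" "zg \<gamma> = g # gs"
    using zigzags_lengths[OF assms] by (auto simp: length_Suc_conv)
  then have \<gamma>: "\<gamma> = zcons a b g f \<lparr>zx = as, zy = bs, zg = gs, zf = fs\<rparr>"
    using Cons zigzag_eta[of \<gamma>] by (simp add: zcons_def)
  show ?thesis
    using assms cons unfolding \<gamma> zcons_in_zigzags by blast
qed

lemma zigzag_induct [consumes 1, case_names single cons]:
  assumes "\<gamma> \<in> zigzags C S w z"
    and "\<And>w g. \<lbrakk>w \<in> Obj C; z \<in> Obj C; g \<in> Hom C w z\<rbrakk> \<Longrightarrow> P w (zz1 w z g)"
    and "\<And>w y g f x \<delta>. \<lbrakk>w \<in> Obj C; y \<in> Obj C; g \<in> Hom C w y; f \<in> S x y; \<delta> \<in> zigzags C S x z; P x \<delta>\<rbrakk> \<Longrightarrow>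
      P w (zcons w y g f \<delta>)"
  shows "P w \<gamma>"
  using assms(1)
proof (induction "length (zf \<gamma>)" arbitrary: w \<gamma>)
  case 0
  show ?case
    by (rule zigzag_cases[OF 0(2)]) (use 0(1) assms(2) in \<open>auto simp: zcons_def\<close>)
next
  case (Suc n)
  from Suc.prems show ?case
  proof (cases rule: zigzag_cases)
    case (cons y g f x \<delta>)
    have "n = length (zf \<delta>)" using Suc.hyps(2) cons(1) by (simp add: zcons_def)
    then show ?thesis using Suc.hyps(1)[OF _ cons(6)] assms(3)[OF cons(2-6)] cons(1) by simp
  qed (use Suc.hyps(2) in auto)
qed

lemma concat_zcons:
  assumes "\<gamma> \<in> zigzags C S x z"
  shows "zigzag_concat C (zcons w y g f \<gamma>) \<delta> = zcons w y g f (zigzag_concat C \<gamma> \<delta>)"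
proof -
  have "zy \<gamma> \<noteq> []" "zg \<gamma> \<noteq> []" using zigzags_lengths[OF assms] by auto
  then show ?thesis by (simp add: zigzag_concat_def zcons_def)
qed

lemma concat_zz1_zz1: "zigzag_concat C (zz1 w y g) (zz1 y' z h) = zz1 w z (Comp C h g)"
  by (simp add: zigzag_concat_def)

lemma concat_zz1_zcons: "zigzag_concat C (zz1 w y g) (zcons y' a h f \<gamma>) = zcons w a (Comp C h g) f \<gamma>"
  by (simp add: zigzag_concat_def zcons_def)

section \<open>Cells with a matching\<close>

text \<open>All that the combinatorial part takes from topology and from the Morse function. Among
  these facts \<open>no_chain\<close> is the one that rests on invariance of domain.\<close>

locale matched_cells =
  fixes X :: "'a topology" and K :: "'a set set" and cdim :: "'a set \<Rightarrow> nat" and f :: "'a set \<Rightarrow> real"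
  assumes dim_less: "\<lbrakk>x \<in> K; y \<in> K; cell_less X y x\<rbrakk> \<Longrightarrow> cdim y < cdim x"
    and up_unique: "\<lbrakk>regular_pair X K cdim f x y; regular_pair X K cdim f x y'\<rbrakk> \<Longrightarrow> y = y'"
    and down_unique: "\<lbrakk>regular_pair X K cdim f x y; regular_pair X K cdim f x' y\<rbrakk> \<Longrightarrow> x = x'"
    and no_chain: "regular_pair X K cdim f x y \<Longrightarrow> \<not> regular_pair X K cdim f y z"
begin

abbreviation "E \<equiv> Ent X K"
abbreviation "\<Sigma> \<equiv> with_identities E (Morse_system X K cdim f)"
abbreviation "rp \<equiv> regular_pair X K cdim f"
abbreviation "ZZ \<equiv> zigzags E \<Sigma>"
abbreviation "cat \<equiv> zigzag_concat E"

lemma rp_cells: "rp x y \<Longrightarrow> x \<in> K \<and> y \<in> K \<and> cdim y = Suc (cdim x) \<and> cell_less X x y"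
  by (simp add: regular_pair_def)

lemma Ent_simps [simp]:
  "Obj E = K" "Comp E t s = s @ tl t" "Ident E x = [x]" "Le E = subseq"
  by (simp_all add: Ent_def)

lemma mem_Hom: "s \<in> Hom E x y \<longleftrightarrow> s \<noteq> [] \<and> set s \<subseteq> K \<and> hd s = x \<and> last s = y \<and>
    successively (\<lambda>a b. cell_less X b a) s"
  by (simp add: Ent_def)

lemma mem_\<Sigma>: "s \<in> \<Sigma> a b \<longleftrightarrow> rp b a \<and> s = [a, b] \<or> a = b \<and> s = [a]"
  by (auto simp: with_identities_def Morse_system_def)

lemma singleton_Hom: "[x] \<in> Hom E a b \<longleftrightarrow> x \<in> K \<and> a = x \<and> b = x"
  by (auto simp: mem_Hom)

lemma Cons_Hom: "a # b # s \<in> Hom E x y \<longleftrightarrow> a = x \<and> a \<in> K \<and> cell_less X b a \<and> b # s \<in> Hom E b y"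
  by (auto simp: mem_Hom)

lemma \<Sigma>_Hom: "s \<in> \<Sigma> a b \<Longrightarrow> a \<in> K \<Longrightarrow> s \<in> Hom E a b"
  by (auto simp: mem_\<Sigma> singleton_Hom Cons_Hom dest: rp_cells)

lemma comp_Hom:
  assumes "s \<in> Hom E x y" "t \<in> Hom E y z"
  shows "s @ tl t \<in> Hom E x z"
proof (cases t)
  case Nil
  with assms show ?thesis by (simp add: mem_Hom)
next
  case (Cons a t')
  then show ?thesis
    using assms by (cases t') (auto simp: mem_Hom successively_append_iff successively_Cons)
qed

lemma comp_assoc: "t \<noteq> [] \<Longrightarrow> s @ tl (t @ tl u) = (s @ tl t) @ tl u"
  by (cases t) auto

lemma Hom_cons_tl: "s \<in> Hom E x y \<Longrightarrow> [x] @ tl s = s"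
  by (cases s) (auto simp: mem_Hom)

lemma Hom_cases:
  assumes "s \<in> Hom E x y"
  obtains "s = [x]" "x = y" "x \<in> K"
  | b t where "s = x # b # t" "x \<in> K" "b \<in> K" "cell_less X b x" "b # t \<in> Hom E b y"
proof (cases s)
  case Nil
  with assms show ?thesis by (simp add: mem_Hom)
next
  case (Cons a s')
  then show ?thesis
    using assms that by (cases s') (auto simp: singleton_Hom Cons_Hom, auto simp: mem_Hom)
qed

lemma Hom_induct [consumes 1, case_names single cons]:
  assumes "s \<in> Hom E x y"
    and "y \<in> K \<Longrightarrow> P y [y]"
    and "\<And>x b t. \<lbrakk>x \<in> K; b \<in> K; cell_less X b x; b # t \<in> Hom E b y; P b (b # t)\<rbrakk> \<Longrightarrow> P x (x # b # t)"
  shows "P x s"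
  using assms(1)
proof (induction s arbitrary: x)
  case (Cons a s)
  from Cons.prems show ?case
  proof (cases rule: Hom_cases)
    case (2 b t)
    then show ?thesis using Cons.IH[of b] assms(3) by auto
  qed (use assms(2) in auto)
qed (simp add: mem_Hom)

lemma Hom_ends: "s \<in> Hom E x y \<Longrightarrow> x \<in> K \<and> y \<in> K"
  by (auto simp: mem_Hom)

text \<open>Each step of a descending path loses at least one dimension. Consequently a path from a
  cell to itself is trivial, and a path between the two cells of a pair is a single step.\<close>

lemma Hom_dim: "s \<in> Hom E x y \<Longrightarrow> cdim y + length s \<le> Suc (cdim x)"
proof (induction rule: Hom_induct)
  case (cons x b t)
  then show ?case using dim_less[of x b] by simp
qed simp

lemma Hom_loop:
  assumes "s \<in> Hom E x x"
  shows "s = [x]"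
  using assms by (cases rule: Hom_cases) (use Hom_dim[OF assms] in auto)

lemma Hom_pair:
  assumes "s \<in> Hom E x y" "rp y x"
  shows "s = [x, y]"
  using assms(1)
proof (cases rule: Hom_cases)
  case 1
  then show ?thesis using rp_cells[OF assms(2)] by simp
next
  case (2 b t)
  then have "t = []"
    using Hom_dim[OF assms(1)] rp_cells[OF assms(2)] by simp
  with 2 show ?thesis by (simp add: singleton_Hom)
qed

subsection \<open>Normal forms\<close>

text \<open>Steps are stored with both endpoints because, once the steps in \<Sigma> are dropped,
  the target of one entry need not be the source of the next.\<close>

definition nfp :: "'a set list \<Rightarrow> ('a set \<times> 'a set) list" where
  "nfp s = filter (\<lambda>(a, b). \<not> rp b a) (zip s (tl s))"

lemma nfp_simps [simp]:
  "nfp [] = []" "nfp [a] = []" "nfp (a # b # s) = (if rp b a then [] else [(a, b)]) @ nfp (b # s)"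
  by (simp_all add: nfp_def)

lemma nfp_comp: "s \<in> Hom E x y \<Longrightarrow> t \<in> Hom E y z \<Longrightarrow> nfp (s @ tl t) = nfp s @ nfp t"
proof (induction rule: Hom_induct)
  case single
  then show ?case using Hom_cons_tl[of t y z] by simp
qed simp

lemma nfp_\<Sigma>: "s \<in> \<Sigma> a b \<Longrightarrow> nfp s = []"
  by (auto simp: mem_\<Sigma>)

text \<open>The regular pairs are disjoint, so the groupoid generated by \<open>\<Sigma>\<close> has at most one morphism
  between any two cells. Hence the steps outside \<open>\<Sigma>\<close> determine a morphism of the localization.\<close>

definition nf :: "('a set, 'a set list) zigzag \<Rightarrow> ('a set \<times> 'a set) list" where
  "nf \<gamma> = concat (map nfp (zg \<gamma>))"

lemma nf_zz1 [simp]: "nf (zz1 w z g) = nfp g"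
  by (simp add: nf_def)

lemma nf_zcons [simp]: "nf (zcons w y g h \<gamma>) = nfp g @ nf \<gamma>"
  by (simp add: nf_def zcons_def)

definition same :: "'a set \<Rightarrow> 'a set \<Rightarrow> bool" where
  "same a b \<longleftrightarrow> a = b \<or> rp a b \<or> rp b a"

lemma same_refl [simp]: "same a a"
  by (simp add: same_def)

text \<open>A class with three cells would contain two pairs sharing a cell, which
  \<open>up_unique\<close>, \<open>down_unique\<close> and \<open>no_chain\<close> exclude for the
  possible positions of the shared cell.\<close>

lemma same_trans: "same a b \<Longrightarrow> same b c \<Longrightarrow> same a c"
  unfolding same_def using up_unique down_unique no_chain by metis

lemma same_critical:
  "same a b \<Longrightarrow> a \<in> critical_cells X K cdim f \<Longrightarrow> a = b"
  "same a b \<Longrightarrow> b \<in> critical_cells X K cdim f \<Longrightarrow> a = b"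
  by (auto simp: same_def critical_cells_def)

text \<open>The condition that singles out the normal forms of morphisms from \<open>w\<close> to
  \<open>z\<close>: each gap between consecutive steps can be bridged inside \<Sigma>. Necessity is
  \<open>linked_nf\<close>, sufficiency is \<open>can_closed\<close>.\<close>

fun linked :: "'a set \<Rightarrow> ('a set \<times> 'a set) list \<Rightarrow> 'a set \<Rightarrow> bool" where
  "linked w [] z \<longleftrightarrow> same w z"
| "linked w ((a, c) # es) z \<longleftrightarrow> same w a \<and> a \<in> K \<and> c \<in> K \<and> cell_less X c a \<and> \<not> rp c a \<and> linked c es z"

lemma linked_same: "same w' w \<Longrightarrow> linked w es z \<Longrightarrow> linked w' es z"
  using same_trans by (cases es) auto

lemma linked_append: "linked w es x \<Longrightarrow> linked x es' z \<Longrightarrow> linked w (es @ es') z"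
  by (induction w es x rule: linked.induct) (auto intro: linked_same)

lemma linked_split: "linked w (es @ (a, c) # es') z \<Longrightarrow> linked w (es @ [(a, c)]) c \<and> linked c es' z"
  by (induction es arbitrary: w) auto

lemma linked_nfp: "s \<in> Hom E x y \<Longrightarrow> linked x (nfp s) y"
proof (induction rule: Hom_induct)
  case (cons x b t)
  show ?case
  proof (cases "rp b x")
    case True
    then have "same x b" by (simp add: same_def)
    from linked_same[OF this cons.IH] True show ?thesis by simp
  qed (use cons in simp)
qed simp

lemma \<Sigma>_same: "s \<in> \<Sigma> a b \<Longrightarrow> same a b"
  by (auto simp: mem_\<Sigma> same_def)

lemma same_sym: "same a b \<Longrightarrow> same b a"
  by (auto simp: same_def)

lemma linked_nf: "\<gamma> \<in> ZZ w z \<Longrightarrow> linked w (nf \<gamma>) z"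
proof (induction rule: zigzag_induct)
  case (single w g)
  then show ?case by (simp add: linked_nfp)
next
  case (cons w y g h x \<delta>)
  then show ?case
    using linked_append[OF linked_nfp linked_same[OF same_sym[OF \<Sigma>_same]]] by simp
qed

subsection \<open>Refinement of normal forms\<close>

definition fills :: "('a set \<times> 'a set) list \<Rightarrow> 'a set list list \<Rightarrow> bool" where
  "fills es ss \<longleftrightarrow> list_all2 (\<lambda>(a, c) s. s \<in> Hom E a c) es ss"

text \<open>The path replacing a step may itself use steps of \<Sigma>, which \<open>nfp\<close>
  removes again.\<close>

definition refines :: "('a set \<times> 'a set) list \<Rightarrow> ('a set \<times> 'a set) list \<Rightarrow> bool" where
  "refines es fs \<longleftrightarrow> (\<exists>ss. fills es ss \<and> fs = concat (map nfp ss))"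

lemma fills_Nil [simp]: "fills [] ss \<longleftrightarrow> ss = []"
  by (simp add: fills_def)

lemma fills_Cons: "fills ((a, c) # es) ss \<longleftrightarrow> (\<exists>s ss'. ss = s # ss' \<and> s \<in> Hom E a c \<and> fills es ss')"
  by (auto simp: fills_def list_all2_Cons1)

lemma fills_append: "fills (es @ es') ss \<longleftrightarrow> (\<exists>ts us. ss = ts @ us \<and> fills es ts \<and> fills es' us)"
  unfolding fills_def list_all2_append1 by (blast dest: list_all2_lengthD[THEN sym])

lemma refines_Nil [simp]: "refines [] fs \<longleftrightarrow> fs = []"
  by (auto simp: refines_def)

lemma refines_Cons: "refines ((a, c) # es) fs \<longleftrightarrow> (\<exists>s fs'. s \<in> Hom E a c \<and> fs = nfp s @ fs' \<and> refines es fs')"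
  unfolding refines_def fills_Cons by fastforce

lemma refines_append: "refines (es @ es') fs \<longleftrightarrow> (\<exists>fs1 fs2. fs = fs1 @ fs2 \<and> refines es fs1 \<and> refines es' fs2)"
  unfolding refines_def fills_append by fastforce

lemma refines_refl: "linked w es z \<Longrightarrow> refines es es"
proof (induction w es z rule: linked.induct)
  case (2 w a c es z)
  then have "[a, c] \<in> Hom E a c" by (simp add: Cons_Hom singleton_Hom)
  with 2 show ?case by (auto simp: refines_Cons intro!: exI[of _ "[a, c]"])
qed simp

lemma refines_linked: "linked w es z \<Longrightarrow> refines es fs \<Longrightarrow> linked w fs z"
proof (induction w es z arbitrary: fs rule: linked.induct)
  case (2 w a c es z)
  then obtain s fs' where s: "s \<in> Hom E a c" "fs = nfp s @ fs'" "refines es fs'"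
    by (auto simp: refines_Cons)
  then have "linked a fs z"
    using linked_append[OF linked_nfp[OF s(1)]] 2 by simp
  then show ?case using linked_same[of w a fs z] 2(2) by simp
qed simp

text \<open>The steps of \<open>s\<close> in \<Sigma> are kept and the others replaced by their
  fillings, so all endpoints still match and one honest path results. Transitivity of
  \<open>refines\<close> depends on this.\<close>

lemma nfp_fill:
  assumes "s \<in> Hom E x y" "fills (nfp s) ts"
  shows "\<exists>t\<in>Hom E x y. nfp t = concat (map nfp ts)"
  using assms
proof (induction arbitrary: ts rule: Hom_induct)
  case single
  then show ?case by (auto simp: singleton_Hom intro!: bexI[of _ "[y]"])
next
  case (cons x b t)
  show ?case
  proof (cases "rp b x")
    case True
    then obtain t' where t': "t' \<in> Hom E b y" "nfp t' = concat (map nfp ts)"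
      using cons by auto
    have xb: "[x, b] \<in> Hom E x b" using cons by (simp add: Cons_Hom singleton_Hom)
    then show ?thesis
      using comp_Hom[OF xb t'(1)] nfp_comp[OF xb t'(1)] t' True by (intro bexI[of _ "[x, b] @ tl t'"]) auto
  next
    case False
    then obtain t1 ts' where t1: "ts = t1 # ts'" "t1 \<in> Hom E x b" "fills (nfp (b # t)) ts'"
      using cons.prems by (auto simp: fills_Cons)
    then obtain t' where t': "t' \<in> Hom E b y" "nfp t' = concat (map nfp ts')"
      using cons.IH by blast
    then show ?thesis
      using comp_Hom[OF t1(2) t'(1)] nfp_comp[OF t1(2) t'(1)] t1(1) by auto
  qed
qed

lemma refines_trans: "refines es fs \<Longrightarrow> refines fs gs \<Longrightarrow> refines es gs"
proof (induction es arbitrary: fs gs)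
  case (Cons e es)
  obtain a c where e: "e = (a, c)" by fastforce
  then obtain s fs' where s: "s \<in> Hom E a c" "fs = nfp s @ fs'" "refines es fs'"
    using Cons.prems(1) by (auto simp: refines_Cons)
  then obtain gs1 gs2 where g: "gs = gs1 @ gs2" "refines (nfp s) gs1" "refines fs' gs2"
    using Cons.prems(2) by (auto simp: refines_append)
  then obtain t where "t \<in> Hom E a c" "nfp t = gs1"
    using nfp_fill[OF s(1)] by (auto simp: refines_def)
  then show ?case using g s Cons.IH by (auto simp: e refines_Cons)
qed simp

text \<open>Two consecutive steps in \<Sigma> would form a chain of two pairs, so a path lying in
  \<Sigma> has at most one step.\<close>

lemma nfp_eq_Nil:
  assumes "s \<in> Hom E x y" "nfp s = []"
  shows "x = y \<or> rp y x"
  using assms(1)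
proof (cases rule: Hom_cases)
  case (2 b t)
  then have b: "rp b x" "nfp (b # t) = []" using assms(2) by (auto split: if_splits)
  from 2(5) show ?thesis
  proof (cases rule: Hom_cases)
    case (2 b' t')
    then have "rp b' b" using b(2) by (auto split: if_splits)
    with b(1) no_chain show ?thesis by blast
  qed (use b in simp)
qed simp

lemma nfp_split:
  assumes "s \<in> Hom E x y" "nfp s = p @ (a, c) # r"
  shows "\<exists>t. c # t \<in> Hom E c y \<and> nfp (c # t) = r"
  using assms
proof (induction arbitrary: p rule: Hom_induct)
  case (cons x b t)
  show ?case
  proof (cases "rp b x")
    case True
    then show ?thesis using cons by auto
  next
    case False
    then show ?thesis using cons by (cases p) auto
  qed
qed simp

text \<open>The refinements of a step form a prefix code. Let \<open>y\<close> be the target of the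
  last step of \<open>s\<close> outside \<Sigma>; then \<open>y = c\<close> or \<open>y\<close> is
  paired above \<open>c\<close>. In both cases dimension leaves just one path from \<open>y\<close>
  to \<open>c\<close>, so \<open>s'\<close> has no further step outside \<Sigma>.\<close>

lemma nfp_prefix_free:
  assumes s: "s \<in> Hom E a c" and s': "s' \<in> Hom E a c" and "a \<noteq> c" "\<not> rp c a" and eq: "nfp s' = nfp s @ r"
  shows "r = []"
proof -
  have "nfp s \<noteq> []" using nfp_eq_Nil[OF s] assms(3,4) by blast
  then obtain p u y where p: "nfp s = p @ [(u, y)]"
    by (metis rev_exhaust surj_pair)
  obtain t where "y # t \<in> Hom E y c" "nfp (y # t) = []"
    using nfp_split[OF s p] by blast
  then have y: "y = c \<or> rp c y" by (rule nfp_eq_Nil)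
  obtain t' where t': "y # t' \<in> Hom E y c" "nfp (y # t') = r"
    using nfp_split[OF s', of p u y r] eq p by auto
  from y show ?thesis
  proof
    assume "y = c"
    then show ?thesis using Hom_loop t' by fastforce
  next
    assume "rp c y"
    then show ?thesis using Hom_pair[OF t'(1)] t'(2) by auto
  qed
qed

text \<open>Unique decoding with a prefix code, one step at a time. The arbitrary tails
  \<open>r\<close> and \<open>r'\<close> make it locate the cut inside a refinement of a
  composite.\<close>

lemma refines_unique:
  "\<lbrakk>linked w es z; refines es fs; refines es fs'; fs @ r = fs' @ r'\<rbrakk> \<Longrightarrow> fs = fs'"
proof (induction w es z arbitrary: fs fs' rule: linked.induct)
  case (2 w a c es z)
  obtain s gs where s: "s \<in> Hom E a c" "fs = nfp s @ gs" "refines es gs"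
    using 2 by (auto simp: refines_Cons)
  obtain s' gs' where s': "s' \<in> Hom E a c" "fs' = nfp s' @ gs'" "refines es gs'"
    using 2 by (auto simp: refines_Cons)
  have ac: "a \<noteq> c" "\<not> rp c a" using 2 by (auto simp: cell_less_def)
  have "nfp s @ (gs @ r) = nfp s' @ (gs' @ r')" using 2 s s' by simp
  then obtain q where "nfp s = nfp s' @ q \<or> nfp s @ q = nfp s'"
    unfolding append_eq_append_conv2 by blast
  then have e: "nfp s = nfp s'"
    using nfp_prefix_free[OF s(1) s'(1) ac, of q] nfp_prefix_free[OF s'(1) s(1) ac, of q] by fastforce
  then have "gs = gs'" using 2 s s' by auto
  with e s s' show ?case by simp
qed simp

text \<open>Each step \<open>x > b\<close> of \<open>s'\<close> is refined by the segment of
  \<open>s\<close> between these cells. If the step lies in \<Sigma>, the segment is that very step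
  by \<open>Hom_pair\<close>, and both sides lose it.\<close>

lemma subseq_refines:
  assumes "s' \<in> Hom E x y" "s \<in> Hom E x y" "subseq s' s"
  shows "refines (nfp s') (nfp s)"
  using assms
proof (induction arbitrary: s rule: Hom_induct)
  case single
  then show ?case using Hom_loop[of s y] by simp
next
  case (cons x b t)
  obtain s1 where s1: "s = x # s1" using cons.prems(1) by (cases s) (auto simp: mem_Hom)
  with cons.prems have "subseq (b # t) s1" by simp
  then obtain us vs where s1': "s1 = us @ b # vs" "subseq t vs"
    by (auto dest: list_emb_ConsD)
  have ne: "b # vs \<noteq> []" by simp
  let ?R = "\<lambda>a b. cell_less X b a"
  have s2: "s = (x # us) @ (b # vs)" by (simp add: s1 s1')
  have su: "set (x # us) \<subseteq> K" "b \<in> K" "set vs \<subseteq> K" "last (b # vs) = y"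
    using cons.prems(1) unfolding mem_Hom s2 by simp_all
  have "successively ?R ((x # us) @ (b # vs))"
    using cons.prems(1) unfolding mem_Hom s2 by blast
  then have sc: "successively ?R (x # us)" "successively ?R (b # vs)" "?R (last (x # us)) b"
    unfolding successively_append_iff by simp_all
  then have "successively ?R ((x # us) @ [b])"
    unfolding successively_append_iff by simp
  then have u: "x # us @ [b] \<in> Hom E x b"
    using su unfolding mem_Hom by simp
  have v: "b # vs \<in> Hom E b y"
    using su sc(2) unfolding mem_Hom by simp
  have split: "nfp s = nfp (x # us @ [b]) @ nfp (b # vs)"
    using nfp_comp[OF u v] by (simp add: s1 s1')
  have IH: "refines (nfp (b # t)) (nfp (b # vs))"
    by (rule cons.IH[OF v]) (use s1' in simp)
  show ?case
  proof (cases "rp b x")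
    case True
    then show ?thesis using Hom_pair[OF u] split IH by auto
  next
    case False
    then show ?thesis using u split IH by (auto simp: refines_Cons)
  qed
qed

subsection \<open>Concatenation respects equivalence\<close>

lemma Hom_nonempty: "s \<in> Hom E x y \<Longrightarrow> s \<noteq> []"
  by (auto simp: mem_Hom)

lemma cat_closed:
  assumes "\<gamma> \<in> ZZ w y" "\<delta> \<in> ZZ y z"
  shows "cat \<gamma> \<delta> \<in> ZZ w z"
  using assms(1)
proof (induction rule: zigzag_induct)
  case (single w g)
  from assms(2) show ?case
    by (cases rule: zigzag_cases)
      (use single comp_Hom in \<open>auto simp: concat_zz1_zz1 concat_zz1_zcons zcons_in_zigzags\<close>)
next
  case (cons w y g f x \<delta>')
  then show ?case by (auto simp: concat_zcons[OF cons.hyps(5)] zcons_in_zigzags)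
qed

lemma cat_assoc:
  assumes "\<gamma> \<in> ZZ w x" "\<delta> \<in> ZZ x y" "\<epsilon> \<in> ZZ y z"
  shows "cat (cat \<gamma> \<delta>) \<epsilon> = cat \<gamma> (cat \<delta> \<epsilon>)"
  using assms(1)
proof (induction rule: zigzag_induct)
  case (single w g)
  from assms(2) show ?case
  proof (cases rule: zigzag_cases)
    case (single h)
    note h = this
    have ne: "h \<noteq> []" using h Hom_nonempty by simp
    from assms(3) show ?thesis
      by (cases rule: zigzag_cases) (simp_all add: h concat_zz1_zz1 concat_zz1_zcons comp_assoc[OF ne])
  next
    case (cons a h k b \<delta>')
    then show ?thesis by (simp add: concat_zz1_zcons concat_zcons[OF cons(6)])
  qed
next
  case (cons w y' g f x' \<delta>')
  have "cat \<delta>' \<delta> \<in> ZZ x' y" using cat_closed[OF cons.hyps(5) assms(2)] .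
  then show ?case using cons by (simp add: concat_zcons[OF cons.hyps(5)] concat_zcons)
qed

lemma cat_unit_left: "\<delta> \<in> ZZ w z \<Longrightarrow> cat (zz1 w w [w]) \<delta> = \<delta>"
  by (erule zigzag_cases) (auto simp: concat_zz1_zz1 concat_zz1_zcons dest: Hom_cons_tl)

lemma cat_unit_right: "\<gamma> \<in> ZZ w z \<Longrightarrow> cat \<gamma> (zz1 z z [z]) = \<gamma>"
  by (induction rule: zigzag_induct) (simp_all add: concat_zz1_zz1 concat_zcons)

lemma nf_cat:
  assumes "\<gamma> \<in> ZZ w y" "\<delta> \<in> ZZ y z"
  shows "nf (cat \<gamma> \<delta>) = nf \<gamma> @ nf \<delta>"
  using assms(1)
proof (induction rule: zigzag_induct)
  case (single w g)
  from assms(2) show ?case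
  proof (cases rule: zigzag_cases)
    case (single h)
    then show ?thesis using nfp_comp \<open>g \<in> Hom E w y\<close> by (simp add: concat_zz1_zz1)
  next
    case (cons a h k b \<delta>')
    then show ?thesis using nfp_comp \<open>g \<in> Hom E w y\<close> by (simp add: concat_zz1_zcons)
  qed
next
  case (cons w y' g f x' \<delta>')
  then show ?case by (simp add: concat_zcons[OF cons.hyps(5)])
qed

lemma ZZ_unique: "\<gamma> \<in> ZZ w z \<Longrightarrow> \<gamma> \<in> ZZ w' z' \<Longrightarrow> w = w' \<and> z = z'"
  using zigzags_endpoints(3,4) by metis

lemma horizontal_zcons: "horizontal_step E \<gamma> \<gamma>' \<Longrightarrow> horizontal_step E (zcons w y g s \<gamma>) (zcons w y g s \<gamma>')"
proof -
  assume "horizontal_step E \<gamma> \<gamma>'"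
  then obtain X1 X2 Y1 Y2 G1 G2 F1 F2 x a b h k where
    l: "length X1 = length F1" "length Y1 = length F1" "length G1 = length F1"
    and e: "\<gamma> = \<lparr>zx = X1 @ [x, a] @ X2, zy = Y1 @ [a, b] @ Y2,
            zg = G1 @ [h, k] @ G2, zf = F1 @ [Ident E a] @ F2\<rparr>"
       "\<gamma>' = \<lparr>zx = X1 @ [x] @ X2, zy = Y1 @ [b] @ Y2,
             zg = G1 @ [Comp E k h] @ G2, zf = F1 @ F2\<rparr>"
    unfolding horizontal_step_def by blast
  show ?thesis
    unfolding horizontal_step_def
    by (rule exI[of _ "w # X1"], rule exI[of _ X2], rule exI[of _ "y # Y1"], rule exI[of _ Y2],
        rule exI[of _ "g # G1"], rule exI[of _ G2], rule exI[of _ "s # F1"], rule exI[of _ F2],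
        rule exI[of _ x], rule exI[of _ a], rule exI[of _ b], rule exI[of _ h], rule exI[of _ k])
      (simp add: l e zcons_def)
qed

text \<open>With \<open>horizontal_elim\<close> this trades the list surgery of
  \<open>horizontal_step\<close> for concatenation with an identity column in the middle, so that
  compatibility with \<open>cat\<close> reduces to associativity.\<close>

lemma horizontal_intro:
  assumes "\<alpha> \<in> ZZ w y" "\<beta> \<in> ZZ y z"
  shows "horizontal_step E (cat \<alpha> (zcons y y [y] [y] \<beta>)) (cat \<alpha> \<beta>)"
  using assms(1)
proof (induction rule: zigzag_induct)
  case (single w g)
  have l: "length (zx \<beta>) = Suc (length (zf \<beta>))" "length (zy \<beta>) = Suc (length (zf \<beta>))"
    "length (zg \<beta>) = Suc (length (zf \<beta>))" by (rule zigzags_lengths[OF assms(2)])+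
  obtain a X2 where x: "zx \<beta> = a # X2" using l(1) by (cases "zx \<beta>") auto
  obtain b Y2 where y: "zy \<beta> = b # Y2" using l(2) by (cases "zy \<beta>") auto
  obtain h G2 where g: "zg \<beta> = h # G2" using l(3) by (cases "zg \<beta>") auto
  have "a = y" using zigzags_endpoints(3)[OF assms(2)] x by simp
  show ?case
    unfolding horizontal_step_def
    by (rule exI[of _ "[]"], rule exI[of _ X2], rule exI[of _ "[]"], rule exI[of _ Y2],
        rule exI[of _ "[]"], rule exI[of _ G2], rule exI[of _ "[]"], rule exI[of _ "zf \<beta>"],
        rule exI[of _ w], rule exI[of _ y], rule exI[of _ b], rule exI[of _ g], rule exI[of _ h])
      (simp add: zigzag_concat_def zcons_def x y g \<open>a = y\<close>)
next
  case (cons w y' g f x' \<delta>')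
  then show ?case by (simp add: concat_zcons[OF cons.hyps(5)] horizontal_zcons)
qed

lemma horizontal_elim_lists:
  assumes "length X1 = length F1" "length Y1 = length F1" "length G1 = length F1"
    and "\<lparr>zx = X1 @ [x, y] @ X2, zy = Y1 @ [y, y'] @ Y2, zg = G1 @ [g, g'] @ G2, zf = F1 @ [[y]] @ F2\<rparr> \<in> ZZ w z"
  shows "\<exists>\<alpha> \<beta>. \<alpha> \<in> ZZ w y \<and> \<beta> \<in> ZZ y z \<and>
    \<lparr>zx = X1 @ [x, y] @ X2, zy = Y1 @ [y, y'] @ Y2, zg = G1 @ [g, g'] @ G2, zf = F1 @ [[y]] @ F2\<rparr> =
      cat \<alpha> (zcons y y [y] [y] \<beta>) \<and>
    \<lparr>zx = X1 @ [x] @ X2, zy = Y1 @ [y'] @ Y2, zg = G1 @ [g @ tl g'] @ G2, zf = F1 @ F2\<rparr> = cat \<alpha> \<beta>"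
  using assms
proof (induction F1 arbitrary: X1 Y1 G1 w)
  case Nil
  let ?\<beta> = "\<lparr>zx = y # X2, zy = y' # Y2, zg = g' # G2, zf = F2\<rparr>"
  have e: "\<lparr>zx = X1 @ [x, y] @ X2, zy = Y1 @ [y, y'] @ Y2, zg = G1 @ [g, g'] @ G2, zf = [] @ [[y]] @ F2\<rparr> =
      zcons x y g [y] ?\<beta>"
    using Nil by (simp add: zcons_def)
  obtain x' where m: "w = x" "x \<in> K" "y \<in> K" "g \<in> Hom E x y" "?\<beta> \<in> ZZ x' z"
    using Nil(4) unfolding e zcons_in_zigzags by auto
  then have "?\<beta> \<in> ZZ y z" using zigzags_endpoints(3)[OF m(5)] by simp
  with m e Nil show ?case
    by (intro exI[of _ "zz1 x y g"] exI[of _ ?\<beta>])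
      (simp add: concat_zz1_zcons, simp add: zigzag_concat_def)
next
  case (Cons f F1)
  then obtain x0 X1' y0 Y1' g0 G1' where s: "X1 = x0 # X1'" "Y1 = y0 # Y1'" "G1 = g0 # G1'"
    and l: "length X1' = length F1" "length Y1' = length F1" "length G1' = length F1"
    by (auto simp: length_Suc_conv)
  let ?\<gamma> = "\<lparr>zx = X1' @ [x, y] @ X2, zy = Y1' @ [y, y'] @ Y2, zg = G1' @ [g, g'] @ G2, zf = F1 @ [[y]] @ F2\<rparr>"
  let ?\<gamma>' = "\<lparr>zx = X1' @ [x] @ X2, zy = Y1' @ [y'] @ Y2, zg = G1' @ [g @ tl g'] @ G2, zf = F1 @ F2\<rparr>"
  have e: "\<lparr>zx = X1 @ [x, y] @ X2, zy = Y1 @ [y, y'] @ Y2, zg = G1 @ [g, g'] @ G2, zf = (f # F1) @ [[y]] @ F2\<rparr>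
      = zcons x0 y0 g0 f ?\<gamma>"
    "\<lparr>zx = X1 @ [x] @ X2, zy = Y1 @ [y'] @ Y2, zg = G1 @ [g @ tl g'] @ G2, zf = (f # F1) @ F2\<rparr> = zcons x0 y0 g0 f ?\<gamma>'"
    by (simp_all add: zcons_def s)
  obtain x1 where m: "w = x0" "x0 \<in> K" "y0 \<in> K" "g0 \<in> Hom E x0 y0" "f \<in> \<Sigma> x1 y0" "?\<gamma> \<in> ZZ x1 z"
    using Cons.prems(4) unfolding e zcons_in_zigzags by auto
  obtain \<alpha> \<beta> where IH: "\<alpha> \<in> ZZ x1 y" "\<beta> \<in> ZZ y z" "?\<gamma> = cat \<alpha> (zcons y y [y] [y] \<beta>)" "?\<gamma>' = cat \<alpha> \<beta>"
    using Cons.IH[OF l m(6)] by blast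
  have "zcons x0 y0 g0 f \<alpha> \<in> ZZ w y"
    using m IH(1) by (auto simp: zcons_in_zigzags)
  then show ?case
    unfolding e IH(3,4) using IH(1,2) by (intro exI[of _ "zcons x0 y0 g0 f \<alpha>"] exI[of _ \<beta>]) (simp add: concat_zcons)
qed

lemma horizontal_elim:
  assumes "horizontal_step E \<gamma> \<gamma>'" "\<gamma> \<in> ZZ w z"
  obtains \<alpha> \<beta> y where "\<alpha> \<in> ZZ w y" "\<beta> \<in> ZZ y z" "\<gamma> = cat \<alpha> (zcons y y [y] [y] \<beta>)" "\<gamma>' = cat \<alpha> \<beta>"
proof -
  obtain X1 X2 Y1 Y2 G1 G2 F1 F2 x y y' g g' where
    l: "length X1 = length F1" "length Y1 = length F1" "length G1 = length F1"
    and e: "\<gamma> = \<lparr>zx = X1 @ [x, y] @ X2, zy = Y1 @ [y, y'] @ Y2, zg = G1 @ [g, g'] @ G2, zf = F1 @ [[y]] @ F2\<rparr>"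
       "\<gamma>' = \<lparr>zx = X1 @ [x] @ X2, zy = Y1 @ [y'] @ Y2, zg = G1 @ [g @ tl g'] @ G2, zf = F1 @ F2\<rparr>"
    using assms(1) unfolding horizontal_step_def Ent_simps by blast
  show ?thesis
    using horizontal_elim_lists[OF l assms(2)[unfolded e]] that unfolding e by blast
qed

text \<open>Index \<open>a\<close> is the merged column: its source comes from the first zigzag, its
  target from the second, and its arrow is the composite. Hence \<open>i \<le> a\<close> for
  \<open>zx\<close> but \<open>i < a\<close> for \<open>zy\<close>.\<close>

lemma cat_nth:
  assumes "\<gamma> \<in> ZZ w y" "\<delta> \<in> ZZ y z"
  defines "a \<equiv> length (zf \<gamma>)" and "b \<equiv> length (zf \<delta>)"
  shows "i \<le> a + b \<Longrightarrow> zx (cat \<gamma> \<delta>) ! i = (if i \<le> a then zx \<gamma> ! i else zx \<delta> ! (i - a))"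
    and "i \<le> a + b \<Longrightarrow> zy (cat \<gamma> \<delta>) ! i = (if i < a then zy \<gamma> ! i else zy \<delta> ! (i - a))"
    and "i \<le> a + b \<Longrightarrow> zg (cat \<gamma> \<delta>) ! i =
      (if i < a then zg \<gamma> ! i else if i = a then zg \<gamma> ! a @ tl (zg \<delta> ! 0) else zg \<delta> ! (i - a))"
    and "zf (cat \<gamma> \<delta>) ! i = (if i < a then zf \<gamma> ! i else zf \<delta> ! (i - a))"
    and "length (zf (cat \<gamma> \<delta>)) = a + b"
proof -
  note l = zigzags_lengths[OF assms(1)] zigzags_lengths[OF assms(2)]
  have ne: "zg \<gamma> \<noteq> []" "zg \<delta> \<noteq> []" using l by auto
  show "i \<le> a + b \<Longrightarrow> zx (cat \<gamma> \<delta>) ! i = (if i \<le> a then zx \<gamma> ! i else zx \<delta> ! (i - a))"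
    using l by (auto simp: zigzag_concat_def nth_append nth_tl a_def b_def Suc_diff_Suc)
  show "i \<le> a + b \<Longrightarrow> zy (cat \<gamma> \<delta>) ! i = (if i < a then zy \<gamma> ! i else zy \<delta> ! (i - a))"
    using l by (auto simp: zigzag_concat_def nth_append nth_butlast a_def b_def)
  show "i \<le> a + b \<Longrightarrow> zg (cat \<gamma> \<delta>) ! i =
      (if i < a then zg \<gamma> ! i else if i = a then zg \<gamma> ! a @ tl (zg \<delta> ! 0) else zg \<delta> ! (i - a))"
    using l ne
    by (auto simp: zigzag_concat_def nth_append nth_butlast nth_tl nth_Cons' a_def b_def last_conv_nth hd_conv_nth Suc_diff_Suc)
  show "zf (cat \<gamma> \<delta>) ! i = (if i < a then zf \<gamma> ! i else zf \<delta> ! (i - a))"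
    by (simp add: zigzag_concat_def nth_append a_def)
  show "length (zf (cat \<gamma> \<delta>)) = a + b"
    by (simp add: zigzag_concat_def a_def b_def)
qed

lemma ZZ_arrows:
  assumes "\<gamma> \<in> ZZ w z"
  shows "i \<le> length (zf \<gamma>) \<Longrightarrow> zg \<gamma> ! i \<in> Hom E (zx \<gamma> ! i) (zy \<gamma> ! i)"
    and "i < length (zf \<gamma>) \<Longrightarrow> zf \<gamma> ! i \<in> \<Sigma> (zx \<gamma> ! (i + 1)) (zy \<gamma> ! i)"
    and "i \<le> length (zf \<gamma>) \<Longrightarrow> zx \<gamma> ! i \<in> K"
    and "i \<le> length (zf \<gamma>) \<Longrightarrow> zy \<gamma> ! i \<in> K"
proof -
  show "i \<le> length (zf \<gamma>) \<Longrightarrow> zg \<gamma> ! i \<in> Hom E (zx \<gamma> ! i) (zy \<gamma> ! i)"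
    "i < length (zf \<gamma>) \<Longrightarrow> zf \<gamma> ! i \<in> \<Sigma> (zx \<gamma> ! (i + 1)) (zy \<gamma> ! i)"
    using assms by (simp_all add: zigzags_def Let_def)
  show "i \<le> length (zf \<gamma>) \<Longrightarrow> zx \<gamma> ! i \<in> K" "i \<le> length (zf \<gamma>) \<Longrightarrow> zy \<gamma> ! i \<in> K"
    using assms nth_mem[of i "zx \<gamma>"] nth_mem[of i "zy \<gamma>"] by (auto simp: zigzags_def Let_def)
qed

lemma ladder_refl:
  assumes "\<gamma> \<in> ZZ w z" and R: "\<And>s. R s s"
  shows "ladder E \<Sigma> R \<gamma> \<gamma>"
proof -
  have 1: "[zx \<gamma> ! i] @ tl (zg \<gamma> ! i) = zg \<gamma> ! i" if "i \<le> length (zf \<gamma>)" for i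
    using Hom_cons_tl[OF ZZ_arrows(1)[OF assms(1) that]] .
  have 2: "[zx \<gamma> ! Suc i] @ tl (zf \<gamma> ! i) = zf \<gamma> ! i" if "i < length (zf \<gamma>)" for i
    using ZZ_arrows(2)[OF assms(1) that] by (auto simp: mem_\<Sigma>)
  show ?thesis
    unfolding ladder_def Let_def
    by (rule conjI, rule refl, rule exI[of _ "\<lambda>i. [zy \<gamma> ! i]"], rule exI[of _ "\<lambda>i. [zx \<gamma> ! i]"])
      (use 1 2 R in \<open>simp add: mem_\<Sigma>\<close>)
qed

text \<open>The last \<open>u\<close> of one ladder and the first \<open>v\<close> of the other are
  identities at \<open>y\<close>, so in the merged column the first supplies \<open>v\<close> and
  the second supplies \<open>u\<close>. The condition on \<open>R\<close> holds for equality and for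
  \<open>subseq\<close>.\<close>

lemma ladder_cat:
  assumes \<gamma>: "\<gamma> \<in> ZZ w y" "\<gamma>' \<in> ZZ w y" and \<delta>: "\<delta> \<in> ZZ y z" "\<delta>' \<in> ZZ y z"
    and l1: "ladder E \<Sigma> R \<gamma> \<gamma>'" and l2: "ladder E \<Sigma> R \<delta> \<delta>'"
    and R: "\<And>p p' q q'. \<lbrakk>R p p'; R q q'; q \<noteq> []; q' \<noteq> []; hd q = hd q'\<rbrakk> \<Longrightarrow> R (p @ tl q) (p' @ tl q')"
  shows "ladder E \<Sigma> R (cat \<gamma> \<delta>) (cat \<gamma>' \<delta>')"
proof -
  define a b where "a = length (zf \<gamma>)" and "b = length (zf \<delta>)"
  obtain u1 v1 where a': "length (zf \<gamma>') = a"
    and u1: "\<And>i. i \<le> a \<Longrightarrow> u1 i \<in> \<Sigma> (zy \<gamma> ! i) (zy \<gamma>' ! i)" and v1: "\<And>i. i \<le> a \<Longrightarrow> v1 i \<in> \<Sigma> (zx \<gamma> ! i) (zx \<gamma>' ! i)"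
    and e1: "v1 0 = [zx \<gamma> ! 0]" "u1 a = [zy \<gamma> ! a]"
    and g1: "\<And>i. i \<le> a \<Longrightarrow> R (v1 i @ tl (zg \<gamma>' ! i)) (zg \<gamma> ! i @ tl (u1 i))"
    and f1: "\<And>i. i < a \<Longrightarrow> R (v1 (i + 1) @ tl (zf \<gamma>' ! i)) (zf \<gamma> ! i @ tl (u1 i))"
    using l1 unfolding ladder_def Let_def a_def[symmetric] Ent_simps by blast
  obtain u2 v2 where b': "length (zf \<delta>') = b"
    and u2: "\<And>i. i \<le> b \<Longrightarrow> u2 i \<in> \<Sigma> (zy \<delta> ! i) (zy \<delta>' ! i)" and v2: "\<And>i. i \<le> b \<Longrightarrow> v2 i \<in> \<Sigma> (zx \<delta> ! i) (zx \<delta>' ! i)"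
    and e2: "v2 0 = [zx \<delta> ! 0]" "u2 b = [zy \<delta> ! b]"
    and g2: "\<And>i. i \<le> b \<Longrightarrow> R (v2 i @ tl (zg \<delta>' ! i)) (zg \<delta> ! i @ tl (u2 i))"
    and f2: "\<And>i. i < b \<Longrightarrow> R (v2 (i + 1) @ tl (zf \<delta>' ! i)) (zf \<delta> ! i @ tl (u2 i))"
    using l2 unfolding ladder_def Let_def b_def[symmetric] Ent_simps by blast
  note n = cat_nth[OF \<gamma>(1) \<delta>(1), folded a_def b_def]
    and n' = cat_nth[OF \<gamma>(2) \<delta>(2), unfolded a' b']
  define u v where "u = (\<lambda>i. if i < a then u1 i else u2 (i - a))" and "v = (\<lambda>i. if i \<le> a then v1 i else v2 (i - a))"
  have uS: "u i \<in> \<Sigma> (zy (cat \<gamma> \<delta>) ! i) (zy (cat \<gamma>' \<delta>') ! i)" if "i \<le> a + b" for i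
    using that u1[of i] u2[of "i - a"] by (simp add: n n' u_def)
  have vS: "v i \<in> \<Sigma> (zx (cat \<gamma> \<delta>) ! i) (zx (cat \<gamma>' \<delta>') ! i)" if "i \<le> a + b" for i
    using that v1[of i] v2[of "i - a"] by (simp add: n n' v_def)
  have v0: "v 0 = [zx (cat \<gamma> \<delta>) ! 0]" and uk: "u (a + b) = [zy (cat \<gamma> \<delta>) ! (a + b)]"
    using e1 e2 by (simp_all add: n u_def v_def)
  have y: "zx \<delta> ! 0 = y" "zy \<gamma> ! a = y" "zx \<delta>' ! 0 = y"
    using zigzags_endpoints(3)[OF \<delta>(1)] zigzags_endpoints(3)[OF \<delta>(2)] zigzags_endpoints(4)[OF \<gamma>(1)] by (simp_all add: a_def)
  have G: "R (v i @ tl (zg (cat \<gamma>' \<delta>') ! i)) (zg (cat \<gamma> \<delta>) ! i @ tl (u i))" if i: "i \<le> a + b" for i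
  proof -
    consider "i < a" | "i = a" | "i > a" by linarith
    then show ?thesis
    proof cases
      case 1
      then show ?thesis using g1[of i] i by (simp add: n n' u_def v_def)
    next
      case 2
      have d: "zg \<delta> ! 0 \<in> Hom E y (zy \<delta> ! 0)" "zg \<delta>' ! 0 \<in> Hom E y (zy \<delta>' ! 0)"
        using ZZ_arrows(1)[OF \<delta>(1), of 0] ZZ_arrows(1)[OF \<delta>(2), of 0] y by simp_all
      then have q: "zg \<delta> ! 0 \<noteq> []" "zg \<delta>' ! 0 \<noteq> []" "hd (zg \<delta> ! 0) = y" "hd (zg \<delta>' ! 0) = y"
        by (auto simp: mem_Hom)
      have c: "zg \<gamma>' ! a \<noteq> []" using Hom_nonempty[OF ZZ_arrows(1)[OF \<gamma>(2), of a]] a' by simp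
      have r1: "R (v1 a @ tl (zg \<gamma>' ! a)) (zg \<gamma> ! a)" using g1[of a] e1 by simp
      have r2: "R (zg \<delta>' ! 0) (zg \<delta> ! 0 @ tl (u2 0))"
        using g2[of 0] e2(1) Hom_cons_tl[OF d(2)] y by simp
      have "R ((v1 a @ tl (zg \<gamma>' ! a)) @ tl (zg \<delta>' ! 0)) (zg \<gamma> ! a @ tl (zg \<delta> ! 0 @ tl (u2 0)))"
        by (rule R[OF r1 r2]) (use q in simp_all)
      then show ?thesis
        using 2 i q c by (simp add: n n' u_def v_def)
    next
      case 3
      then show ?thesis using g2[of "i - a"] i by (simp add: n n' u_def v_def)
    qed
  qed
  have F: "R (v (i + 1) @ tl (zf (cat \<gamma>' \<delta>') ! i)) (zf (cat \<gamma> \<delta>) ! i @ tl (u i))" if i: "i < a + b" for i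
  proof (cases "i < a")
    case True
    then show ?thesis using f1[of i] by (simp add: n n' u_def v_def)
  next
    case False
    then show ?thesis using f2[of "i - a"] i by (simp add: n n' u_def v_def Suc_diff_le)
  qed
  have "ladder E \<Sigma> R (cat \<gamma> \<delta>) (cat \<gamma>' \<delta>') \<longleftrightarrow>
     (\<exists>u v. (\<forall>i\<le>a + b. u i \<in> \<Sigma> (zy (cat \<gamma> \<delta>) ! i) (zy (cat \<gamma>' \<delta>') ! i) \<and> v i \<in> \<Sigma> (zx (cat \<gamma> \<delta>) ! i) (zx (cat \<gamma>' \<delta>') ! i)) \<and>
        v 0 = [zx (cat \<gamma> \<delta>) ! 0] \<and> u (a + b) = [zy (cat \<gamma> \<delta>) ! (a + b)] \<and>
        (\<forall>i\<le>a + b. R (v i @ tl (zg (cat \<gamma>' \<delta>') ! i)) (zg (cat \<gamma> \<delta>) ! i @ tl (u i))) \<and>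
        (\<forall>i<a + b. R (v (i + 1) @ tl (zf (cat \<gamma>' \<delta>') ! i)) (zf (cat \<gamma> \<delta>) ! i @ tl (u i))))"
    unfolding ladder_def Let_def n(5) n'(5) Ent_simps by simp
  then show ?thesis
    using uS vS v0 uk G F by blast
qed


section \<open>The equivalence of zigzags as a congruence\<close>

definition eqv :: "('a set, 'a set list) zigzag \<Rightarrow> ('a set, 'a set list) zigzag \<Rightarrow> bool" where
  "eqv \<gamma> \<delta> \<longleftrightarrow> (\<gamma>, \<delta>) \<in> zigzag_equiv E \<Sigma>"

lemma eqv_refl [simp]: "eqv \<gamma> \<gamma>"
  by (simp add: eqv_def zigzag_equiv_def)

lemma eqv_trans [trans]: "eqv \<gamma> \<delta> \<Longrightarrow> eqv \<delta> \<epsilon> \<Longrightarrow> eqv \<gamma> \<epsilon>"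
  unfolding eqv_def zigzag_equiv_def by (rule rtrancl_trans)

lemma eqv_sym: "eqv \<gamma> \<delta> \<Longrightarrow> eqv \<delta> \<gamma>"
proof -
  have "sym (zigzag_equiv E \<Sigma>)"
    unfolding zigzag_equiv_def by (rule sym_rtrancl) (auto intro: symI)
  then show "eqv \<gamma> \<delta> \<Longrightarrow> eqv \<delta> \<gamma>" unfolding eqv_def by (rule symD)
qed

lemma step_eqv: "(\<gamma>, \<delta>) \<in> zigzag_step E \<Sigma> \<Longrightarrow> eqv \<gamma> \<delta>"
  unfolding eqv_def zigzag_equiv_def by blast

lemma eqv_induct [consumes 2, case_names base step]:
  assumes "eqv \<gamma> \<delta>" "\<gamma> \<in> ZZ w z"
    and "P \<gamma>"
    and "\<And>\<alpha> \<beta>. \<lbrakk>\<alpha> \<in> ZZ w z; \<beta> \<in> ZZ w z; (\<alpha>, \<beta>) \<in> zigzag_step E \<Sigma> \<or> (\<beta>, \<alpha>) \<in> zigzag_step E \<Sigma>; P \<alpha>\<rbrakk> \<Longrightarrow> P \<beta>"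
  shows "P \<delta> \<and> \<delta> \<in> ZZ w z"
  using assms(1) unfolding eqv_def zigzag_equiv_def
proof (induction rule: rtrancl_induct)
  case base
  then show ?case using assms(2,3) by simp
next
  case (step \<alpha> \<beta>)
  then have s: "(\<alpha>, \<beta>) \<in> zigzag_step E \<Sigma> \<or> (\<beta>, \<alpha>) \<in> zigzag_step E \<Sigma>" by blast
  then obtain w' z' where "\<alpha> \<in> ZZ w' z'" "\<beta> \<in> ZZ w' z'"
    unfolding zigzag_step_def by blast
  then have "\<beta> \<in> ZZ w z" using step.IH ZZ_unique by blast
  then show ?case using assms(4)[of \<alpha> \<beta>] s step.IH by blast
qed

lemma eqv_closed: "eqv \<gamma> \<delta> \<Longrightarrow> \<gamma> \<in> ZZ w z \<Longrightarrow> \<delta> \<in> ZZ w z"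
  using eqv_induct[of \<gamma> \<delta> w z "\<lambda>_. True"] by blast

lemma horizontal_eqv:
  assumes "\<alpha> \<in> ZZ w y" "\<beta> \<in> ZZ y z"
  shows "eqv (cat \<alpha> (zcons y y [y] [y] \<beta>)) (cat \<alpha> \<beta>)"
proof (rule step_eqv)
  have "y \<in> K" using zigzags_endpoints(1)[OF assms(2)] by simp
  then have "zcons y y [y] [y] \<beta> \<in> ZZ y z"
    using assms(2) by (auto simp: zcons_in_zigzags mem_\<Sigma> singleton_Hom)
  then show "(cat \<alpha> (zcons y y [y] [y] \<beta>), cat \<alpha> \<beta>) \<in> zigzag_step E \<Sigma>"
    unfolding zigzag_step_def using cat_closed[OF assms(1)] assms(2) horizontal_intro[OF assms] by blast
qed

lemma ladder_eqv: "\<gamma> \<in> ZZ w z \<Longrightarrow> \<delta> \<in> ZZ w z \<Longrightarrow> ladder E \<Sigma> (=) \<gamma> \<delta> \<Longrightarrow> eqv \<gamma> \<delta>"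
  by (rule step_eqv) (auto simp: zigzag_step_def)

lemma step_cat_right:
  assumes "(\<gamma>, \<gamma>') \<in> zigzag_step E \<Sigma>" "\<gamma> \<in> ZZ w y" "\<gamma>' \<in> ZZ w y" "\<delta> \<in> ZZ y z"
  shows "eqv (cat \<gamma> \<delta>) (cat \<gamma>' \<delta>)"
proof -
  consider "horizontal_step E \<gamma> \<gamma>'" | "ladder E \<Sigma> (=) \<gamma> \<gamma>'"
    using assms(1) by (auto simp: zigzag_step_def)
  then show ?thesis
  proof cases
    case 1
    then obtain \<alpha> \<beta> x where h: "\<alpha> \<in> ZZ w x" "\<beta> \<in> ZZ x y" "\<gamma> = cat \<alpha> (zcons x x [x] [x] \<beta>)" "\<gamma>' = cat \<alpha> \<beta>"
      using horizontal_elim assms(2) by blast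
    have x: "x \<in> K" using zigzags_endpoints(1)[OF h(2)] by simp
    then have "zcons x x [x] [x] \<beta> \<in> ZZ x y"
      using h(2) by (auto simp: zcons_in_zigzags mem_\<Sigma> singleton_Hom)
    then have "cat \<gamma> \<delta> = cat \<alpha> (zcons x x [x] [x] (cat \<beta> \<delta>))" "cat \<gamma>' \<delta> = cat \<alpha> (cat \<beta> \<delta>)"
      using cat_assoc[OF h(1) _ assms(4)] h concat_zcons[OF h(2)] by simp_all
    then show ?thesis using horizontal_eqv[OF h(1) cat_closed[OF h(2) assms(4)]] by simp
  next
    case 2
    have "ladder E \<Sigma> (=) (cat \<gamma> \<delta>) (cat \<gamma>' \<delta>)"
      by (rule ladder_cat[OF assms(2,3,4,4) 2 ladder_refl[OF assms(4)]]) auto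
    then show ?thesis
      using ladder_eqv[OF cat_closed[OF assms(2,4)] cat_closed[OF assms(3,4)]] by blast
  qed
qed

lemma step_cat_left:
  assumes "(\<delta>, \<delta>') \<in> zigzag_step E \<Sigma>" "\<gamma> \<in> ZZ w y" "\<delta> \<in> ZZ y z" "\<delta>' \<in> ZZ y z"
  shows "eqv (cat \<gamma> \<delta>) (cat \<gamma> \<delta>')"
proof -
  consider "horizontal_step E \<delta> \<delta>'" | "ladder E \<Sigma> (=) \<delta> \<delta>'"
    using assms(1) by (auto simp: zigzag_step_def)
  then show ?thesis
  proof cases
    case 1
    then obtain \<alpha> \<beta> x where h: "\<alpha> \<in> ZZ y x" "\<beta> \<in> ZZ x z" "\<delta> = cat \<alpha> (zcons x x [x] [x] \<beta>)" "\<delta>' = cat \<alpha> \<beta>"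
      using horizontal_elim assms(3) by blast
    have x: "x \<in> K" using zigzags_endpoints(1)[OF h(2)] by simp
    then have "zcons x x [x] [x] \<beta> \<in> ZZ x z"
      using h(2) by (auto simp: zcons_in_zigzags mem_\<Sigma> singleton_Hom)
    then have "cat \<gamma> \<delta> = cat (cat \<gamma> \<alpha>) (zcons x x [x] [x] \<beta>)" "cat \<gamma> \<delta>' = cat (cat \<gamma> \<alpha>) \<beta>"
      using cat_assoc[OF assms(2) h(1)] h by simp_all
    then show ?thesis using horizontal_eqv[OF cat_closed[OF assms(2) h(1)] h(2)] by simp
  next
    case 2
    have "ladder E \<Sigma> (=) (cat \<gamma> \<delta>) (cat \<gamma> \<delta>')"
      by (rule ladder_cat[OF assms(2,2,3,4) ladder_refl[OF assms(2)] 2]) auto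
    then show ?thesis
      using ladder_eqv[OF cat_closed[OF assms(2,3)] cat_closed[OF assms(2,4)]] by blast
  qed
qed

lemma eqv_cat:
  assumes "eqv \<gamma> \<gamma>'" "eqv \<delta> \<delta>'" "\<gamma> \<in> ZZ w y" "\<delta> \<in> ZZ y z"
  shows "eqv (cat \<gamma> \<delta>) (cat \<gamma>' \<delta>')"
proof -
  have "eqv (cat \<gamma> \<delta>) (cat \<gamma>' \<delta>) \<and> \<gamma>' \<in> ZZ w y"
    using assms(1,3)
  proof (induction rule: eqv_induct)
    case (step \<alpha> \<beta>)
    have "eqv (cat \<alpha> \<delta>) (cat \<beta> \<delta>)"
      using step(3) step_cat_right[OF _ step(1,2) assms(4)]
        eqv_sym[OF step_cat_right[OF _ step(2,1) assms(4)]] by blast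
    with step(4) show ?case by (rule eqv_trans)
  qed simp
  moreover have "eqv (cat \<gamma>' \<delta>) (cat \<gamma>' \<delta>') \<and> \<delta>' \<in> ZZ y z" if "\<gamma>' \<in> ZZ w y"
    using assms(2,4)
  proof (induction rule: eqv_induct)
    case (step \<alpha> \<beta>)
    have "eqv (cat \<gamma>' \<alpha>) (cat \<gamma>' \<beta>)"
      using step(3) step_cat_left[OF _ that step(1,2)]
        eqv_sym[OF step_cat_left[OF _ that step(2,1)]] by blast
    with step(4) show ?case by (rule eqv_trans)
  qed simp
  ultimately show ?thesis using eqv_trans by blast
qed

subsection \<open>Normal forms classify morphisms\<close>

text \<open>The legs of a ladder are invisible to \<open>nfp\<close>, so a relation between the
  composites around a square passes to its two arrows. Equality yields invariance of
  \<open>nf\<close>; \<open>subseq\<close> yields refinement.\<close>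

lemma ladder_nfp:
  assumes "ladder E \<Sigma> R \<gamma> \<gamma>'" "\<gamma> \<in> ZZ w z" "\<gamma>' \<in> ZZ w z"
    and R: "\<And>x y s s'. \<lbrakk>R s' s; s \<in> Hom E x y; s' \<in> Hom E x y\<rbrakk> \<Longrightarrow> Q (nfp s') (nfp s)"
  shows "list_all2 Q (map nfp (zg \<gamma>')) (map nfp (zg \<gamma>))"
proof -
  define k where "k = length (zf \<gamma>)"
  obtain u v where k': "length (zf \<gamma>') = k"
    and u: "\<And>i. i \<le> k \<Longrightarrow> u i \<in> \<Sigma> (zy \<gamma> ! i) (zy \<gamma>' ! i)" and v: "\<And>i. i \<le> k \<Longrightarrow> v i \<in> \<Sigma> (zx \<gamma> ! i) (zx \<gamma>' ! i)"
    and g: "\<And>i. i \<le> k \<Longrightarrow> R (v i @ tl (zg \<gamma>' ! i)) (zg \<gamma> ! i @ tl (u i))"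
    using assms(1) unfolding ladder_def Let_def k_def[symmetric] Ent_simps by blast
  have "Q (nfp (zg \<gamma>' ! i)) (nfp (zg \<gamma> ! i))" if i: "i \<le> k" for i
  proof -
    have h: "zg \<gamma> ! i \<in> Hom E (zx \<gamma> ! i) (zy \<gamma> ! i)" "zg \<gamma>' ! i \<in> Hom E (zx \<gamma>' ! i) (zy \<gamma>' ! i)"
      and uv: "v i \<in> Hom E (zx \<gamma> ! i) (zx \<gamma>' ! i)" "u i \<in> Hom E (zy \<gamma> ! i) (zy \<gamma>' ! i)"
      using ZZ_arrows[OF assms(2), of i] ZZ_arrows[OF assms(3), of i] i k' u v \<Sigma>_Hom by (simp_all add: k_def)
    have "Q (nfp (v i @ tl (zg \<gamma>' ! i))) (nfp (zg \<gamma> ! i @ tl (u i)))"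
      by (rule R[OF g[OF i] comp_Hom[OF h(1) uv(2)] comp_Hom[OF uv(1) h(2)]])
    then show ?thesis
      using nfp_comp[OF h(1) uv(2)] nfp_comp[OF uv(1) h(2)] nfp_\<Sigma>[OF u[OF i]] nfp_\<Sigma>[OF v[OF i]] by simp
  qed
  then show ?thesis
    using zigzags_lengths(3)[OF assms(2)] zigzags_lengths(3)[OF assms(3)] k'
    by (simp add: list_all2_conv_all_nth k_def)
qed

lemma nf_step:
  assumes "(\<gamma>, \<gamma>') \<in> zigzag_step E \<Sigma>"
  shows "nf \<gamma> = nf \<gamma>'"
proof -
  obtain w z where z: "\<gamma> \<in> ZZ w z" "\<gamma>' \<in> ZZ w z" "horizontal_step E \<gamma> \<gamma>' \<or> ladder E \<Sigma> (=) \<gamma> \<gamma>'"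
    using assms unfolding zigzag_step_def by blast
  from z(3) show ?thesis
  proof
    assume "horizontal_step E \<gamma> \<gamma>'"
    then obtain \<alpha> \<beta> y where h: "\<alpha> \<in> ZZ w y" "\<beta> \<in> ZZ y z" "\<gamma> = cat \<alpha> (zcons y y [y] [y] \<beta>)" "\<gamma>' = cat \<alpha> \<beta>"
      using horizontal_elim z(1) by blast
    have "y \<in> K" using zigzags_endpoints(1)[OF h(2)] by simp
    then have "zcons y y [y] [y] \<beta> \<in> ZZ y z"
      using h(2) by (auto simp: zcons_in_zigzags mem_\<Sigma> singleton_Hom)
    then show ?thesis using h by (simp add: nf_cat)
  next
    assume "ladder E \<Sigma> (=) \<gamma> \<gamma>'"
    then have "list_all2 (=) (map nfp (zg \<gamma>')) (map nfp (zg \<gamma>))"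
      by (rule ladder_nfp[OF _ z(1,2)]) simp
    then show ?thesis by (simp add: nf_def list.rel_eq)
  qed
qed

lemma nf_eqv: "eqv \<gamma> \<delta> \<Longrightarrow> \<gamma> \<in> ZZ w z \<Longrightarrow> nf \<gamma> = nf \<delta>"
  using eqv_induct[of \<gamma> \<delta> w z "\<lambda>\<delta>. nf \<gamma> = nf \<delta>"] nf_step by metis

text \<open>The canonical isomorphism between cells with \<open>same w a\<close>. The first branch
  goes down along the pair; the other two read an arrow \<open>a \<rightarrow> w\<close> of \<Sigma>
  with identities backwards.\<close>

definition tau :: "'a set \<Rightarrow> 'a set \<Rightarrow> ('a set, 'a set list) zigzag" where
  "tau w a =
    (if rp a w then zcons w a [w, a] [a] (zz1 a a [a])
     else if rp w a then zcons w w [w] [a, w] (zz1 a a [a])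
     else zcons w w [w] [a] (zz1 a a [a]))"

lemma rp_asym: "rp x y \<Longrightarrow> \<not> rp y x"
  using no_chain by blast

lemma rp_irrefl: "\<not> rp x x"
  using no_chain by blast

lemma tau_closed:
  assumes "same w a" "w \<in> K" "a \<in> K"
  shows "tau w a \<in> ZZ w a"
  using assms rp_cells
  by (auto simp: tau_def same_def zcons_in_zigzags mem_\<Sigma> singleton_Hom Cons_Hom)

lemma nf_tau: "nf (tau w a) = []"
  by (simp add: tau_def)

lemma tau_refl: "w \<in> K \<Longrightarrow> eqv (tau w w) (zz1 w w [w])"
  using horizontal_eqv[of "zz1 w w [w]" w w "zz1 w w [w]" w] rp_asym[of w w]
  by (auto simp: tau_def singleton_Hom concat_zz1_zz1 concat_zz1_zcons)

lemma tau_down: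
  assumes "rp x y"
  shows "eqv (zz1 y x [y, x]) (tau y x)"
proof -
  have c: "x \<in> K" "y \<in> K" "cell_less X x y" using rp_cells[OF assms] by auto
  have "eqv (cat (zz1 y x [y, x]) (zcons x x [x] [x] (zz1 x x [x]))) (cat (zz1 y x [y, x]) (zz1 x x [x]))"
    by (rule horizontal_eqv) (use c in \<open>simp_all add: singleton_Hom Cons_Hom\<close>)
  then show ?thesis
    using assms eqv_sym by (simp add: tau_def concat_zz1_zz1 concat_zz1_zcons)
qed

lemma tau_up_down:
  assumes "rp x y"
  shows "eqv (cat (tau x y) (tau y x)) (zz1 x x [x])"
proof -
  have c: "x \<in> K" "y \<in> K" "cell_less X x y" "x \<noteq> y" using rp_cells[OF assms] by (auto simp: cell_less_def)
  have s: "same x y" "same y x" using assms by (auto simp: same_def)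
  let ?i = "zz1 x x [x]"
  let ?\<gamma> = "zcons x x [x] [y, x] (zz1 y x [y, x])"
  have t: "tau x y \<in> ZZ x y" "tau y x \<in> ZZ y x" by (rule tau_closed; use c s in simp)+
  have "eqv (cat (tau x y) (tau y x)) (cat (tau x y) (zz1 y x [y, x]))"
    by (rule eqv_cat[OF eqv_refl eqv_sym[OF tau_down[OF assms]] t])
  also have "cat (tau x y) (zz1 y x [y, x]) = ?\<gamma>"
    using assms rp_asym[OF assms] c
    by (simp add: tau_def concat_zcons[of "zz1 y y [y]" E \<Sigma> y y] singleton_Hom concat_zz1_zz1)
  also have "eqv ?\<gamma> (zcons x x [x] [x] ?i)"
  proof (rule ladder_eqv)
    show "?\<gamma> \<in> ZZ x x" "zcons x x [x] [x] ?i \<in> ZZ x x"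
      using c assms by (auto simp: zcons_in_zigzags mem_\<Sigma> singleton_Hom Cons_Hom)
    \<comment> \<open>The leg \<open>v_1 = (y > x)\<close> collapses the inner source
      \<open>y\<close> onto \<open>x\<close>; all other legs are identities.\<close>
    show "ladder E \<Sigma> (=) ?\<gamma> (zcons x x [x] [x] ?i)"
      unfolding ladder_def Let_def
      by (rule conjI, simp add: zcons_def, rule exI[of _ "\<lambda>_. [x]"], rule exI[of _ "\<lambda>i. if i = 0 then [x] else [y, x]"])
        (use assms in \<open>auto simp: zcons_def mem_\<Sigma> le_Suc_eq\<close>)
  qed
  also have "eqv (zcons x x [x] [x] ?i) ?i"
    using tau_refl[OF c(1)] by (simp add: tau_def rp_irrefl)
  finally show ?thesis .
qed

lemma tau_down_up:
  assumes "rp x y"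
  shows "eqv (cat (tau y x) (tau x y)) (zz1 y y [y])"
proof -
  have c: "x \<in> K" "y \<in> K" "cell_less X x y" "x \<noteq> y" using rp_cells[OF assms] by (auto simp: cell_less_def)
  have s: "same x y" "same y x" using assms by (auto simp: same_def)
  let ?i = "zz1 y y [y]"
  let ?\<gamma> = "zcons y x [y, x] [y, x] ?i"
  have t: "tau x y \<in> ZZ x y" "tau y x \<in> ZZ y x" by (rule tau_closed; use c s in simp)+
  have "eqv (cat (tau y x) (tau x y)) (cat (zz1 y x [y, x]) (tau x y))"
    by (rule eqv_cat[OF eqv_sym[OF tau_down[OF assms]] eqv_refl t(2,1)])
  also have "cat (zz1 y x [y, x]) (tau x y) = ?\<gamma>"
    using assms rp_asym[OF assms] by (simp add: tau_def concat_zz1_zcons)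
  also have "eqv ?\<gamma> (zcons y y [y] [y] ?i)"
  proof (rule eqv_sym, rule ladder_eqv)
    show "?\<gamma> \<in> ZZ y y" "zcons y y [y] [y] ?i \<in> ZZ y y"
      using c assms by (auto simp: zcons_in_zigzags mem_\<Sigma> singleton_Hom Cons_Hom)
    \<comment> \<open>Here the ladder starts at the constant zigzag, and its only nontrivial leg
      \<open>u_0 = (y > x)\<close> pushes the inner target down to \<open>x\<close>.\<close>
    show "ladder E \<Sigma> (=) (zcons y y [y] [y] ?i) ?\<gamma>"
      unfolding ladder_def Let_def
      by (rule conjI, simp add: zcons_def, rule exI[of _ "\<lambda>i. if i = 0 then [y, x] else [y]"], rule exI[of _ "\<lambda>_. [y]"])
        (use assms in \<open>auto simp: zcons_def mem_\<Sigma> le_Suc_eq\<close>)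
  qed
  also have "eqv (zcons y y [y] [y] ?i) ?i"
    using tau_refl[OF c(2)] by (simp add: tau_def rp_irrefl)
  finally show ?thesis .
qed

text \<open>Classes of \<open>same\<close> have at most two cells, so \<open>w\<close>,
  \<open>a\<close>, \<open>b\<close> cannot be distinct, and only units and mutual inverses have to
  be checked.\<close>

lemma tau_tau:
  assumes "same w a" "same a b" "w \<in> K" "a \<in> K" "b \<in> K"
  shows "eqv (cat (tau w a) (tau a b)) (tau w b)"
proof -
  have t: "tau w a \<in> ZZ w a" "tau a b \<in> ZZ a b" "tau w w \<in> ZZ w w" "tau b b \<in> ZZ b b"
    using tau_closed assms by simp_all
  have i: "zz1 w w [w] \<in> ZZ w w" using assms by (simp add: singleton_Hom)
  consider "w = a" | "a = b" | "w = b" "rp w a" | "w = b" "rp a w"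
    using assms(1,2) up_unique down_unique no_chain unfolding same_def by metis
  then show ?thesis
  proof cases
    case 1
    have "eqv (cat (tau a a) (tau a b)) (cat (zz1 a a [a]) (tau a b))"
      by (rule eqv_cat[OF tau_refl eqv_refl]) (use t assms 1 in auto)
    then show ?thesis using 1 cat_unit_left[OF t(2)] by simp
  next
    case 2
    have "eqv (cat (tau w b) (tau b b)) (cat (tau w b) (zz1 b b [b]))"
      by (rule eqv_cat[OF eqv_refl tau_refl]) (use t assms 2 in auto)
    then show ?thesis using 2 cat_unit_right t(1) by simp
  next
    case 3
    then show ?thesis using tau_up_down[of w a] tau_refl[of w] assms eqv_sym eqv_trans by blast
  next
    case 4
    then show ?thesis using tau_down_up[of a w] tau_refl[of w] assms eqv_sym eqv_trans by blast
  qed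
qed

text \<open>Strings the given paths together, bridging the gap before each of them by
  \<open>tau\<close>. Single edges give the canonical representative of a normal form, longer
  fillings give a representative of a refinement with the same number of columns.\<close>

fun build :: "'a set \<Rightarrow> 'a set list list \<Rightarrow> 'a set \<Rightarrow> ('a set, 'a set list) zigzag" where
  "build w [] z = tau w z"
| "build w (s # ss) z =
    cat (cat (tau w (hd s)) (zz1 (hd s) (last s) s)) (build (last s) ss z)"

lemma build_closed:
  assumes "linked w es z" "fills es ss" "w \<in> K" "z \<in> K"
  shows "build w ss z \<in> ZZ w z" "nf (build w ss z) = concat (map nfp ss)"
proof -
  have "build w ss z \<in> ZZ w z \<and> nf (build w ss z) = concat (map nfp ss)"
    using assms
  proof (induction w es z arbitrary: ss rule: linked.induct)
    case (1 w z)
    then show ?case by (simp add: tau_closed nf_tau)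
  next
    case (2 w a c es z)
    then obtain s ss' where s: "ss = s # ss'" "s \<in> Hom E a c" "fills es ss'"
      by (auto simp: fills_Cons)
    have e: "hd s = a" "last s = c" using s(2) by (auto simp: mem_Hom)
    have t: "tau w a \<in> ZZ w a" "zz1 a c s \<in> ZZ a c" using 2 s tau_closed[of w a] by simp_all
    have b: "build c ss' z \<in> ZZ c z" "nf (build c ss' z) = concat (map nfp ss')"
      using 2 s by simp_all
    show ?case
      using cat_closed[OF cat_closed[OF t] b(1)] nf_cat[OF cat_closed[OF t] b(1)] nf_cat[OF t] b(2)
      by (simp add: s(1) e nf_tau)
  qed
  then show "build w ss z \<in> ZZ w z" "nf (build w ss z) = concat (map nfp ss)" by auto
qed

abbreviation edges :: "('a set \<times> 'a set) list \<Rightarrow> 'a set list list" where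
  "edges es \<equiv> map (\<lambda>(a, c). [a, c]) es"

lemma fills_edges: "linked w es z \<Longrightarrow> fills es (edges es)"
  by (induction w es z rule: linked.induct) (simp_all add: fills_Cons Cons_Hom singleton_Hom)

lemma nf_edges: "linked w es z \<Longrightarrow> concat (map nfp (edges es)) = es"
  by (induction w es z rule: linked.induct) simp_all

abbreviation can :: "'a set \<Rightarrow> ('a set \<times> 'a set) list \<Rightarrow> 'a set \<Rightarrow> ('a set, 'a set list) zigzag" where
  "can w es z \<equiv> build w (edges es) z"

lemma can_closed:
  assumes "linked w es z" "w \<in> K" "z \<in> K"
  shows "can w es z \<in> ZZ w z" "nf (can w es z) = es"
  using build_closed[OF assms(1) fills_edges[OF assms(1)] assms(2,3)] nf_edges[OF assms(1)] by simp_all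

lemma tau_can:
  assumes "same w' w" "linked w es z" "w' \<in> K" "w \<in> K" "z \<in> K"
  shows "eqv (cat (tau w' w) (can w es z)) (can w' es z)"
proof (cases es)
  case Nil
  then show ?thesis using tau_tau[of w' w z] assms by simp
next
  case (Cons e es')
  obtain a c where e: "e = (a, c)" by fastforce
  have p: "same w a" "a \<in> K" "c \<in> K" "cell_less X c a" "linked c es' z" using assms(2) Cons e by auto
  have t: "tau w' w \<in> ZZ w' w" "tau w a \<in> ZZ w a" "zz1 a c [a, c] \<in> ZZ a c" "can c es' z \<in> ZZ c z"
    using tau_closed[of w' w] tau_closed[of w a] can_closed[OF p(5)] assms p by (simp_all add: Cons_Hom singleton_Hom)
  have "cat (tau w' w) (can w es z) = cat (cat (tau w' w) (tau w a)) (cat (zz1 a c [a, c]) (can c es' z))"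
    using cat_assoc[OF t(1) cat_closed[OF t(2,3)] t(4)] cat_assoc[OF t(2,3,4)]
      cat_assoc[OF t(1,2) cat_closed[OF t(3,4)]] cat_assoc[OF t(1,2,3)] cat_assoc[OF cat_closed[OF t(1,2)] t(3,4)]
    by (simp add: Cons e)
  also have "eqv \<dots> (cat (tau w' a) (cat (zz1 a c [a, c]) (can c es' z)))"
    by (rule eqv_cat[OF tau_tau eqv_refl cat_closed[OF t(1,2)] cat_closed[OF t(3,4)]])
      (use assms p in simp_all)
  also have "cat (tau w' a) (cat (zz1 a c [a, c]) (can c es' z)) = can w' es z"
    using cat_assoc[OF _ t(3,4), of "tau w' a" w'] tau_closed[of w' a] same_trans[OF assms(1) p(1)] assms p
    by (simp add: Cons e)
  finally show ?thesis .
qed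

text \<open>The path \<open>g\<close> is absorbed from its far end. A step in \<Sigma> is a
  \<open>tau\<close> and merges into the next gap by \<open>tau_can\<close>; any other step becomes
  a new edge, preceded by the trivial \<open>tau w w\<close>.\<close>

lemma arrow_can:
  assumes "g \<in> Hom E w x" "linked x es z" "z \<in> K"
  shows "eqv (cat (zz1 w x g) (can x es z)) (can w (nfp g @ es) z)"
  using assms(1)
proof (induction rule: Hom_induct)
  case single
  then show ?case using cat_unit_left[OF can_closed(1)[OF assms(2) single assms(3)]] by simp
next
  case (cons w b t)
  let ?es = "nfp (b # t) @ es"
  have x: "x \<in> K" using Hom_ends[OF cons.hyps(4)] by simp
  have p: "linked b ?es z" using linked_append[OF linked_nfp[OF cons.hyps(4)] assms(2)] .
  have h: "zz1 w b [w, b] \<in> ZZ w b" "zz1 b x (b # t) \<in> ZZ b x" "can x es z \<in> ZZ x z" "can b ?es z \<in> ZZ b z"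
    using cons.hyps x can_closed(1)[OF assms(2) x assms(3)] can_closed(1)[OF p cons.hyps(2) assms(3)]
    by (simp_all add: Cons_Hom singleton_Hom)
  have "zz1 w x (w # b # t) = cat (zz1 w b [w, b]) (zz1 b x (b # t))"
    by (simp add: concat_zz1_zz1)
  then have "cat (zz1 w x (w # b # t)) (can x es z) = cat (zz1 w b [w, b]) (cat (zz1 b x (b # t)) (can x es z))"
    using cat_assoc[OF h(1-3)] by simp
  also have "eqv \<dots> (cat (zz1 w b [w, b]) (can b ?es z))"
    by (rule eqv_cat[OF eqv_refl cons.IH h(1) cat_closed[OF h(2,3)]])
  also have "eqv (cat (zz1 w b [w, b]) (can b ?es z)) (can w (nfp (w # b # t) @ es) z)"
  proof (cases "rp b w")
    case True
    then have "same w b" by (simp add: same_def)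
    have "eqv (cat (zz1 w b [w, b]) (can b ?es z)) (cat (tau w b) (can b ?es z))"
      by (rule eqv_cat[OF tau_down[OF True] eqv_refl h(1,4)])
    also have "eqv (cat (tau w b) (can b ?es z)) (can w ?es z)"
      by (rule tau_can[OF \<open>same w b\<close> p cons.hyps(1,2) assms(3)])
    finally show ?thesis using True by simp
  next
    case False
    have w: "zz1 w w [w] \<in> ZZ w w" "tau w w \<in> ZZ w w"
      using cons.hyps(1) tau_closed[of w w] by (simp_all add: singleton_Hom)
    have "cat (zz1 w b [w, b]) (can b ?es z) = cat (cat (zz1 w w [w]) (zz1 w b [w, b])) (can b ?es z)"
      using cat_unit_left[OF h(1)] by simp
    also have "eqv \<dots> (cat (cat (tau w w) (zz1 w b [w, b])) (can b ?es z))"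
      by (rule eqv_cat[OF eqv_cat[OF eqv_sym[OF tau_refl[OF cons.hyps(1)]] eqv_refl w(1) h(1)] eqv_refl
          cat_closed[OF w(1) h(1)] h(4)])
    also have "\<dots> = can w (nfp (w # b # t) @ es) z"
      using False by simp
    finally show ?thesis .
  qed
  finally show ?case .
qed

text \<open>Every backward arrow of the zigzag is a \<open>tau\<close>, so the zigzag is absorbed
  into canonical form from right to left by \<open>tau_can\<close> and \<open>arrow_can\<close>.
  Hence equal normal forms imply equivalence.\<close>

lemma eqv_can: "\<gamma> \<in> ZZ w z \<Longrightarrow> eqv \<gamma> (can w (nf \<gamma>) z)"
proof (induction rule: zigzag_induct)
  case (single w g)
  then have g: "zz1 w z g \<in> ZZ w z" "z \<in> K" "zz1 z z [z] \<in> ZZ z z" by (simp_all add: singleton_Hom)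
  have "zz1 w z g = cat (zz1 w z g) (zz1 z z [z])"
    using cat_unit_right[OF g(1)] by simp
  also have "eqv \<dots> (cat (zz1 w z g) (can z [] z))"
    using eqv_cat[OF eqv_refl eqv_sym[OF tau_refl[OF g(2)]] g(1,3)] by simp
  also have "eqv \<dots> (can w (nfp g @ []) z)"
    by (rule arrow_can) (use single in simp_all)
  finally show ?case by simp
next
  case (cons w y g h x \<delta>)
  have z: "x \<in> K" "z \<in> K" using zigzags_endpoints(1,2)[OF cons.hyps(5)] by simp_all
  have yx: "same y x" using same_sym[OF \<Sigma>_same[OF cons.hyps(4)]] .
  have p: "linked x (nf \<delta>) z" "linked y (nf \<delta>) z"
    using linked_nf[OF cons.hyps(5)] linked_same[OF yx] by blast+
  have t: "zz1 w y g \<in> ZZ w y" "tau y x \<in> ZZ y x" using cons.hyps yx z tau_closed by simp_all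
  have tau: "tau y x = zcons y y [y] h (zz1 x x [x])"
    using cons.hyps(4) rp_asym by (auto simp: mem_\<Sigma> tau_def)
  have zcons: "zcons w y g h \<delta> = cat (zz1 w y g) (cat (tau y x) \<delta>)"
    unfolding tau using z cat_unit_left[OF cons.hyps(5)]
    by (simp add: concat_zcons[of "zz1 x x [x]" E \<Sigma> x x] singleton_Hom concat_zz1_zcons)
  have "eqv (cat (tau y x) \<delta>) (cat (tau y x) (can x (nf \<delta>) z))"
    by (rule eqv_cat[OF eqv_refl cons.IH t(2) cons.hyps(5)])
  also have "eqv \<dots> (can y (nf \<delta>) z)"
    by (rule tau_can[OF yx p(1)]) (use z cons.hyps in simp_all)
  finally have "eqv (zcons w y g h \<delta>) (cat (zz1 w y g) (can y (nf \<delta>) z))"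
    unfolding zcons by (rule eqv_cat[OF eqv_refl _ t(1) cat_closed[OF t(2) cons.hyps(5)]])
  also have "eqv \<dots> (can w (nfp g @ nf \<delta>) z)"
    by (rule arrow_can[OF cons.hyps(3) p(2) z(2)])
  finally show ?case by simp
qed

lemma eqv_iff_nf:
  assumes "\<gamma> \<in> ZZ w z" "\<delta> \<in> ZZ w z"
  shows "eqv \<gamma> \<delta> \<longleftrightarrow> nf \<gamma> = nf \<delta>"
  using nf_eqv[OF _ assms(1)] eqv_can[OF assms(1)] eqv_can[OF assms(2)] eqv_trans eqv_sym by metis

lemma ladder_refines:
  assumes "ladder E \<Sigma> subseq \<gamma> \<gamma>'" "\<gamma> \<in> ZZ w z" "\<gamma>' \<in> ZZ w z"
  shows "refines (nf \<gamma>') (nf \<gamma>)"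
proof -
  have "list_all2 refines (map nfp (zg \<gamma>')) (map nfp (zg \<gamma>))"
    by (rule ladder_nfp[OF assms]) (rule subseq_refines)
  then show ?thesis
    unfolding nf_def by (induction rule: list_all2_induct) (auto simp: refines_append)
qed

lemma ladder_cat_subseq:
  assumes "\<gamma> \<in> ZZ w y" "\<gamma>' \<in> ZZ w y" "\<delta> \<in> ZZ y z" "\<delta>' \<in> ZZ y z"
    and "ladder E \<Sigma> subseq \<gamma> \<gamma>'" "ladder E \<Sigma> subseq \<delta> \<delta>'"
  shows "ladder E \<Sigma> subseq (cat \<gamma> \<delta>) (cat \<gamma>' \<delta>')"
proof (rule ladder_cat[OF assms])
  fix p p' q q' :: "'a set list"
  assume "subseq p p'" "subseq q q'" "q \<noteq> []" "q' \<noteq> []" "hd q = hd q'"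
  then show "subseq (p @ tl q) (p' @ tl q')"
    by (cases q; cases q') (auto intro: list_emb_append_mono)
qed

text \<open>A filling contains both ends of its edge, and these differ, so the edge is a subsequence
  of it; identity legs suffice. The bridging pieces are the same on both sides.\<close>

lemma ladder_build:
  assumes "linked w es z" "fills es ss" "w \<in> K" "z \<in> K"
  shows "ladder E \<Sigma> subseq (build w ss z) (can w es z)"
  using assms
proof (induction w es z arbitrary: ss rule: linked.induct)
  case (1 w z)
  then show ?case using ladder_refl[OF tau_closed[of w z], of subseq] by simp
next
  case (2 w a c es z)
  then obtain s ss' where s: "ss = s # ss'" "s \<in> Hom E a c" "fills es ss'"
    by (auto simp: fills_Cons)
  have p: "same w a" "a \<in> K" "c \<in> K" "cell_less X c a" "linked c es z" using 2 by simp_all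
  have e: "hd s = a" "last s = c" using s(2) by (auto simp: mem_Hom)
  have t: "tau w a \<in> ZZ w a" "zz1 a c s \<in> ZZ a c" "zz1 a c [a, c] \<in> ZZ a c"
    using tau_closed[OF p(1)] 2(4) p s by (simp_all add: Cons_Hom singleton_Hom)
  have "a \<noteq> c" using p(4) by (auto simp: cell_less_def)
  then obtain b t where bt: "s = a # b # t" "b # t \<in> Hom E b c"
    using Hom_cases[OF s(2)] by blast
  then have "c \<in> set (b # t)"
    using last_in_set[of "b # t"] by (simp add: mem_Hom)
  then have sub: "subseq [a, c] s"
    unfolding bt(1) by (auto simp: subseq_singleton_left)
  have "ladder E \<Sigma> subseq (zz1 a c s) (zz1 a c [a, c])"
    unfolding ladder_def Let_def
    by (rule conjI, simp, rule exI[of _ "\<lambda>_. [c]"], rule exI[of _ "\<lambda>_. [a]"])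
      (use sub in \<open>simp add: mem_\<Sigma>\<close>)
  then have "ladder E \<Sigma> subseq (cat (tau w a) (zz1 a c s)) (cat (tau w a) (zz1 a c [a, c]))"
    by (rule ladder_cat_subseq[OF t(1,1,2,3) ladder_refl[OF t(1) subseq_order.refl]])
  then have "ladder E \<Sigma> subseq (cat (cat (tau w a) (zz1 a c s)) (build c ss' z))
      (cat (cat (tau w a) (zz1 a c [a, c])) (can c es z))"
    by (rule ladder_cat_subseq[OF cat_closed[OF t(1,2)] cat_closed[OF t(1,3)]
          build_closed(1)[OF p(5) s(3) p(3) 2(5)] can_closed(1)[OF p(5,3) 2(5)] _ 2(1)[OF p(5) s(3) p(3) 2(5)]])
  then show ?case by (simp add: s(1) e)
qed

subsection \<open>The discrete flow category\<close>

abbreviation "L \<equiv> Loc E \<Sigma>"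

abbreviation cls :: "('a set, 'a set list) zigzag \<Rightarrow> ('a set, 'a set list) zigzag set" where
  "cls \<gamma> \<equiv> zigzag_equiv E \<Sigma> `` {\<gamma>}"

definition nfc :: "('a set, 'a set list) zigzag set \<Rightarrow> ('a set \<times> 'a set) list" where
  "nfc H = nf (SOME \<gamma>. \<gamma> \<in> H)"

lemma mem_cls: "\<delta> \<in> cls \<gamma> \<longleftrightarrow> eqv \<gamma> \<delta>"
  by (simp add: eqv_def)

lemma cls_eq_iff: "cls \<gamma> = cls \<delta> \<longleftrightarrow> eqv \<gamma> \<delta>"
proof
  assume "cls \<gamma> = cls \<delta>"
  then have "\<delta> \<in> cls \<gamma>" using mem_cls eqv_refl by blast
  then show "eqv \<gamma> \<delta>" by (simp only: mem_cls)
next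
  assume "eqv \<gamma> \<delta>"
  then have "eqv \<gamma> \<epsilon> \<longleftrightarrow> eqv \<delta> \<epsilon>" for \<epsilon> using eqv_trans eqv_sym by blast
  then show "cls \<gamma> = cls \<delta>" unfolding set_eq_iff mem_cls by blast
qed

lemma cls_eq_iff_nf: "\<gamma> \<in> ZZ w z \<Longrightarrow> \<delta> \<in> ZZ w z \<Longrightarrow> cls \<gamma> = cls \<delta> \<longleftrightarrow> nf \<gamma> = nf \<delta>"
  by (simp only: cls_eq_iff eqv_iff_nf)

lemma nfc_cls: "\<gamma> \<in> ZZ w z \<Longrightarrow> nfc (cls \<gamma>) = nf \<gamma>"
proof -
  assume "\<gamma> \<in> ZZ w z"
  have "\<gamma> \<in> cls \<gamma>" by (simp only: mem_cls eqv_refl)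
  then have "(SOME \<delta>. \<delta> \<in> cls \<gamma>) \<in> cls \<gamma>" by (rule someI)
  then have "eqv \<gamma> (SOME \<delta>. \<delta> \<in> cls \<gamma>)" by (simp only: mem_cls)
  from nf_eqv[OF this \<open>\<gamma> \<in> ZZ w z\<close>] show ?thesis by (simp only: nfc_def)
qed

lemma Hom_L: "H \<in> Hom L w z \<longleftrightarrow> (\<exists>\<gamma>\<in>ZZ w z. H = cls \<gamma>)"
  by (auto simp: Loc_def quotient_def)

lemma Hom_L_can:
  assumes "linked w es z" "w \<in> K" "z \<in> K"
  shows "cls (can w es z) \<in> Hom L w z" "nfc (cls (can w es z)) = es"
  using can_closed[OF assms] nfc_cls[OF can_closed(1)[OF assms]] unfolding Hom_L by auto

lemma Hom_L_eq: "H \<in> Hom L w z \<Longrightarrow> G \<in> Hom L w z \<Longrightarrow> nfc H = nfc G \<Longrightarrow> H = G"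
  unfolding Hom_L using nfc_cls cls_eq_iff_nf by metis

lemma Hom_L_linked: "H \<in> Hom L w z \<Longrightarrow> linked w (nfc H) z"
  unfolding Hom_L using nfc_cls linked_nf by metis

lemma Comp_L:
  assumes "\<gamma> \<in> ZZ w y" "\<delta> \<in> ZZ y z"
  shows "Comp L (cls \<delta>) (cls \<gamma>) = cls (cat \<gamma> \<delta>)"
proof -
  have "cls (cat \<gamma>' \<delta>') = cls (cat \<gamma> \<delta>)" if "\<gamma>' \<in> cls \<gamma>" "\<delta>' \<in> cls \<delta>" for \<gamma>' \<delta>'
    using that eqv_cat[OF _ _ assms, of \<gamma>' \<delta>'] eqv_sym by (simp only: mem_cls cls_eq_iff)
  moreover have "\<gamma> \<in> cls \<gamma>" "\<delta> \<in> cls \<delta>" by (simp_all only: mem_cls eqv_refl)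
  ultimately have "(\<Union>\<gamma>'\<in>cls \<gamma>. \<Union>\<delta>'\<in>cls \<delta>. cls (cat \<gamma>' \<delta>')) = cls (cat \<gamma> \<delta>)"
    by blast
  then show ?thesis by (simp add: Loc_def)
qed

lemma Comp_L_Hom:
  assumes "H \<in> Hom L w y" "G \<in> Hom L y z"
  shows "Comp L G H \<in> Hom L w z" "nfc (Comp L G H) = nfc H @ nfc G"
proof -
  obtain \<gamma> \<delta> where g: "\<gamma> \<in> ZZ w y" "H = cls \<gamma>" "\<delta> \<in> ZZ y z" "G = cls \<delta>"
    using assms unfolding Hom_L by blast
  note c = cat_closed[OF g(1,3)]
  show "Comp L G H \<in> Hom L w z"
    unfolding g Comp_L[OF g(1,3)] Hom_L using c by blast
  show "nfc (Comp L G H) = nfc H @ nfc G"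
    unfolding g Comp_L[OF g(1,3)] nfc_cls[OF c] nfc_cls[OF g(1)] nfc_cls[OF g(3)] nf_cat[OF g(1,3)] ..
qed

lemma Ident_L:
  assumes "w \<in> K"
  shows "Ident L w \<in> Hom L w w" "nfc (Ident L w) = []"
proof -
  have i: "Ident L w = cls (zz1 w w [w])" by (simp add: Loc_def)
  have c: "zz1 w w [w] \<in> ZZ w w" using assms by (simp add: singleton_Hom)
  show "Ident L w \<in> Hom L w w" unfolding i Hom_L using c by blast
  show "nfc (Ident L w) = []" unfolding i nfc_cls[OF c] by simp
qed

text \<open>The order asks for some pair of representatives of equal length. Any such pair shows
  refinement by \<open>ladder_refines\<close>; conversely \<open>build\<close> and
  \<open>can\<close> over the same list of steps are such a pair.\<close>

lemma Le_L:
  assumes "G \<in> Hom L w z" "H \<in> Hom L w z"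
  shows "Le L G H \<longleftrightarrow> refines (nfc G) (nfc H)"
proof -
  obtain \<gamma>' \<gamma> where g: "\<gamma>' \<in> ZZ w z" "G = cls \<gamma>'" "\<gamma> \<in> ZZ w z" "H = cls \<gamma>"
    using assms unfolding Hom_L by blast
  have K: "w \<in> K" "z \<in> K" using zigzags_endpoints(1,2)[OF g(1)] by simp_all
  have Le: "Le L G H \<longleftrightarrow> (\<exists>\<delta>'\<in>G. \<exists>\<delta>\<in>H. ladder E \<Sigma> subseq \<delta> \<delta>')"
    by (simp add: Loc_def)
  show ?thesis
  proof
    assume "Le L G H"
    then obtain \<delta>' \<delta> where "\<delta>' \<in> G" "\<delta> \<in> H" and l: "ladder E \<Sigma> subseq \<delta> \<delta>'"
      unfolding Le by blast
    then have d: "eqv \<gamma>' \<delta>'" "eqv \<gamma> \<delta>" by (simp_all only: g mem_cls)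
    have "refines (nf \<delta>') (nf \<delta>)"
      by (rule ladder_refines[OF l eqv_closed[OF d(2) g(3)] eqv_closed[OF d(1) g(1)]])
    then show "refines (nfc G) (nfc H)"
      unfolding g nfc_cls[OF g(1)] nfc_cls[OF g(3)] using nf_eqv[OF d(1) g(1)] nf_eqv[OF d(2) g(3)] by simp
  next
    assume "refines (nfc G) (nfc H)"
    then obtain ss where ss: "fills (nf \<gamma>') ss" "nf \<gamma> = concat (map nfp ss)"
      unfolding g nfc_cls[OF g(1)] nfc_cls[OF g(3)] refines_def by blast
    note p = linked_nf[OF g(1)]
    note b = build_closed[OF p ss(1) K]
    have "eqv \<gamma> (build w ss z)"
      using b ss(2) eqv_iff_nf[OF g(3) b(1)] by simp
    moreover have "eqv \<gamma>' (can w (nf \<gamma>') z)" by (rule eqv_can[OF g(1)])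
    ultimately show "Le L G H"
      unfolding Le unfolding g using ladder_build[OF p ss(1) K] mem_cls by blast
  qed
qed

abbreviation "crit \<equiv> critical_cells X K cdim f"
abbreviation "F \<equiv> Flo X K cdim f"

text \<open>Counts generators: a critical cell is alone in its \<open>same\<close> class, so a step
  ending there is a place where the morphism factors through that cell. The final target counts as
  well, so generators have value 1.\<close>

definition crossings :: "('a set \<times> 'a set) list \<Rightarrow> nat" where
  "crossings es = length (filter (\<lambda>(a, c). c \<in> crit) es)"

lemma crossings_simps [simp]:
  "crossings [] = 0" "crossings (es @ fs) = crossings es + crossings fs"
  "crossings ((a, c) # es) = (if c \<in> crit then Suc (crossings es) else crossings es)"
  by (simp_all add: crossings_def)

lemma Flo_simps [simp]:
  "Obj F = K \<inter> crit" "Hom F = Hom L" "Ident F = Ident L" "Comp F = Comp L" "Le F = Le L"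
  by (simp_all add: Flo_def full_sub_def Loc_def)

lemma linked_last: "linked w (es @ [(a, c)]) z \<Longrightarrow> same c z"
  by (induction es arbitrary: w) auto

text \<open>The last step of a nonempty list ends in the class of \<open>z\<close>, which is
  \<open>z\<close> alone, and would be a crossing.\<close>

lemma crossings_eq_0:
  assumes "linked w es z" "z \<in> crit" "crossings es = 0"
  shows "es = []"
proof (cases es rule: rev_exhaust)
  case (snoc fs e)
  obtain a c where "e = (a, c)" by fastforce
  then have "c = z" using assms(1,2) snoc linked_last same_critical(2) by blast
  then show ?thesis using assms(2,3) snoc \<open>e = (a, c)\<close> by simp
qed

lemma crossings_split:
  assumes "0 < crossings es"
  shows "\<exists>fs a c gs. es = fs @ (a, c) # gs \<and> crossings fs = 0 \<and> c \<in> crit"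
  using assms
proof (induction es)
  case (Cons e es)
  obtain a c where e: "e = (a, c)" by fastforce
  show ?case
  proof (cases "c \<in> crit")
    case True
    then show ?thesis using e by (intro exI[of _ "[]"]) auto
  next
    case False
    then obtain fs a' c' gs where "es = fs @ (a', c') # gs" "crossings fs = 0" "c' \<in> crit"
      using Cons e by auto
    then show ?thesis using False e by (intro exI[of _ "e # fs"]) auto
  qed
qed simp

lemma split_unique:
  assumes "fs @ (a, c) # gs = fs' @ (a', c') # gs'" "crossings fs = 0" "crossings fs' = 0" "c \<in> crit" "c' \<in> crit"
  shows "fs = fs' \<and> a = a' \<and> c = c' \<and> gs = gs'"
  using assms
proof (induction fs arbitrary: fs')
  case Nil
  then show ?case by (cases fs') (auto split: if_splits)
next
  case (Cons e fs)
  then show ?case by (cases fs'; cases e) (auto split: if_splits)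
qed

lemma crossings_1:
  assumes "linked w es z" "z \<in> crit" "crossings es = 1"
  shows "\<exists>fs a. es = fs @ [(a, z)] \<and> crossings fs = 0"
proof (cases es rule: rev_exhaust)
  case Nil
  then show ?thesis using assms by simp
next
  case (snoc fs e)
  obtain a c where "e = (a, c)" by fastforce
  then have "c = z" using assms(1,2) snoc linked_last same_critical(2) by blast
  then show ?thesis using assms(2,3) snoc \<open>e = (a, c)\<close> by auto
qed

lemma linked_critical: "linked w [] z \<Longrightarrow> z \<in> crit \<Longrightarrow> w = z"
  using same_critical(2) by simp

text \<open>Through \<open>nfc\<close> every axiom becomes a statement about lists of steps:
  composition is concatenation, the order is \<open>refines\<close>, and a morphism is determined by
  its list.\<close>

lemma free_pcat_Flo: "free_pcat F (\<lambda>H. crossings (nfc H))"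
proof
  fix a assume "a \<in> Obj F"
  then show "Ident F a \<in> Hom F a a" using Ident_L by simp
next
  fix a b c G H
  assume "a \<in> Obj F" "b \<in> Obj F" "c \<in> Obj F" and h: "G \<in> Hom F a b" "H \<in> Hom F b c"
  then have h': "G \<in> Hom L a b" "H \<in> Hom L b c" by simp_all
  show "Comp F H G \<in> Hom F a c" "crossings (nfc (Comp F H G)) = crossings (nfc G) + crossings (nfc H)"
    using Comp_L_Hom[OF h'] by simp_all
next
  fix a b c d f' g h
  assume "a \<in> Obj F" "b \<in> Obj F" "c \<in> Obj F" "d \<in> Obj F" "f' \<in> Hom F a b" "g \<in> Hom F b c" "h \<in> Hom F c d"
  then have h': "f' \<in> Hom L a b" "g \<in> Hom L b c" "h \<in> Hom L c d" by simp_all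
  note 1 = Comp_L_Hom[OF h'(1,2)] and 2 = Comp_L_Hom[OF h'(2,3)]
  show "Comp F h (Comp F g f') = Comp F (Comp F h g) f'"
    using Hom_L_eq[OF Comp_L_Hom(1)[OF 1(1) h'(3)] Comp_L_Hom(1)[OF h'(1) 2(1)]]
      Comp_L_Hom(2)[OF 1(1) h'(3)] Comp_L_Hom(2)[OF h'(1) 2(1)] 1(2) 2(2) by simp
next
  fix a b g
  assume ab: "a \<in> Obj F" "b \<in> Obj F" and "g \<in> Hom F a b"
  then have g: "g \<in> Hom L a b" and i: "Ident L a \<in> Hom L a a" "Ident L b \<in> Hom L b b"
    using Ident_L by simp_all
  have n: "nfc (Ident L a) = []" "nfc (Ident L b) = []" using ab Ident_L by simp_all
  show "Comp F (Ident F b) g = g"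
    using Hom_L_eq[OF Comp_L_Hom(1)[OF g i(2)] g] Comp_L_Hom(2)[OF g i(2)] n by simp
  show "Comp F g (Ident F a) = g"
    using Hom_L_eq[OF Comp_L_Hom(1)[OF i(1) g] g] Comp_L_Hom(2)[OF i(1) g] n by simp
  show "Le F g g"
    using Le_L[OF g g] refines_refl[OF Hom_L_linked[OF g]] by simp
next
  fix a b u g h
  assume "a \<in> Obj F" "b \<in> Obj F" "u \<in> Hom F a b" "g \<in> Hom F a b" "h \<in> Hom F a b" "Le F u g" "Le F g h"
  then have h': "u \<in> Hom L a b" "g \<in> Hom L a b" "h \<in> Hom L a b" and l: "Le L u g" "Le L g h" by simp_all
  show "Le F u h"
    using refines_trans l unfolding Flo_simps Le_L[OF h'(1,2)] Le_L[OF h'(2,3)] Le_L[OF h'(1,3)] by blast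
next
  fix a b c u u' g g'
  assume "a \<in> Obj F" "b \<in> Obj F" "c \<in> Obj F" "u \<in> Hom F a b" "u' \<in> Hom F a b" "g \<in> Hom F b c" "g' \<in> Hom F b c"
    and "Le F u u'" "Le F g g'"
  then have h': "u \<in> Hom L a b" "u' \<in> Hom L a b" "g \<in> Hom L b c" "g' \<in> Hom L b c"
    and l: "Le L u u'" "Le L g g'" by simp_all
  note 1 = Comp_L_Hom[OF h'(1,3)] and 2 = Comp_L_Hom[OF h'(2,4)]
  show "Le F (Comp F g u) (Comp F g' u')"
    using l unfolding Flo_simps Le_L[OF h'(1,2)] Le_L[OF h'(3,4)] Le_L[OF 1(1) 2(1)] 1(2) 2(2) refines_append
    by blast
next
  fix a b g
  assume ab: "a \<in> Obj F" "b \<in> Obj F" and "g \<in> Hom F a b" and 0: "crossings (nfc g) = 0"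
  then have g: "g \<in> Hom L a b" by simp
  have n: "nfc g = []" by (rule crossings_eq_0[OF Hom_L_linked[OF g] _ 0]) (use ab in simp)
  have e: "a = b" using Hom_L_linked[OF g] linked_critical[of a b] n ab by simp
  have "g = Ident L a"
    using Hom_L_eq[of g a a "Ident L a"] Ident_L[of a] g n e ab by simp
  with e show "a = b \<and> g = Ident F a" by simp
next
  fix a b h
  assume ab: "a \<in> Obj F" "b \<in> Obj F" and "h \<in> Hom F a b" and pos: "0 < crossings (nfc h)"
  then have h: "h \<in> Hom L a b" and K: "a \<in> K" "b \<in> K" "a \<in> crit" "b \<in> crit" by simp_all
  note p = Hom_L_linked[OF h]
  \<comment> \<open>The first generator is cut off right after the first step that ends in a
    critical cell.\<close>
  obtain fs x c gs where s: "nfc h = fs @ (x, c) # gs" "crossings fs = 0" "c \<in> crit"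
    using crossings_split[OF pos] by blast
  have p1: "linked a (fs @ [(x, c)]) c" and p2: "linked c gs b" using linked_split[of a fs x c gs b] p s(1) by simp_all
  have c: "c \<in> K" using s(3) by (simp add: critical_cells_def)
  define g r where "g = cls (can a (fs @ [(x, c)]) c)" and "r = cls (can c gs b)"
  have g: "g \<in> Hom L a c" "nfc g = fs @ [(x, c)]" and r: "r \<in> Hom L c b" "nfc r = gs"
    using Hom_L_can[OF p1 K(1) c] Hom_L_can[OF p2 c K(2)] by (simp_all only: g_def r_def)
  have hgr: "h = Comp L r g"
    by (rule Hom_L_eq[OF h Comp_L_Hom(1)[OF g(1) r(1)]]) (simp add: Comp_L_Hom(2)[OF g(1) r(1)] g r s)
  show "\<exists>!(c, g, r). c \<in> Obj F \<and> g \<in> Hom F a c \<and> r \<in> Hom F c b \<and> crossings (nfc g) = 1 \<and> h = Comp F r g"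
  proof (rule ex1I[of _ "(c, g, r)"])
    show "case (c, g, r) of (c, g, r) \<Rightarrow> c \<in> Obj F \<and> g \<in> Hom F a c \<and> r \<in> Hom F c b \<and>
        crossings (nfc g) = 1 \<and> h = Comp F r g"
      using c s(2,3) g r hgr by simp
  next
    fix y assume y: "case y of (c, g, r) \<Rightarrow> c \<in> Obj F \<and> g \<in> Hom F a c \<and> r \<in> Hom F c b \<and>
        crossings (nfc g) = 1 \<and> h = Comp F r g"
    obtain c' g' r' where y_eq: "y = (c', g', r')" by (cases y)
    have y': "c' \<in> crit" "g' \<in> Hom L a c'" "r' \<in> Hom L c' b" "crossings (nfc g') = 1" "h = Comp L r' g'"
      using y unfolding y_eq by simp_all
    obtain fs' x' where fs': "nfc g' = fs' @ [(x', c')]" "crossings fs' = 0"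
      using crossings_1[OF Hom_L_linked[OF y'(2)] y'(1,4)] by blast
    have "fs @ (x, c) # gs = fs' @ (x', c') # nfc r'"
      using s(1) y'(5) Comp_L_Hom(2)[OF y'(2,3)] fs' by simp
    then have e: "fs = fs'" "x = x'" "c = c'" "gs = nfc r'"
      using split_unique s(2,3) fs'(2) y'(1) by blast+
    have "g' = g" by (rule Hom_L_eq[of _ a c]) (use y' g fs' e in simp_all)
    moreover have "r' = r" by (rule Hom_L_eq[of _ c b]) (use y' r e in simp_all)
    ultimately show "y = (c, g, r)" using y_eq e by simp
  qed
next
  fix a b c g r h
  assume abc: "a \<in> Obj F" "b \<in> Obj F" "c \<in> Obj F" and "g \<in> Hom F a c" "r \<in> Hom F c b" "h \<in> Hom F a b"
    and "Le F (Comp F r g) h"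
  then have g: "g \<in> Hom L a c" and r: "r \<in> Hom L c b" and h: "h \<in> Hom L a b" and l: "Le L (Comp L r g) h"
    and K: "a \<in> K" "b \<in> K" "c \<in> K"
    by simp_all
  note C = Comp_L_Hom[OF g r]
  \<comment> \<open>A refinement of a concatenation is a concatenation of refinements, which gives
    the factors; \<open>refines_unique\<close> fixes the place of the cut.\<close>
  have "refines (nfc g @ nfc r) (nfc h)"
    using l unfolding Le_L[OF C(1) h] C(2) .
  then obtain es fs where s: "nfc h = es @ fs" "refines (nfc g) es" "refines (nfc r) fs"
    unfolding refines_append by blast
  have p: "linked a es c" "linked c fs b"
    using refines_linked[OF Hom_L_linked[OF g] s(2)] refines_linked[OF Hom_L_linked[OF r] s(3)] by blast+
  define g' r' where "g' = cls (can a es c)" and "r' = cls (can c fs b)"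
  have g': "g' \<in> Hom L a c" "nfc g' = es" and r': "r' \<in> Hom L c b" "nfc r' = fs"
    using Hom_L_can[OF p(1) K(1,3)] Hom_L_can[OF p(2) K(3,2)] by (simp_all only: g'_def r'_def)
  have hgr: "h = Comp L r' g'"
    by (rule Hom_L_eq[OF h Comp_L_Hom(1)[OF g'(1) r'(1)]]) (simp add: Comp_L_Hom(2)[OF g'(1) r'(1)] g' r' s)
  show "\<exists>!(g', r'). g' \<in> Hom F a c \<and> r' \<in> Hom F c b \<and> h = Comp F r' g' \<and> Le F g g' \<and> Le F r r'"
  proof (rule ex1I[of _ "(g', r')"])
    show "case (g', r') of (g', r') \<Rightarrow> g' \<in> Hom F a c \<and> r' \<in> Hom F c b \<and> h = Comp F r' g' \<and> Le F g g' \<and> Le F r r'"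
      using g' r' hgr s Le_L[OF g g'(1)] Le_L[OF r r'(1)] by simp
  next
    fix y assume y: "case y of (g', r') \<Rightarrow> g' \<in> Hom F a c \<and> r' \<in> Hom F c b \<and> h = Comp F r' g' \<and> Le F g g' \<and> Le F r r'"
    obtain g'' r'' where y_eq: "y = (g'', r'')" by (cases y)
    have y': "g'' \<in> Hom L a c" "r'' \<in> Hom L c b" "h = Comp L r'' g''" "Le L g g''" "Le L r r''"
      using y unfolding y_eq by simp_all
    have e: "es @ fs = nfc g'' @ nfc r''"
      using s(1) y'(3) Comp_L_Hom(2)[OF y'(1,2)] by simp
    have "es = nfc g''"
      by (rule refines_unique[OF Hom_L_linked[OF g] s(2) _ e]) (use y'(4) Le_L[OF g y'(1)] in simp)
    then have "g'' = g'" "r'' = r'"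
      using Hom_L_eq[OF y'(1) g'(1)] Hom_L_eq[OF y'(2) r'(1)] g' r' e by simp_all
    then show "y = (g', r')" using y_eq by simp
  qed
next
  fix a h
  assume a: "a \<in> Obj F" and "h \<in> Hom F a a" "Le F (Ident F a) h"
  then have h: "h \<in> Hom L a a" and l: "Le L (Ident L a) h" by simp_all
  have i: "Ident L a \<in> Hom L a a" "nfc (Ident L a) = []" using a Ident_L by simp_all
  have "nfc h = []" using l unfolding Le_L[OF i(1) h] i(2) by simp
  then have "h = Ident L a" using Hom_L_eq[OF h i(1)] i(2) by simp
  then show "h = Ident F a" by simp
qed

end

section \<open>Cells of a regular CW complex\<close>

definition sqsum :: "nat \<Rightarrow> (nat \<Rightarrow> real) \<Rightarrow> real" where
  "sqsum n x = (\<Sum>i<n. (x i)\<^sup>2)"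

definition euclid_set :: "nat \<Rightarrow> (nat \<Rightarrow> real) set" where
  "euclid_set n = {x. \<forall>i\<ge>n. x i = 0}"

definition disc_set :: "nat \<Rightarrow> (nat \<Rightarrow> real) set" where "disc_set n = euclid_set n \<inter> {x. sqsum n x \<le> 1}"
definition sphere_bdry :: "nat \<Rightarrow> (nat \<Rightarrow> real) set" where "sphere_bdry n = euclid_set n \<inter> {x. sqsum n x = 1}"
definition open_disc :: "nat \<Rightarrow> (nat \<Rightarrow> real) set" where "open_disc n = euclid_set n \<inter> {x. sqsum n x < 1}"

lemma Euclidean_space_euclid_set: "Euclidean_space n = top_of_set (euclid_set n)"
  by (simp add: Euclidean_space_def euclidean_product_topology euclid_set_def)

lemma disc_disc_set: "disc n = top_of_set (disc_set n)"
  by (simp add: disc_def Euclidean_space_euclid_set subtopology_subtopology disc_set_def sqsum_def)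

lemma disc_boundary_sphere_bdry: "disc_boundary n = top_of_set (sphere_bdry n)"
  unfolding disc_boundary_def disc_disc_set subtopology_subtopology
  by (rule arg_cong[where f = "subtopology euclidean"]) (auto simp: sphere_bdry_def disc_set_def sqsum_def sphere_set_def)

lemma disc_interior_open_disc: "disc_interior n = top_of_set (open_disc n)"
  unfolding disc_interior_def disc_disc_set subtopology_subtopology
  by (rule arg_cong[where f = "subtopology euclidean"]) (auto simp: open_disc_def disc_set_def sqsum_def sphere_set_def)

lemma disc_set_split: "disc_set n = open_disc n \<union> sphere_bdry n" "open_disc n \<inter> sphere_bdry n = {}"
  by (auto simp: disc_set_def open_disc_def sphere_bdry_def)

lemma continuous_on_sqsum [continuous_intros]: "continuous_on S (sqsum n)"
  unfolding sqsum_def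
  by (intro continuous_intros) (metis continuous_on_product_coordinates continuous_on_subset subset_UNIV)

lemma sqsum_scale: "sqsum n (\<lambda>i. t * x i) = t\<^sup>2 * sqsum n x"
  by (simp add: sqsum_def power_mult_distrib sum_distrib_left)

lemma sqsum_nonneg: "0 \<le> sqsum n x"
  by (simp add: sqsum_def sum_nonneg)

lemma sqsum_eq_0: "x \<in> euclid_set n \<Longrightarrow> sqsum n x = 0 \<longleftrightarrow> x = (\<lambda>_. 0)"
  by (auto simp: sqsum_def euclid_set_def sum_nonneg_eq_0_iff fun_eq_iff) (metis lessThan_iff not_le)

lemma euclid_set_scale: "x \<in> euclid_set n \<Longrightarrow> (\<lambda>i. t * x i) \<in> euclid_set n"
  by (simp add: euclid_set_def)

lemma continuous_on_scale:
  "continuous_on A g \<Longrightarrow> continuous_on A h \<Longrightarrow> continuous_on A (\<lambda>v i. (g v :: real) * (h v :: nat \<Rightarrow> real) i)"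
  by (rule continuous_on_coordinatewise_then_product)
    (erule continuous_on_mult, erule continuous_on_product_then_coordinatewise)

lemma continuous_on_scalar: "continuous_on A (\<lambda>t i. (t :: real) * (x :: nat \<Rightarrow> real) i)"
  by (rule continuous_on_coordinatewise_then_product) (intro continuous_on_mult_right continuous_on_id)

lemma closed_euclid_set: "closed (euclid_set n)"
proof -
  have "euclid_set n = (\<Inter>i\<in>{n..}. {x. x i = 0})" by (auto simp: euclid_set_def)
  moreover have "closed {x :: nat \<Rightarrow> real. x i = 0}" for i
    by (intro closed_Collect_eq continuous_on_product_coordinates continuous_intros)
  ultimately show ?thesis by auto
qed

lemma compact_disc_set: "compact (disc_set n)"
proof -
  have "compact (PiE UNIV (\<lambda>i::nat. {-1..1::real}))"
    using compactin_PiE[of "\<lambda>i. euclidean" UNIV "\<lambda>i::nat. {-1..1::real}"]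
    by (simp add: euclidean_product_topology compactin_euclidean_iff)
  moreover have "closed (disc_set n)"
    unfolding disc_set_def by (intro closed_Int closed_euclid_set closed_Collect_le continuous_intros)
  moreover have "disc_set n \<subseteq> PiE UNIV (\<lambda>i::nat. {-1..1::real})"
  proof
    fix x assume x: "x \<in> disc_set n"
    have "x i \<in> {-1..1}" for i
    proof (cases "i < n")
      case True
      then have "(x i)\<^sup>2 \<le> sqsum n x"
        unfolding sqsum_def by (intro member_le_sum) auto
      then have "(x i)\<^sup>2 \<le> 1\<^sup>2" using x by (simp add: disc_set_def)
      then show ?thesis using abs_le_square_iff[of "x i" 1] by auto
    next
      case False
      then show ?thesis using x by (simp add: disc_set_def euclid_set_def)
    qed
    then show "x \<in> PiE UNIV (\<lambda>i::nat. {-1..1::real})" by auto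
  qed
  ultimately show ?thesis using compact_Int_closed by (metis inf.absorb_iff2)
qed

lemma connected_open_disc: "connected (open_disc n)"
proof -
  have "connected (\<Union>x\<in>open_disc n. (\<lambda>t i. t * x i) ` {0..1::real})"
  proof (rule connected_Union)
    fix S assume "S \<in> (\<lambda>x. (\<lambda>t i. t * x i) ` {0..1::real}) ` open_disc n"
    then show "connected S"
      by (auto intro!: connected_continuous_image continuous_on_scalar)
  next
    have "(\<lambda>_. 0) \<in> (\<lambda>t i. t * x i) ` {0..1::real}" for x :: "nat \<Rightarrow> real"
      by (rule image_eqI[of _ _ 0]) auto
    then show "\<Inter> ((\<lambda>x. (\<lambda>t i. t * x i) ` {0..1::real}) ` open_disc n) \<noteq> {}" by blast
  qed
  also have "(\<Union>x\<in>open_disc n. (\<lambda>t i. t * x i) ` {0..1::real}) = open_disc n"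
  proof
    show "(\<Union>x\<in>open_disc n. (\<lambda>t i. t * x i) ` {0..1::real}) \<subseteq> open_disc n"
    proof clarify
      fix x and t :: real assume x: "x \<in> open_disc n" and t: "t \<in> {0..1}"
      have "t\<^sup>2 * sqsum n x \<le> 1 * sqsum n x"
        by (rule mult_right_mono) (use t sqsum_nonneg in \<open>auto simp: power_le_one\<close>)
      then show "(\<lambda>i. t * x i) \<in> open_disc n"
        using x euclid_set_scale by (simp add: open_disc_def sqsum_scale)
    qed
    show "open_disc n \<subseteq> (\<Union>x\<in>open_disc n. (\<lambda>t i. t * x i) ` {0..1::real})"
    proof
      fix x assume "x \<in> open_disc n"
      then show "x \<in> (\<Union>x\<in>open_disc n. (\<lambda>t i. t * x i) ` {0..1::real})"
        by (intro UN_I[of x] image_eqI[of _ _ 1]) auto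
    qed
  qed
  finally show ?thesis .
qed

lemma sphere_bdry_subset_closure_open_disc: "sphere_bdry n \<subseteq> closure (open_disc n)"
proof
  fix x assume x: "x \<in> sphere_bdry n"
  have "(\<lambda>t i. t * x i) ` closure {0..<1::real} \<subseteq> closure ((\<lambda>t i. t * x i) ` {0..<1::real})"
    by (rule continuous_image_closure_subset[OF continuous_on_scalar[of UNIV]]) simp
  also have "\<dots> \<subseteq> closure (open_disc n)"
  proof (rule closure_mono, clarify)
    fix t :: real assume "t \<in> {0..<1}"
    then have "t\<^sup>2 < 1" by (simp add: abs_square_less_1)
    then show "(\<lambda>i. t * x i) \<in> open_disc n"
      using x euclid_set_scale by (simp add: sphere_bdry_def open_disc_def sqsum_scale)
  qed
  finally show "x \<in> closure (open_disc n)"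
    by (rule subsetD) (intro image_eqI[of _ _ 1], auto)
qed

text \<open>Both domains are turned into Euclidean ones by passing to the open cone \<open>S\<^sup>n \<times> (0, \<infinity>)\<close>.\<close>

lemma sphere_invariance_of_domain:
  assumes U: "openin (top_of_set (sphere_bdry (Suc n))) U"
    and cont: "continuous_on U f" and f: "f ` U \<subseteq> euclid_set n" and inj: "inj_on f U"
  shows "openin (top_of_set (euclid_set n)) (f ` U)"
proof -
  let ?r = "\<lambda>v. sqrt (sqsum (Suc n) v)"
  let ?N = "\<lambda>v i. inverse (?r v) * v i"
  define E0 where "E0 = euclid_set (Suc n) - {\<lambda>_. 0}"
  define C where "C = E0 \<inter> ?N -` U"
  \<comment> \<open>Values of \<open>f\<close> vanish in coordinate \<open>n\<close>, which is
    therefore free to record the radius; this makes \<open>F\<close> injective on the cone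
    \<open>C\<close> over \<open>U\<close>.\<close>
  define F where "F = (\<lambda>v i. if i = n then ?r v else f (?N v) i)"
  have US: "U \<subseteq> sphere_bdry (Suc n)" using U openin_imp_subset by blast
  have r_pos: "0 < ?r v" if "v \<in> E0" for v
    using that sqsum_eq_0[of v "Suc n"] sqsum_nonneg[of "Suc n" v] by (auto simp: E0_def less_le)
  have cr: "continuous_on A ?r" for A
    by (intro continuous_intros)
  have cN: "continuous_on E0 ?N"
    by (rule continuous_on_scale) (use r_pos in \<open>auto intro!: continuous_intros simp: less_le\<close>)
  have NS: "?N v \<in> sphere_bdry (Suc n)" if "v \<in> E0" for v
  proof -
    have "(inverse (?r v))\<^sup>2 * sqsum (Suc n) v = 1"
      using r_pos[OF that] by (simp add: power_inverse sqsum_nonneg)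
    then show ?thesis using that euclid_set_scale[of v "Suc n" "inverse (?r v)"] by (simp add: sphere_bdry_def E0_def sqsum_scale)
  qed
  have E0_open: "openin (top_of_set (euclid_set (Suc n))) E0"
    unfolding E0_def by (rule openin_diff) (auto simp: closedin_closed_eq closed_euclid_set euclid_set_def)
  have "openin (top_of_set E0) C"
    unfolding C_def by (rule continuous_openin_preimage[OF cN _ U]) (use NS in auto)
  then have C_open: "openin (top_of_set (euclid_set (Suc n))) C"
    using E0_open openin_trans by blast
  have CE: "C \<subseteq> E0" by (auto simp: C_def)
  have NC: "?N ` C \<subseteq> U" by (auto simp: C_def)
  have FE: "F ` C \<subseteq> euclid_set (Suc n)"
    using NC f by (force simp: F_def euclid_set_def)
  have cF: "continuous_on C F"
  proof (rule continuous_on_coordinatewise_then_product)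
    fix i
    have "continuous_on C (\<lambda>v. f (?N v))"
      using continuous_on_compose2[OF cont continuous_on_subset[OF cN CE] NC] .
    then have "continuous_on C (\<lambda>v. f (?N v) i)" by (rule continuous_on_product_then_coordinatewise)
    with cr show "continuous_on C (\<lambda>v. F v i)" by (cases "i = n") (simp_all add: F_def)
  qed
  have iF: "inj_on F C"
  proof (rule inj_onI)
    fix v w assume v: "v \<in> C" and w: "w \<in> C" and eq: "F v = F w"
    have r: "?r v = ?r w" using fun_cong[OF eq, of n] by (simp add: F_def)
    have "f (?N v) i = f (?N w) i" for i
    proof (cases "i = n")
      case True
      have "f (?N v) \<in> euclid_set n" "f (?N w) \<in> euclid_set n" using NC f v w by blast+
      then show ?thesis using True by (simp add: euclid_set_def)
    next
      case False
      then show ?thesis using fun_cong[OF eq, of i] by (simp add: F_def)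
    qed
    then have "f (?N v) = f (?N w)" by auto
    then have N: "?N v = ?N w" using inj_onD[OF inj] NC v w by blast
    show "v = w"
    proof
      fix i
      have "inverse (?r v) * v i = inverse (?r v) * w i" using fun_cong[OF N, of i] r by simp
      then show "v i = w i" using r_pos[of v] v CE by auto
    qed
  qed
  have "openin (Euclidean_space (Suc n)) (F ` C)"
  proof (rule invariance_of_domain_Euclidean_space)
    show "openin (Euclidean_space (Suc n)) C" using C_open by (simp add: Euclidean_space_euclid_set)
    have "C \<subseteq> euclid_set (Suc n)" using C_open openin_imp_subset by blast
    then show "continuous_map (subtopology (Euclidean_space (Suc n)) C) (Euclidean_space (Suc n)) F"
      using cF FE by (simp add: Euclidean_space_euclid_set subtopology_subtopology continuous_map_in_subtopology
          inf.absorb2 image_subset_iff_funcset)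
  qed (rule iF)
  then have FC: "openin (top_of_set (euclid_set (Suc n))) (F ` C)" by (simp add: Euclidean_space_euclid_set)
  \<comment> \<open>Slicing the image of the cone at height 1, the radius of the sphere, recovers
    the image of \<open>U\<close>.\<close>
  let ?j = "\<lambda>u i. if i = n then 1 else u i :: real"
  have cj: "continuous_on (euclid_set n) ?j"
  proof (rule continuous_on_coordinatewise_then_product)
    fix i
    show "continuous_on (euclid_set n) (\<lambda>u. ?j u i)"
      by (cases "i = n") (auto intro: continuous_on_product_then_coordinatewise continuous_on_id)
  qed
  have "openin (top_of_set (euclid_set n)) (euclid_set n \<inter> ?j -` (F ` C))"
    by (rule continuous_openin_preimage[OF cj _ FC]) (auto simp: euclid_set_def)
  also have "euclid_set n \<inter> ?j -` (F ` C) = f ` U"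
  proof (intro subset_antisym subsetI)
    fix u assume u: "u \<in> euclid_set n \<inter> ?j -` (F ` C)"
    then obtain v where v: "v \<in> C" "?j u = F v" by auto
    have "u i = f (?N v) i" for i
    proof (cases "i = n")
      case True
      have "f (?N v) \<in> euclid_set n" using NC f v(1) by blast
      then show ?thesis using True u by (simp add: euclid_set_def)
    next
      case False
      then show ?thesis using fun_cong[OF v(2), of i] by (simp add: F_def)
    qed
    then have "u = f (?N v)" by auto
    then show "u \<in> f ` U" using NC v(1) by blast
  next
    fix u assume "u \<in> f ` U"
    then obtain s where s: "s \<in> U" "u = f s" by auto
    have sS: "s \<in> euclid_set (Suc n)" "sqsum (Suc n) s = 1" using US s(1) by (auto simp: sphere_bdry_def)
    then have "s \<in> C" using s(1) by (auto simp: C_def E0_def sqsum_def)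
    moreover have "?j u = F s" using sS s(2) by (auto simp: F_def)
    ultimately show "u \<in> euclid_set n \<inter> ?j -` (F ` C)" using f s by auto
  qed
  finally show ?thesis .
qed


section \<open>Closures of cells\<close>

context CW_complex
begin

lemma cell_subset: "e \<in> K \<Longrightarrow> e \<subseteq> topspace X"
  using partition by (auto simp: partition_on_def)

lemma cells_disjoint: "c \<in> K \<Longrightarrow> e \<in> K \<Longrightarrow> p \<in> c \<Longrightarrow> p \<in> e \<Longrightarrow> c = e"
  using partition unfolding partition_on_def disjoint_def by blast

lemma cell_nonempty: "e \<in> K \<Longrightarrow> e \<noteq> {}"
  using partition by (auto simp: partition_on_def)

lemma image_open_disc: "e \<in> K \<Longrightarrow> \<Phi> e ` open_disc (cdim e) = e"
  using homeomorphic_imp_surjective_map[OF open_cell, of e] cell_subset[of e]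
  by (simp add: disc_interior_open_disc inf.absorb2)

lemma image_sphere_bdry:
  "e \<in> K \<Longrightarrow> \<exists>F. finite F \<and> F \<subseteq> K \<and> (\<forall>c\<in>F. cdim c < cdim e) \<and> \<Phi> e ` sphere_bdry (cdim e) \<subseteq> \<Union> F"
  using closure_finite[of e] by (fastforce simp: disc_boundary_sphere_bdry)

lemma closedin_image_disc_set: "e \<in> K \<Longrightarrow> closedin X (\<Phi> e ` disc_set (cdim e))"
  by (rule compactin_imp_closedin[OF Hausdorff image_compactin[OF _ characteristic_map]])
    (auto simp: disc_disc_set compactin_subtopology compact_disc_set)

lemma closedin_image_sphere_bdry:
  assumes "e \<in> K"
  shows "closedin X (\<Phi> e ` sphere_bdry (cdim e))"
proof (rule compactin_imp_closedin[OF Hausdorff image_compactin[OF _ characteristic_map[OF assms]]])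
  have "closed {x. sqsum (cdim e) x = 1}" by (intro closed_Collect_eq continuous_intros)
  moreover have "sphere_bdry (cdim e) = disc_set (cdim e) \<inter> {x. sqsum (cdim e) x = 1}" by (auto simp: sphere_bdry_def disc_set_def)
  ultimately have "compact (sphere_bdry (cdim e))" using compact_Int_closed[OF compact_disc_set] by simp
  then show "compactin (disc (cdim e)) (sphere_bdry (cdim e))"
    by (auto simp: disc_disc_set compactin_subtopology disc_set_split)
qed

text \<open>The image of the closed disc is compact, hence closed in a Hausdorff space. It lies in
  the closure by continuity, as the open disc is dense in the closed one.\<close>

lemma closure_cell: "e \<in> K \<Longrightarrow> X closure_of e = \<Phi> e ` disc_set (cdim e)"
proof
  assume e: "e \<in> K"
  show "X closure_of e \<subseteq> \<Phi> e ` disc_set (cdim e)"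
    by (rule closure_of_minimal[OF _ closedin_image_disc_set[OF e]]) (use image_open_disc[OF e] disc_set_split in blast)
  have "open_disc (cdim e) \<subseteq> disc_set (cdim e)" by (auto simp: disc_set_split)
  then have "disc_set (cdim e) \<subseteq> disc (cdim e) closure_of open_disc (cdim e)"
    using sphere_bdry_subset_closure_open_disc[of "cdim e"] closure_subset[of "open_disc (cdim e)"]
    by (auto simp: disc_disc_set closure_of_subtopology inf.absorb2 disc_set_split(1))
  then show "\<Phi> e ` disc_set (cdim e) \<subseteq> X closure_of e"
    using continuous_map_image_closure_subset[OF characteristic_map[OF e], of "open_disc (cdim e)"] image_open_disc[OF e] by auto
qed

text \<open>The boundary sphere is mapped into cells of smaller dimension, and a point determines
  the cell that contains it.\<close>

lemma closure_cases:
  assumes "c \<in> K" "e \<in> K" "p \<in> c" "p \<in> X closure_of e"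
  shows "c = e \<or> p \<in> \<Phi> e ` sphere_bdry (cdim e) \<and> cdim c < cdim e"
proof (cases "p \<in> e")
  case True
  then show ?thesis using cells_disjoint assms by blast
next
  case False
  have "p \<in> \<Phi> e ` open_disc (cdim e) \<union> \<Phi> e ` sphere_bdry (cdim e)"
    using assms(4) unfolding closure_cell[OF assms(2)] disc_set_split(1) image_Un .
  then have S: "p \<in> \<Phi> e ` sphere_bdry (cdim e)"
    using False unfolding image_open_disc[OF assms(2)] by blast
  obtain F where F: "finite F" "F \<subseteq> K" "\<forall>c\<in>F. cdim c < cdim e" "\<Phi> e ` sphere_bdry (cdim e) \<subseteq> \<Union> F"
    using image_sphere_bdry[OF assms(2)] by (elim exE conjE)
  then obtain d where "d \<in> F" "p \<in> d" using S by blast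
  then show ?thesis using cells_disjoint[of c d p] F assms S by blast
qed

lemma image_sphere_bdry_disjoint: "e \<in> K \<Longrightarrow> p \<in> \<Phi> e ` sphere_bdry (cdim e) \<Longrightarrow> p \<notin> e"
proof
  assume e: "e \<in> K" and p: "p \<in> \<Phi> e ` sphere_bdry (cdim e)" "p \<in> e"
  obtain F where F: "finite F" "F \<subseteq> K" "\<forall>c\<in>F. cdim c < cdim e" "\<Phi> e ` sphere_bdry (cdim e) \<subseteq> \<Union> F"
    using image_sphere_bdry[OF e] by (elim exE conjE)
  then obtain d where d: "d \<in> F" "p \<in> d" using p by blast
  then have "e = d" using cells_disjoint[OF e _ p(2) d(2)] F(2) by blast
  then show False using bspec[OF F(3) d(1)] by simp
qed

lemma cell_less_dim:
  assumes "x \<in> K" "y \<in> K" "cell_less X y x"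
  shows "cdim y < cdim x"
proof -
  obtain p where "p \<in> y" using cell_nonempty[OF assms(2)] by blast
  then show ?thesis
    using closure_cases[OF assms(2,1), of p] assms(3) by (auto simp: cell_less_def)
qed

lemma closure_subset_closure: "y \<subseteq> X closure_of x \<Longrightarrow> X closure_of y \<subseteq> X closure_of x"
  by (simp add: closure_of_minimal)

end

section \<open>Facets of regular cells\<close>

context regular_CW_complex
begin

lemma inj_on_sphere_bdry: "e \<in> K \<Longrightarrow> inj_on (\<Phi> e) (sphere_bdry (cdim e))"
  using homeomorphic_imp_injective_map[OF regular[unfolded embedding_map_def]] by (simp add: disc_boundary_sphere_bdry)

lemma inj_on_disc_set:
  assumes "e \<in> K"
  shows "inj_on (\<Phi> e) (disc_set (cdim e))"
proof -
  have "inj_on (\<Phi> e) (open_disc (cdim e))"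
    using homeomorphic_imp_injective_map[OF open_cell[OF assms]] by (simp add: disc_interior_open_disc)
  moreover have "\<Phi> e ` (open_disc (cdim e) - sphere_bdry (cdim e)) \<inter> \<Phi> e ` (sphere_bdry (cdim e) - open_disc (cdim e)) = {}"
    using image_open_disc[OF assms] image_sphere_bdry_disjoint[OF assms] by blast
  ultimately show ?thesis
    using inj_on_sphere_bdry[OF assms] by (simp add: disc_set_split(1) inj_on_Un)
qed

text \<open>The sphere bounding \<open>z\<close> has the dimension of \<open>c\<close>. Reading the
  part of it over \<open>N\<close> in the disc coordinates of \<open>c\<close> is a continuous
  injection into Euclidean space of the same dimension, so its image is open there, not merely in
  the disc.\<close>

lemma open_preimage:
  assumes z: "z \<in> K" and c: "c \<in> K" and dim: "cdim z = Suc (cdim c)"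
    and "N \<subseteq> X closure_of c" and N: "openin (subtopology X (\<Phi> z ` sphere_bdry (cdim z))) N"
  shows "openin (top_of_set (euclid_set (cdim c))) {w \<in> disc_set (cdim c). \<Phi> c w \<in> N}"
proof -
  let ?n = "cdim c" and ?B = "\<Phi> z ` sphere_bdry (cdim z)"
  have NB: "N \<subseteq> ?B" using openin_subset[OF N] by auto
  have "embedding_map (disc ?n) X (\<Phi> c)"
    by (rule continuous_imp_embedding_map[OF characteristic_map[OF c] _ Hausdorff])
      (use inj_on_disc_set[OF c] compact_disc_set in \<open>simp_all add: disc_disc_set compact_space_subtopology\<close>)
  then obtain g where g: "homeomorphic_maps (disc ?n) (subtopology X (X closure_of c)) (\<Phi> c) g"
    unfolding embedding_map_def homeomorphic_map_maps using closure_cell[OF c] by (auto simp: disc_disc_set)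
  have cg: "continuous_map (subtopology X (X closure_of c)) (disc ?n) g"
    and gl: "\<And>w. w \<in> disc_set ?n \<Longrightarrow> g (\<Phi> c w) = w"
    and gr: "\<And>p. p \<in> X closure_of c \<Longrightarrow> \<Phi> c (g p) = p"
    using g closure_of_subset_topspace[of X c] by (auto simp: homeomorphic_maps_def disc_disc_set)
  have g_disc_set: "g p \<in> disc_set ?n" if "p \<in> X closure_of c" for p
    using continuous_map_image_subset_topspace[OF cg] that closure_of_subset_topspace[of X c]
    by (auto simp: disc_disc_set image_subset_iff)
  define U where "U = {s \<in> sphere_bdry (cdim z). \<Phi> z s \<in> N}"
  have cz: "continuous_map (top_of_set (sphere_bdry (cdim z))) (subtopology X ?B) (\<Phi> z)"
    using homeomorphic_imp_continuous_map[OF regular[OF z, unfolded embedding_map_def]]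
    by (simp add: disc_boundary_sphere_bdry)
  have U: "openin (top_of_set (sphere_bdry (cdim z))) U"
    using openin_continuous_map_preimage[OF cz N] by (simp add: U_def)
  have "continuous_map (top_of_set U) (subtopology X (X closure_of c)) (\<Phi> z)"
  proof (rule continuous_map_into_subtopology)
    have "U \<subseteq> sphere_bdry (cdim z)" by (auto simp: U_def)
    then show "continuous_map (top_of_set U) X (\<Phi> z)"
      using continuous_map_from_subtopology[OF continuous_map_into_fulltopology[OF cz], of U]
      by (simp add: subtopology_subtopology inf.absorb2)
  qed (use assms(4) in \<open>auto simp: U_def\<close>)
  from continuous_map_compose[OF this cg]
  have "continuous_map (top_of_set U) (top_of_set (disc_set ?n)) (g \<circ> \<Phi> z)"
    by (simp add: disc_disc_set)
  then have cont: "continuous_on U (g \<circ> \<Phi> z)"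
    by (simp add: continuous_map_in_subtopology)
  have "openin (top_of_set (euclid_set ?n)) ((g \<circ> \<Phi> z) ` U)"
  proof (rule sphere_invariance_of_domain[OF _ cont])
    show "openin (top_of_set (sphere_bdry (Suc ?n))) U" using U dim by simp
    show "(g \<circ> \<Phi> z) ` U \<subseteq> euclid_set ?n"
      using g_disc_set assms(4) by (auto simp: U_def disc_set_def)
    show "inj_on (g \<circ> \<Phi> z) U"
    proof (rule inj_onI)
      fix s t assume s: "s \<in> U" "t \<in> U" "(g \<circ> \<Phi> z) s = (g \<circ> \<Phi> z) t"
      then have m: "\<Phi> z s \<in> X closure_of c" "\<Phi> z t \<in> X closure_of c" "s \<in> sphere_bdry (cdim z)" "t \<in> sphere_bdry (cdim z)"
        using assms(4) by (auto simp: U_def)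
      have "\<Phi> z s = \<Phi> z t"
        using arg_cong[OF s(3), of "\<Phi> c"] gr[OF m(1)] gr[OF m(2)] by simp
      then show "s = t" by (rule inj_onD[OF inj_on_sphere_bdry[OF z] _ m(3,4)])
    qed
  qed
  also have "(g \<circ> \<Phi> z) ` U = {w \<in> disc_set ?n. \<Phi> c w \<in> N}"
  proof (intro subset_antisym subsetI)
    fix w assume "w \<in> (g \<circ> \<Phi> z) ` U"
    then obtain s where s: "s \<in> sphere_bdry (cdim z)" "\<Phi> z s \<in> N" "w = g (\<Phi> z s)" by (auto simp: U_def)
    then have "\<Phi> z s \<in> X closure_of c" using assms(4) by blast
    then show "w \<in> {w \<in> disc_set ?n. \<Phi> c w \<in> N}" using gr g_disc_set s by simp
  next
    fix w assume w: "w \<in> {w \<in> disc_set ?n. \<Phi> c w \<in> N}"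
    then obtain s where "s \<in> sphere_bdry (cdim z)" "\<Phi> c w = \<Phi> z s" using NB by auto
    then show "w \<in> (g \<circ> \<Phi> z) ` U" using w gl[of w] by (intro image_eqI[of _ _ s]) (auto simp: U_def)
  qed
  finally show ?thesis .
qed

text \<open>Inside \<open>c\<close>, the boundary of \<open>z\<close> is closed, and by invariance of domain it is also open.\<close>

lemma meets_facet:
  assumes z: "z \<in> K" and c: "c \<in> K" and dim: "cdim z = Suc (cdim c)"
    and p: "p \<in> c" "p \<in> X closure_of z"
  shows "c \<subseteq> X closure_of z"
proof -
  let ?B = "\<Phi> z ` sphere_bdry (cdim z)" and ?n = "cdim c"
  obtain F where F: "finite F" "F \<subseteq> K" "\<forall>c\<in>F. cdim c < cdim z" "?B \<subseteq> \<Union> F"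
    using image_sphere_bdry[OF z] by (elim exE conjE)
  define Q where "Q = \<Union> ((closure_of) X ` (F - {c}))"
  have Q: "closedin X Q"
    unfolding Q_def by (rule closedin_Union) (use F(1) in auto)
  \<comment> \<open>The cells of \<open>F\<close> have dimension at most \<open>cdim c\<close>, so
    the closure of one other than \<open>c\<close> cannot meet \<open>c\<close>. Hence removing
    \<open>Q\<close> from the boundary of \<open>z\<close> leaves exactly its part in
    \<open>c\<close>.\<close>
  have cQ: "c \<inter> Q = {}"
  proof -
    have False if "d \<in> F" "d \<noteq> c" "q \<in> c" "q \<in> X closure_of d" for d q
      using closure_cases[OF c _ that(3,4)] F(2,3) that dim by fastforce
    then show ?thesis by (auto simp: Q_def)
  qed
  have QF: "q \<in> Q" if "q \<in> d" "d \<in> F" "d \<noteq> c" for q d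
    using that closure_of_subset[OF cell_subset[of d]] F(2) by (auto simp: Q_def)
  define N where "N = ?B - Q"
  have BX: "?B \<subseteq> topspace X" using closedin_subset[OF closedin_image_sphere_bdry[OF z]] .
  have N: "openin (subtopology X ?B) N"
    unfolding N_def openin_subtopology
    by (rule exI[of _ "topspace X - Q"]) (use Q BX in \<open>auto intro: openin_diff\<close>)
  have Nc: "N = ?B \<inter> c" using F(4) QF cQ by (auto simp: N_def)
  have c_closure: "c \<subseteq> X closure_of c" by (rule closure_of_subset[OF cell_subset[OF c]])
  have W_eq: "{w \<in> disc_set ?n. \<Phi> c w \<in> N} = {w \<in> open_disc ?n. \<Phi> c w \<in> ?B}"
  proof (intro subset_antisym subsetI)
    fix w assume "w \<in> {w \<in> disc_set ?n. \<Phi> c w \<in> N}"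
    then have w: "w \<in> open_disc ?n \<or> w \<in> sphere_bdry ?n" "\<Phi> c w \<in> ?B" "\<Phi> c w \<in> c" by (simp_all add: Nc disc_set_split(1))
    then have "w \<notin> sphere_bdry ?n" using image_sphere_bdry_disjoint[OF c, of "\<Phi> c w"] by blast
    with w show "w \<in> {w \<in> open_disc ?n. \<Phi> c w \<in> ?B}" by simp
  next
    fix w assume w: "w \<in> {w \<in> open_disc ?n. \<Phi> c w \<in> ?B}"
    then have "\<Phi> c w \<in> c" using imageI[of w "open_disc ?n" "\<Phi> c"] image_open_disc[OF c] by simp
    with w show "w \<in> {w \<in> disc_set ?n. \<Phi> c w \<in> N}" by (simp add: Nc disc_set_split(1))
  qed
  have "openin (top_of_set (euclid_set ?n)) {w \<in> open_disc ?n. \<Phi> c w \<in> ?B}"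
    unfolding W_eq[symmetric] by (rule open_preimage[OF z c dim _ N]) (use Nc c_closure in auto)
  then have op: "openin (top_of_set (open_disc ?n)) {w \<in> open_disc ?n. \<Phi> c w \<in> ?B}"
    by (rule openin_subset_trans) (auto simp: open_disc_def)
  have cl: "closedin (top_of_set (open_disc ?n)) {w \<in> open_disc ?n. \<Phi> c w \<in> ?B}"
  proof -
    have "continuous_map (top_of_set (open_disc ?n)) X (\<Phi> c)"
      using homeomorphic_imp_continuous_map[OF open_cell[OF c]]
      by (simp add: disc_interior_open_disc continuous_map_in_subtopology)
    from closedin_continuous_map_preimage[OF this closedin_image_sphere_bdry[OF z]] show ?thesis by simp
  qed
  have "{w \<in> open_disc ?n. \<Phi> c w \<in> ?B} \<noteq> {}"
  proof -
    have "c \<noteq> z" using dim by auto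
    then have "p \<in> ?B" using closure_cases[OF c z p] by blast
    moreover have "p \<in> \<Phi> c ` open_disc ?n" using p(1) unfolding image_open_disc[OF c] .
    then obtain w where "p = \<Phi> c w" "w \<in> open_disc ?n" by (rule imageE)
    ultimately have "w \<in> {w \<in> open_disc ?n. \<Phi> c w \<in> ?B}" by simp
    then show ?thesis by fast
  qed
  then have "{w \<in> open_disc ?n. \<Phi> c w \<in> ?B} = open_disc ?n"
    by (rule disjE[OF connected_open_disc[of ?n, unfolded connected_clopen, rule_format, OF conjI[OF op cl]] notE])
  then have "\<Phi> c ` open_disc ?n \<subseteq> ?B" by blast
  then have "c \<subseteq> ?B" unfolding image_open_disc[OF c] .
  then show ?thesis using closure_cell[OF z] by (auto simp: disc_set_split)
qed

text \<open>If \<open>y\<close> were the only facet of \<open>z\<close> above \<open>x\<close>, then near a point of \<open>x\<close> the sphere bounding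
  \<open>z\<close> would be contained in the closed disc \<open>y\<close>, with that point on the boundary of the disc.\<close>

lemma second_facet:
  assumes x: "x \<in> K" and y: "y \<in> K" and z: "z \<in> K"
    and dims: "cdim y = Suc (cdim x)" "cdim z = Suc (cdim y)"
    and less: "cell_less X x y" "cell_less X y z"
  shows "\<exists>y'\<in>K. y' \<noteq> y \<and> cdim y' = cdim y \<and> cell_less X x y' \<and> cell_less X y' z"
proof (rule ccontr)
  assume no: "\<not> ?thesis"
  let ?B = "\<Phi> z ` sphere_bdry (cdim z)"
  obtain F where F: "finite F" "F \<subseteq> K" "\<forall>c\<in>F. cdim c < cdim z" "?B \<subseteq> \<Union> F"
    using image_sphere_bdry[OF z] by (elim exE conjE)
  obtain p where p: "p \<in> x" using cell_nonempty[OF x] by blast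
  have py: "p \<in> X closure_of y" using p less(1) by (auto simp: cell_less_def)
  then have pz: "p \<in> X closure_of z"
    using closure_subset_closure[of y z] less(2) by (auto simp: cell_less_def)
  have pB: "p \<in> ?B" using closure_cases[OF x z p pz] dims by auto
  \<comment> \<open>Removing the finitely many closures that miss \<open>p\<close> leaves a
    neighbourhood of \<open>p\<close> in the boundary of \<open>z\<close> that meets only cells
    having \<open>p\<close> in their closure.\<close>
  define Q where "Q = \<Union> ((closure_of) X ` {c \<in> F. p \<notin> X closure_of c})"
  have Q: "closedin X Q"
    unfolding Q_def by (rule closedin_Union) (use F(1) in auto)
  define N where "N = ?B - Q"
  have BX: "?B \<subseteq> topspace X" using closedin_subset[OF closedin_image_sphere_bdry[OF z]] .
  have N: "openin (subtopology X ?B) N"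
    unfolding N_def openin_subtopology
    by (rule exI[of _ "topspace X - Q"]) (use Q BX in \<open>auto intro: openin_diff\<close>)
  have pN: "p \<in> N" using pB by (auto simp: N_def Q_def)
  have "q \<in> X closure_of y" if q: "q \<in> N" for q
  proof -
    obtain c where c: "c \<in> F" "q \<in> c" using q F(4) by (auto simp: N_def)
    have cK: "c \<in> K" using c F(2) by blast
    have "q \<in> X closure_of c" using closure_of_subset[OF cell_subset[OF cK]] c(2) by blast
    then have pc: "p \<in> X closure_of c" using q c(1) by (auto simp: N_def Q_def)
    show ?thesis
    proof (cases "c = x")
      case True
      then show ?thesis using c(2) less(1) by (auto simp: cell_less_def)
    next
      case False
      \<comment> \<open>The dimension of \<open>c\<close> lies strictly between those of
        \<open>x\<close> and \<open>z\<close>. Two uses of \<open>meets_facet\<close> then place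
        \<open>c\<close> between \<open>x\<close> and \<open>z\<close>, so the assumption forces
        \<open>c = y\<close>.\<close>
      then have dim: "cdim c = cdim y"
        using closure_cases[OF x cK p pc] bspec[OF F(3) c(1)] dims by auto
      have "q \<in> X closure_of z"
        using q closure_cell[OF z] by (auto simp: N_def disc_set_split)
      then have "c \<subseteq> X closure_of z"
        using meets_facet[OF z cK _ c(2)] dim dims by simp
      moreover have "x \<subseteq> X closure_of c"
        using meets_facet[OF cK x _ p pc] dim dims by simp
      moreover have "c \<noteq> z" using dim dims by auto
      ultimately have "c = y"
        using no cK dim False by (auto simp: cell_less_def)
      then show ?thesis using \<open>q \<in> X closure_of c\<close> by simp
    qed
  qed
  then have "N \<subseteq> X closure_of y" by (rule subsetI)
  then have V: "openin (top_of_set (euclid_set (cdim y))) {w \<in> disc_set (cdim y). \<Phi> y w \<in> N}"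
    by (rule open_preimage[OF z y dims(2) _ N])
  have "x \<noteq> y" using dims by auto
  then have "p \<in> \<Phi> y ` sphere_bdry (cdim y)"
    using closure_cases[OF x y p py] by blast
  then obtain s where s: "s \<in> sphere_bdry (cdim y)" "\<Phi> y s = p" by auto
  \<comment> \<open>The ray through the boundary point \<open>s\<close> over \<open>p\<close>.
    Openness of the parameter set in Euclidean space would let the ray continue inside the disc
    beyond \<open>t = 1\<close>.\<close>
  let ?h = "\<lambda>t i. t * s i :: real"
  have "openin (top_of_set UNIV) (UNIV \<inter> ?h -` {w \<in> disc_set (cdim y). \<Phi> y w \<in> N})"
    by (rule continuous_openin_preimage[OF continuous_on_scalar _ V]) (use s(1) euclid_set_scale in \<open>auto simp: sphere_bdry_def\<close>)
  then have "open (?h -` {w \<in> disc_set (cdim y). \<Phi> y w \<in> N})" by simp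
  moreover have "1 \<in> ?h -` {w \<in> disc_set (cdim y). \<Phi> y w \<in> N}"
    using s pN by (simp add: disc_set_split)
  ultimately obtain e where e: "e > 0" "ball 1 e \<subseteq> ?h -` {w \<in> disc_set (cdim y). \<Phi> y w \<in> N}"
    using open_contains_ball by blast
  have "1 + e / 2 \<in> ball 1 e" using e(1) by (simp add: dist_real_def)
  then have "?h (1 + e / 2) \<in> disc_set (cdim y)" using e(2) by auto
  then have "(1 + e / 2)\<^sup>2 \<le> 1" using s(1) by (simp add: disc_set_def sphere_bdry_def sqsum_scale)
  then show False using e(1) abs_square_le_1[of "1 + e / 2"] by simp
qed

text \<open>Let \<open>y'\<close> be the second facet between \<open>x\<close> and \<open>z\<close>.
  Since \<open>y\<close> is the only exception allowed below \<open>z\<close>,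
  \<open>f y' < f z \<le> f y \<le> f x\<close>, which makes \<open>y'\<close> a second exception
  above \<open>x\<close> besides \<open>y\<close>.\<close>

lemma regular_pairs_disjoint:
  assumes f: "discrete_Morse_function X K cdim f" and xy: "regular_pair X K cdim f x y"
  shows "\<not> regular_pair X K cdim f y z"
proof
  assume yz: "regular_pair X K cdim f y z"
  have c: "x \<in> K" "y \<in> K" "z \<in> K" "cdim y = Suc (cdim x)" "cdim z = Suc (cdim y)" "cell_less X x y" "cell_less X y z"
    and le: "f y \<le> f x" "f z \<le> f y"
    using xy yz by (auto simp: regular_pair_def)
  obtain y' where y': "y' \<in> K" "y' \<noteq> y" "cdim y' = cdim y" "cell_less X x y'" "cell_less X y' z"
    using second_facet[OF c] by blast
  have "\<not> f z \<le> f y'"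
    using f c y' le unfolding discrete_Morse_function_def Uniq_def by (metis add.commute plus_1_eq_Suc)
  then have "f y' \<le> f x" using le by simp
  then show False
    using f c y' le unfolding discrete_Morse_function_def Uniq_def by (metis add.commute plus_1_eq_Suc)
qed

end

theorem theoremB:
  fixes X :: "'a topology" and K :: "'a set set" and cdim :: "'a set \<Rightarrow> nat"
    and \<Phi> :: "'a set \<Rightarrow> (nat \<Rightarrow> real) \<Rightarrow> 'a" and f :: "'a set \<Rightarrow> real"
  assumes "regular_CW_complex X K cdim \<Phi>"
    and "finite K"
    and "discrete_Morse_function X K cdim f"
    and "A = FS (double_nerve (Flo X K cdim f))"
  shows "\<forall>r\<ge>2. \<forall>p q. \<forall>\<xi>\<in>carrier (Epage A r p q).
           Ediff A r p q \<xi> = \<one>\<^bsub>Epage A r (p - int r) (q + int r - 1)\<^esub>"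
proof -
  interpret regular_CW_complex X K cdim \<Phi> by (rule assms(1))
  have "matched_cells X K cdim f"
  proof
    show "cdim y < cdim x" if "x \<in> K" "y \<in> K" "cell_less X y x" for x y
      using cell_less_dim that .
    show "y = y'" if "regular_pair X K cdim f x y" "regular_pair X K cdim f x y'" for x y y'
      using assms(3) that unfolding discrete_Morse_function_def Uniq_def regular_pair_def by blast
    show "x = x'" if "regular_pair X K cdim f x y" "regular_pair X K cdim f x' y" for x x' y
      using assms(3) that unfolding discrete_Morse_function_def Uniq_def regular_pair_def by blast
    show "\<not> regular_pair X K cdim f y z" if "regular_pair X K cdim f x y" for x y z
      using regular_pairs_disjoint[OF assms(3) that] .
  qed
  then show ?thesis
    unfolding assms(4)
    using free_pcat.spectral_sequence_collapses[OF matched_cells.free_pcat_Flo] by blast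
qed

end
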